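(* Let $L|K$ be a field extension with $(L^\times/K^\times)[\ell^\infty]=1$, i.e. $(L^{\times})^\ell\cap K^\times=(K^{\times})^\ell$, if $\operatorname{char}K=\ell>0$, and let $U\supseteq K^\times$ be a subgroup of $L^\times$. Let $x_i$, $i\in I$, be a full system of representatives for the elements of $U/K^\times$. Then $E:=\sum_{i\in I}Kx_i$ is a $K$-subalgebra of $L$ and the following conditions are equivalent: 1. $E$ is a field and the $x_i$, $i\in I$, are linearly independent over $K$. 2. $K^\times\hookrightarrow U$ is an essential extension of groups, and $1+i\notin U$ if $U$ contains a root of unity $i$ of order $4$ not in $K^\times$. If these conditions hold, $E$ is a separable algebraic field extension of $K$ of degree $[E:K]=[U:K^\times]$.
   Context: For a multiplicatively written abelian group $G$ and a prime $p$, $G[p^\infty]=\{x\in G: x^{p^k}=1\text{ for some }k\ge1\}$. An extension $H\subseteq G$ of abelian groups is essential if every subgroup $F\subseteq G$ with $F\cap H=1$ is trivial. (In condition 2, the symbol $i$ in $1+i$ denotes the root of unity of order $4$, not an index in $I$.) *)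

theory Defs
  imports "HOL-Algebra.Algebra"
begin

definition primary_torsion :: "('a, 'b) monoid_scheme \<Rightarrow> nat \<Rightarrow> 'a set" where
  "primary_torsion G p = {x \<in> carrier G. \<exists>k\<ge>(1::nat). x [^]\<^bsub>G\<^esub> (p ^ k) = \<one>\<^bsub>G\<^esub>}"

definition essential_extension :: "('a, 'b) monoid_scheme \<Rightarrow> 'a set \<Rightarrow> bool" where
  "essential_extension G H \<longleftrightarrow>
     subgroup H G \<and> (\<forall>F. subgroup F G \<and> F \<inter> H = {\<one>\<^bsub>G\<^esub>} \<longrightarrow> F = {\<one>\<^bsub>G\<^esub>})"

definition coset_representatives ::
    "('a, 'b) monoid_scheme \<Rightarrow> 'a set \<Rightarrow> 'i set \<Rightarrow> ('i \<Rightarrow> 'a) \<Rightarrow> bool" where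
  "coset_representatives G H I x \<longleftrightarrow>
     x \<in> I \<rightarrow> carrier G \<and> bij_betw (\<lambda>i. H #>\<^bsub>G\<^esub> x i) I (rcosets\<^bsub>G\<^esub> H)"

text \<open>The order of an element of infinite order is \<open>0\<close>, so this is \<open>0\<close> in characteristic zero.\<close>

definition ring_char :: "('a, 'b) ring_scheme \<Rightarrow> nat" where
  "ring_char R = group.ord (add_monoid R) \<one>\<^bsub>R\<^esub>"

context ring
begin

text \<open>
  The library's \<open>Span\<close> and \<open>independent\<close> take finite lists of vectors; the two definitions below
  extend them to families with an arbitrary index set. \<open>Span K [u, v, \<dots>]\<close> is
  \<open>K u + K v + \<dots>\<close>. In \<open>family_independent\<close> only the indices are required to be distinct,
  so a family with a repeated vector is dependent.
\<close>

definition family_span :: "'a set \<Rightarrow> ('i \<Rightarrow> 'a) \<Rightarrow> 'i set \<Rightarrow> 'a set" where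
  "family_span K x I = (\<Union>is \<in> lists I. Span K (map x is))"

definition family_independent :: "'a set \<Rightarrow> ('i \<Rightarrow> 'a) \<Rightarrow> 'i set \<Rightarrow> bool" where
  "family_independent K x I \<longleftrightarrow> (\<forall>is \<in> lists I. distinct is \<longrightarrow> independent K (map x is))"

definition is_basis :: "'a set \<Rightarrow> 'a set \<Rightarrow> 'a set \<Rightarrow> bool" where
  "is_basis K E B \<longleftrightarrow> family_independent K (\<lambda>b. b) B \<and> family_span K (\<lambda>b. b) B = E"

text \<open>
  The degree \<open>[E : K]\<close> as a cardinal (the library's \<open>dim\<close> is meaningful only in finite
  dimension).
\<close>

definition ext_degree :: "'a set \<Rightarrow> 'a set \<Rightarrow> 'a rel" where
  "ext_degree K E = card_of (SOME B. is_basis K E B)"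

text \<open>Polynomials are coefficient lists, leading coefficient first.\<close>

definition poly_deriv :: "'a list \<Rightarrow> 'a list" where
  "poly_deriv p = normalize (map (\<lambda>k. [Suc k] \<cdot> coeff p (Suc k)) (rev [0..<degree p]))"

definition separable_poly :: "'a set \<Rightarrow> 'a list \<Rightarrow> bool" where
  "separable_poly K p \<longleftrightarrow>
     (\<forall>d \<in> carrier (K[X]). d divides\<^bsub>K[X]\<^esub> p \<and> d divides\<^bsub>K[X]\<^esub> poly_deriv p
        \<longrightarrow> d \<in> Units (K[X]))"

definition separable_algebraic_ext :: "'a set \<Rightarrow> 'a set \<Rightarrow> bool" where
  "separable_algebraic_ext K E \<longleftrightarrow>
     subfield K R \<and> subfield E R \<and> K \<subseteq> E \<and>
     (\<forall>y \<in> E. (algebraic over K) y \<and> separable_poly K (Irr K y))"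

end

text \<open>
  The library's \<open>subalgebra\<close> asserts only that the set is a \<open>K\<close>-subspace; closure under
  multiplication and \<open>\<one>\<close> come from \<open>subring\<close>.
\<close>

definition unital_subalgebra :: "'a set \<Rightarrow> 'a set \<Rightarrow> ('a, 'b) ring_scheme \<Rightarrow> bool" where
  "unital_subalgebra K E R \<longleftrightarrow> subalgebra K E R \<and> subring E R"

definition group_index :: "('a, 'b) monoid_scheme \<Rightarrow> 'a set \<Rightarrow> 'a set rel" where
  "group_index G H = card_of (rcosets\<^bsub>G\<^esub> H)"

end

theory Submission
  imports Defs
begin

text \<open>
  If $E$ is a field and the $x_i$ are independent, an element $u \<in> U$ of infinite order modulo
  $K^\times$ would make $(u-1)^{-1}$ a finite combination of elements of $U$, which contradicts
  $(1 + u + \dots + u^{n-1})(u-1) = u^n - 1$ for large $n$; a root of unity of prime order outside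
  $K$ contradicts $1 + \zeta + \dots + \zeta^{p-1} = 0$, and $1+i \<in> U$ is itself a dependence.
  With torsion, essentiality means that $U$ has no roots of unity of prime order outside $K$.

  Conversely (Kneser), work in an algebraic closure and treat the primes $p$ in increasing
  order. For odd $p$ let $F \<supseteq> K$ be maximal such that $p$-th powers lying in $K$ remain $p$-th
  powers of $K$. By a norm argument $F$ absorbs all equations of degree below $p$, in particular the
  $p$-th roots of unity and the part of $U$ treated so far, while the $p$-primary part
  of $U$ meets $F$ only in $K$. Over $F$ the $p$-primary part is independent by Kummer theory. For
  $p = 2$ the field $K(i)$ plays the role of $F$, and the condition on $1+i$ controls $U \<inter> K(i)$.

  For separability in characteristic $\ell$, each $y \<in> E$ lies in a finite extension $M$ generated
  by elements of order prime to $\ell$ modulo $K^\times$. The $\ell$-th powers of a basis of $M$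
  span $M$ again, so $y^\ell$ has the same degree as $y$, which excludes a minimal polynomial
  in $X^\ell$.
\<close>

hide_const (open) Divisibility.prime

text \<open>U modulo K^\<times> may be infinite and need not be finitely generated, so independence
  is stated for finite sets of pairwise non-proportional elements of a group and carried through
  towers K \<subseteq> F: the classes of G modulo K^\<times> are sorted by their classes modulo
  F^\<times>. The obstacle is that K lacks the roots of unity that Kummer theory asks for, and
  adjoining them could create new p-th powers among the elements of K. Extensions of degree below p
  do no such harm at p, which is why the primes are taken in increasing order; as these extensions
  leave L, an algebraic closure is used. At p = 2 only linear equations have degree below p, so a
  fourth root of unity must be adjoined by a quadratic extension, and (1 + i)^2 = 2 i shows what can
  go wrong there. The hypothesis in characteristic l says that l-th roots of elements of K add
  nothing to U: this prime is skipped in the induction, and it keeps inseparable elements out of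
  E.\<close>

lemma (in ring) subgroup_finsum_closed:
  assumes V: "subgroup V (add_monoid R)" and "finite A" "\<And>i. i \<in> A \<Longrightarrow> f i \<in> V"
  shows "(\<Oplus>i\<in>A. f i) \<in> V"
  using assms(2,3)
proof (induct A)
  case empty thus ?case using subgroup.one_closed[OF V] by simp
next
  case (insert a A)
  have "(\<Oplus>i\<in>insert a A. f i) = f a \<oplus> (\<Oplus>i\<in>A. f i)"
    by (rule finsum_insert) (use insert subgroup.subset[OF V] in auto)
  thus ?case using subgroup.m_closed[OF V, of "f a" "\<Oplus>i\<in>A. f i"] insert by simp
qed

section \<open>Powers, roots of unity and descent along exponents\<close>

context field
begin

lemma subfield_closed:
  assumes "subfield K R"
  shows "x \<in> K \<Longrightarrow> x \<in> carrier R" and "\<zero> \<in> K" and "\<one> \<in> K"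
    and "x \<in> K \<Longrightarrow> \<ominus> x \<in> K"
    and "\<lbrakk> x \<in> K; y \<in> K \<rbrakk> \<Longrightarrow> x \<otimes> y \<in> K" and "\<lbrakk> x \<in> K; y \<in> K \<rbrakk> \<Longrightarrow> x \<oplus> y \<in> K"
    and "\<lbrakk> x \<in> K; x \<noteq> \<zero> \<rbrakk> \<Longrightarrow> inv x \<in> K" and "x \<in> K \<Longrightarrow> x [^] (n::nat) \<in> K"
    and "\<lbrakk> x \<in> K; y \<in> K \<rbrakk> \<Longrightarrow> x \<ominus> y \<in> K"
proof -
  note sr = subfieldE(1)[OF assms]
  show "x \<in> K \<Longrightarrow> x \<in> carrier R" using subringE(1)[OF sr] by auto
  show "\<zero> \<in> K" "\<one> \<in> K" "x \<in> K \<Longrightarrow> \<ominus> x \<in> K" "\<lbrakk> x \<in> K; y \<in> K \<rbrakk> \<Longrightarrow> x \<otimes> y \<in> K"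
    "\<lbrakk> x \<in> K; y \<in> K \<rbrakk> \<Longrightarrow> x \<oplus> y \<in> K"
    using subringE[OF sr] by auto
  show "\<lbrakk> x \<in> K; x \<noteq> \<zero> \<rbrakk> \<Longrightarrow> inv x \<in> K" using subfield_m_inv(1)[OF assms, of x] by auto
  show "x [^] n \<in> K" if "x \<in> K"
    by (induct n) (use that subringE[OF sr] in auto)
  show "\<lbrakk> x \<in> K; y \<in> K \<rbrakk> \<Longrightarrow> x \<ominus> y \<in> K"
    using subringE[OF sr] by (simp add: a_minus_def)
qed

lemma nonzero_inv:
  assumes "x \<in> carrier R" "x \<noteq> \<zero>"
  shows "inv x \<in> carrier R" "inv x \<noteq> \<zero>" "x \<otimes> inv x = \<one>" "inv x \<otimes> x = \<one>"
proof -
  have u: "x \<in> Units R" using assms field_Units by auto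
  show "inv x \<in> carrier R" "x \<otimes> inv x = \<one>" "inv x \<otimes> x = \<one>" using u by auto
  thus "inv x \<noteq> \<zero>" using assms by auto
qed

lemma pow_nonzero:
  assumes "x \<in> carrier R" "x \<noteq> \<zero>" shows "x [^] (n::nat) \<noteq> \<zero>"
  by (induct n) (use assms integral in auto)

lemma inv_pow:
  assumes "x \<in> carrier R" "x \<noteq> \<zero>" shows "(inv x) [^] (n::nat) = inv (x [^] n)"
  using nonzero_inv[OF assms] nonzero_inv[OF _ pow_nonzero[OF assms, of n]] assms
  by (metis inv_char nat_pow_closed nat_pow_distrib nat_pow_one m_comm)

lemma eval_mem_subfield:
  assumes "subfield F R" "x \<in> F" shows "set f \<subseteq> F \<Longrightarrow> eval f x \<in> F"
  by (induct f) (use subfield_closed[OF assms(1)] assms(2) in auto)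

text \<open>By Bezout, j is invertible modulo q. Knowing one power of u with exponent prime to q
  inside a field therefore puts u itself there.\<close>

lemma power_coprime_eq:
  assumes q: "prime (q::nat)" "\<not> q dvd j" and u: "u \<in> carrier R" "u [^] q = \<one>"
  shows "\<exists>s. u = (u [^] j) [^] (s::nat)"
proof -
  have "coprime j q" using prime_imp_coprime[OF q] by (simp add: coprime_commute)
  moreover have "j \<noteq> 0" using q(2) by (intro notI) simp
  ultimately obtain s t where st: "j * s = q * t + 1" using bezout_nat[of j q] by auto
  have "u = u [^] (q * t + 1)" using u nat_pow_pow[OF u(1), of q t, symmetric] by simp
  also have "\<dots> = (u [^] j) [^] s" unfolding st[symmetric] using u by (simp add: nat_pow_pow)
  finally show ?thesis by blast
qed

lemma pow_eq_quotient:
  assumes x: "x \<in> carrier R" "x \<noteq> \<zero>" and b: "b \<in> carrier R" "b [^] n = x [^] (n::nat)" and "n > 0"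
  shows "b \<noteq> \<zero>" "(x \<otimes> inv b) [^] n = \<one>" "x \<otimes> inv b \<otimes> b = x"
proof -
  show b0: "b \<noteq> \<zero>" using b(2) \<open>n > 0\<close> nat_pow_zero[of n] pow_nonzero[OF x, of n] by auto
  note i = nonzero_inv[OF b(1) b0]
  show "(x \<otimes> inv b) [^] n = \<one>"
    using x i b inv_pow[OF b(1) b0] pow_nonzero[OF x, of n] nonzero_inv(3)[of "x [^] n"]
    by (simp add: nat_pow_distrib)
  show "x \<otimes> inv b \<otimes> b = x" using x i b by (simp add: m_assoc)
qed

text \<open>Strips prime factors off the exponent: with m = q k, the element u^k lies in A because
  its q-th power does, and k < m. Since A is any set and only primes dividing the original exponent
  occur, the same induction serves fields, the trivial group and bounded sets of primes.\<close>

lemma exponent_descent: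
  assumes V: "V \<subseteq> carrier R" "\<And>v n. v \<in> V \<Longrightarrow> v [^] (n::nat) \<in> V"
    and "m > 0" "\<And>q v. \<lbrakk> prime (q::nat); q dvd m; v \<in> V; v [^] q \<in> A \<rbrakk> \<Longrightarrow> v \<in> A" "u \<in> V" "u [^] (m::nat) \<in> A"
  shows "u \<in> A"
  using assms(3-)
proof (induct m arbitrary: u rule: less_induct)
  case (less m)
  have uc: "u \<in> carrier R" using V(1) less(4) by blast
  show ?case
  proof (cases "m = 1")
    case True thus ?thesis using less(5) uc by simp
  next
    case False
    then obtain q where q: "prime q" "q dvd m" using prime_factor_nat by blast
    then obtain k where k: "m = q * k" by auto
    have km: "k < m" "k > 0" using k less(2) prime_gt_1_nat[OF q(1)] by auto
    have "(u [^] k) [^] q \<in> A" using less(5) uc k by (simp add: nat_pow_pow mult.commute)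
    hence "u [^] k \<in> A" using less(3)[OF q] V(2)[OF less(4)] by blast
    moreover have "r dvd m" if "r dvd k" for r using that k by simp
    ultimately show ?thesis by (intro less(1)[OF km less(3) less(4)])
  qed
qed

lemma prime_power_descent:
  assumes p: "prime (p::nat)" and V: "V \<subseteq> carrier R" "\<And>v n. v \<in> V \<Longrightarrow> v [^] (n::nat) \<in> V"
    and step: "\<And>v. \<lbrakk> v \<in> V; v [^] p \<in> A \<rbrakk> \<Longrightarrow> v \<in> A" and u: "u \<in> V" "u [^] (p ^ n) \<in> A"
  shows "u \<in> A"
proof (rule exponent_descent[OF V _ _ u])
  show "p ^ n > 0" using prime_gt_0_nat[OF p] by simp
  show "v \<in> A" if "prime q" "q dvd p ^ n" "v \<in> V" "v [^] q \<in> A" for q v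
    using that(3,4) step unfolding primes_dvd_imp_eq[OF that(1) p prime_dvd_power[OF that(1,2)]] by blast
qed

section \<open>Independence modulo scalars and its behaviour in towers\<close>

abbreviation nonproportional :: "'a set \<Rightarrow> 'a set \<Rightarrow> bool" where
  "nonproportional K S \<equiv> \<forall>s\<in>S. \<forall>t\<in>S. \<forall>k\<in>K. s \<noteq> t \<longrightarrow> s \<noteq> k \<otimes> t"

text \<open>
  For a group $G$: representatives of distinct classes of $G$ modulo $K^\times$ are linearly
  independent over $K$.
\<close>

definition class_independent :: "'a set \<Rightarrow> 'a set \<Rightarrow> bool" where
  "class_independent K G \<longleftrightarrow>
    (\<forall>S c. finite S \<and> S \<subseteq> G \<and> nonproportional K S \<and> c \<in> S \<rightarrow> K
      \<and> (\<Oplus>s\<in>S. c s \<otimes> s) = \<zero> \<longrightarrow> (\<forall>s\<in>S. c s = \<zero>))"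

lemma class_independentI:
  assumes "\<And>S c s. \<lbrakk> finite S; S \<subseteq> G; nonproportional K S; c \<in> S \<rightarrow> K; (\<Oplus>s\<in>S. c s \<otimes> s) = \<zero>; s \<in> S \<rbrakk> \<Longrightarrow> c s = \<zero>"
  shows "class_independent K G"
  unfolding class_independent_def by (intro allI impI ballI, elim conjE) (rule assms)

lemma class_independentD:
  assumes "class_independent K G" "K \<subseteq> carrier R" "G \<subseteq> carrier R" "finite A" "f \<in> A \<rightarrow> G" "c \<in> A \<rightarrow> K"
    and ne: "\<And>i j k. \<lbrakk> i \<in> A; j \<in> A; i \<noteq> j; k \<in> K \<rbrakk> \<Longrightarrow> f i \<noteq> k \<otimes> f j"
    and "\<one> \<in> K"
    and eq: "(\<Oplus>i\<in>A. c i \<otimes> f i) = \<zero>" and "i \<in> A"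
  shows "c i = \<zero>"
proof -
  have inj: "inj_on f A"
  proof (rule inj_onI, rule ccontr)
    fix x y assume "x \<in> A" "y \<in> A" "f x = f y" "x \<noteq> y"
    moreover have "f y \<in> carrier R" using assms(3,5) \<open>y \<in> A\<close> by auto
    ultimately show False using ne[of x y "\<one>"] \<open>\<one> \<in> K\<close> by auto
  qed
  have car: "f i \<in> carrier R" "c i \<in> carrier R" "f i \<in> G" "c i \<in> K" if "i \<in> A" for i
    using that assms(2,3) funcset_mem[OF assms(5)] funcset_mem[OF assms(6)] by auto
  let ?g = "the_inv_into A f"
  have g: "?g (f i) = i" if "i \<in> A" for i using inj that by (simp add: the_inv_into_f_f)
  have "(\<Oplus>s\<in>f ` A. c (?g s) \<otimes> s) = (\<Oplus>i\<in>A. c (?g (f i)) \<otimes> f i)"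
    by (rule finsum_reindex[OF _ inj]) (use car g in auto)
  also have "\<dots> = (\<Oplus>i\<in>A. c i \<otimes> f i)"
    by (rule finsum_cong') (use car g in auto)
  finally have z: "(\<Oplus>s\<in>f ` A. c (?g s) \<otimes> s) = \<zero>" using eq by simp
  have "\<forall>s\<in>f ` A. c (?g s) = \<zero>"
  proof (rule assms(1)[unfolded class_independent_def, THEN spec, THEN spec, THEN mp], safe)
    fix i j k assume "i \<in> A" "j \<in> A" "k \<in> K" "f i \<noteq> f j" "f i = k \<otimes> f j"
    thus False using ne[of i j k] by (cases "i = j") auto
  qed (use z assms(4) g car \<open>i \<in> A\<close> in auto)
  thus ?thesis using g[OF \<open>i \<in> A\<close>] \<open>i \<in> A\<close> by auto
qed

lemma class_independent_mono:
  "class_independent K G \<Longrightarrow> G' \<subseteq> G \<Longrightarrow> class_independent K G'"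
  unfolding class_independent_def by (meson subset_trans)

text \<open>A relation involves only finitely many elements. This finite character is what lets
  independence pass to unions of chains and to U as a union of parts with bounded primes.\<close>

lemma class_independent_finite_subsets:
  assumes "\<And>S. \<lbrakk> finite S; S \<subseteq> G \<rbrakk> \<Longrightarrow> \<exists>H. S \<subseteq> H \<and> class_independent K H"
  shows "class_independent K G"
  unfolding class_independent_def
proof (intro allI impI, elim conjE)
  fix S c assume S: "finite S" "S \<subseteq> G" and r: "nonproportional K S" "c \<in> S \<rightarrow> K"
    "(\<Oplus>s\<in>S. c s \<otimes> s) = \<zero>"
  obtain H where "S \<subseteq> H" "class_independent K H" using assms[OF S] by blast
  thus "\<forall>s\<in>S. c s = \<zero>" using S(1) r unfolding class_independent_def by blast
qed

text \<open>The scalar f moves into the coefficient, and proportional g would give proportional x.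
  Independence is thus transferred from a known set of classes to a group covered by them.\<close>

lemma class_independent_rescale:
  assumes ci: "class_independent F G" and F: "subfield F R" and G: "G \<subseteq> carrier R"
    and G': "\<And>x. x \<in> G' \<Longrightarrow> \<exists>f\<in>F. \<exists>g\<in>G. f \<noteq> \<zero> \<and> x = f \<otimes> g"
  shows "class_independent F G'"
proof (rule class_independentI)
  fix S c s assume S: "finite S" "S \<subseteq> G'" and ne: "nonproportional F S"
    and c: "c \<in> S \<rightarrow> F" and eq: "(\<Oplus>s\<in>S. c s \<otimes> s) = \<zero>" and s: "s \<in> S"
  have "\<forall>x\<in>S. \<exists>f g. f \<in> F \<and> g \<in> G \<and> f \<noteq> \<zero> \<and> x = f \<otimes> g" using G' S(2) by blast
  then obtain f g where fg: "\<And>x. x \<in> S \<Longrightarrow> f x \<in> F" "\<And>x. x \<in> S \<Longrightarrow> g x \<in> G"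
      "\<And>x. x \<in> S \<Longrightarrow> f x \<noteq> \<zero>" "\<And>x. x \<in> S \<Longrightarrow> x = f x \<otimes> g x" by metis
  note Fc = subfield_closed[OF F]
  have gc: "g x \<in> carrier R" if "x \<in> S" for x using fg(2)[OF that] G by auto
  have cF: "c x \<in> F" if "x \<in> S" for x using funcset_mem[OF c that] .
  have "(\<Oplus>x\<in>S. (c x \<otimes> f x) \<otimes> g x) = (\<Oplus>x\<in>S. c x \<otimes> x)"
  proof (rule finsum_cong')
    fix x assume x: "x \<in> S"
    have "c x \<otimes> f x \<otimes> g x = c x \<otimes> (f x \<otimes> g x)"
      using Fc(1)[OF cF[OF x]] Fc(1)[OF fg(1)[OF x]] gc[OF x] by (rule m_assoc)
    thus "c x \<otimes> f x \<otimes> g x = c x \<otimes> x" using fg(4)[OF x] by argo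
  next
    show "(\<lambda>x. c x \<otimes> x) \<in> S \<rightarrow> carrier R"
    proof
      fix x assume x: "x \<in> S"
      have "f x \<otimes> g x \<in> carrier R" using x fg(1) gc Fc(1) by auto
      thus "c x \<otimes> x \<in> carrier R" using x fg(4)[OF x] Fc(1)[OF cF[OF x]] by auto
    qed
  qed auto
  hence z: "(\<Oplus>x\<in>S. (c x \<otimes> f x) \<otimes> g x) = \<zero>" using eq by simp
  have "c s \<otimes> f s = \<zero>"
  proof (rule class_independentD[OF ci _ G S(1), of g "\<lambda>x. c x \<otimes> f x", OF _ _ _ _ _ z s])
    fix i j k assume ij: "i \<in> S" "j \<in> S" "i \<noteq> j" "k \<in> F"
    show "g i \<noteq> k \<otimes> g j"
    proof
      assume e: "g i = k \<otimes> g j"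
      let ?k = "f i \<otimes> k \<otimes> inv (f j)"
      have car: "f i \<in> carrier R" "f j \<in> carrier R" "k \<in> carrier R" "g j \<in> carrier R" "inv (f j) \<in> carrier R"
        using ij fg(1,3) Fc(1,7) gc by auto
      have "i = f i \<otimes> (k \<otimes> g j)" using fg(4)[OF ij(1)] e by argo
      also have "\<dots> = f i \<otimes> k \<otimes> (inv (f j) \<otimes> f j) \<otimes> g j"
        using car nonzero_inv(4)[of "f j"] fg(3)[OF ij(2)] by (simp add: m_assoc)
      also have "\<dots> = ?k \<otimes> (f j \<otimes> g j)" using car by (simp add: m_assoc)
      finally have "i = ?k \<otimes> j" using fg(4)[OF ij(2)] by argo
      moreover have "?k \<in> F" using ij fg(1,3) Fc(5,7) by auto
      ultimately show False using ne ij by blast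
    qed
  qed (use Fc(1,3) Fc(5)[OF cF fg(1)] fg(2) in auto)
  thus "c s = \<zero>" using integral[of "c s" "f s"] fg(1,3)[OF s] cF[OF s] Fc(1) by auto
qed

text \<open>Group elements are constantly added to each other, so subgroups of the unit group are
  kept as plain sets of field elements; \<open>subgroup_units_iff\<close> links them to
  \<open>units_of R\<close>.\<close>

definition mult_subgroup :: "'a set \<Rightarrow> bool" where
  "mult_subgroup G \<longleftrightarrow> G \<subseteq> carrier R - {\<zero>} \<and> \<one> \<in> G \<and> (\<forall>x\<in>G. \<forall>y\<in>G. x \<otimes> y \<in> G) \<and> (\<forall>x\<in>G. inv x \<in> G)"

lemma mult_subgroupD:
  assumes "mult_subgroup G"
  shows "x \<in> G \<Longrightarrow> x \<in> carrier R" "x \<in> G \<Longrightarrow> x \<noteq> \<zero>" "\<one> \<in> G" "x \<in> G \<Longrightarrow> y \<in> G \<Longrightarrow> x \<otimes> y \<in> G"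
    "x \<in> G \<Longrightarrow> inv x \<in> G" "x \<in> G \<Longrightarrow> x [^] (n::nat) \<in> G"
proof -
  show p: "x \<in> G \<Longrightarrow> x \<in> carrier R" "x \<in> G \<Longrightarrow> x \<noteq> \<zero>" "\<one> \<in> G" "x \<in> G \<Longrightarrow> y \<in> G \<Longrightarrow> x \<otimes> y \<in> G"
    "x \<in> G \<Longrightarrow> inv x \<in> G" using assms unfolding mult_subgroup_def by auto
  show "x \<in> G \<Longrightarrow> x [^] n \<in> G"
    using assms unfolding mult_subgroup_def by (induct n) auto
qed

lemma subgroup_units_iff: "subgroup U (units_of R) \<longleftrightarrow> mult_subgroup U"
proof
  assume "subgroup U (units_of R)"
  then interpret U: subgroup U "units_of R" .
  have UU: "x \<in> Units R" if "x \<in> U" for x using U.subset that by (auto simp: units_of_carrier)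
  show "mult_subgroup U"
    unfolding mult_subgroup_def
  proof (intro conjI ballI)
    show "U \<subseteq> carrier R - {\<zero>}" using UU field_Units by auto
    show "\<one> \<in> U" using U.one_closed by (simp add: units_of_one)
    show "x \<otimes> y \<in> U" if "x \<in> U" "y \<in> U" for x y using U.m_closed[OF that] by (simp add: units_of_mult)
    show "inv x \<in> U" if "x \<in> U" for x using U.m_inv_closed[OF that] units_of_inv[OF UU[OF that]] by simp
  qed
next
  assume U: "mult_subgroup U"
  have UU: "x \<in> Units R" if "x \<in> U" for x using U that field_Units unfolding mult_subgroup_def by auto
  show "subgroup U (units_of R)"
  proof (rule subgroup.intro)
    show "U \<subseteq> carrier (units_of R)" using UU by (auto simp: units_of_carrier)
    show "\<one>\<^bsub>units_of R\<^esub> \<in> U" using mult_subgroupD(3)[OF U] by (simp add: units_of_one)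
    show "x \<otimes>\<^bsub>units_of R\<^esub> y \<in> U" if "x \<in> U" "y \<in> U" for x y
      using mult_subgroupD(4)[OF U that] by (simp add: units_of_mult)
    show "inv\<^bsub>units_of R\<^esub> x \<in> U" if "x \<in> U" for x
      using mult_subgroupD(5)[OF U that] units_of_inv[OF UU[OF that]] by simp
  qed
qed

lemma mult_subgroup_subfield: assumes "subfield K R" shows "mult_subgroup (K - {\<zero>})"
  unfolding mult_subgroup_def
proof (intro conjI ballI)
  note Kc = subfield_closed[OF assms]
  show "K - {\<zero>} \<subseteq> carrier R - {\<zero>}" using Kc(1) by auto
  show "\<one> \<in> K - {\<zero>}" using Kc(3) by simp
  fix x assume x: "x \<in> K - {\<zero>}"
  have xc: "x \<in> carrier R" "x \<noteq> \<zero>" using x Kc(1) by auto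
  show "inv x \<in> K - {\<zero>}" using x Kc(7) nonzero_inv(2)[OF xc] by auto
  fix y assume y: "y \<in> K - {\<zero>}"
  show "x \<otimes> y \<in> K - {\<zero>}" using x y Kc(5) integral[of x y] Kc(1) by auto
qed

lemma mult_subgroup_Int_subfield:
  "mult_subgroup G \<Longrightarrow> subfield F R \<Longrightarrow> mult_subgroup (G \<inter> F)"
  using subfield_closed(3,5,7)[of F] unfolding mult_subgroup_def by auto

text \<open>A relation over K is sorted by the classes of its terms modulo F^\<times>. With r x a
  representative of the class of x and h x = x / r x in G \<inter> F, the coefficient of each
  representative is a sum of terms c x h x. Independence over F kills these sums, and independence
  over K inside G \<inter> F then kills every c x.\<close>

lemma class_independent_tower:
  assumes K: "subfield K R" and F: "subfield F R" and KF: "K \<subseteq> F" and G: "mult_subgroup G"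
    and low: "class_independent K (G \<inter> F)" and up: "class_independent F G"
  shows "class_independent K G"
proof (rule class_independentI)
  fix S c s assume S: "finite S" "S \<subseteq> G" and ne: "nonproportional K S"
    and c: "c \<in> S \<rightarrow> K" and eq: "(\<Oplus>s\<in>S. c s \<otimes> s) = \<zero>" and s: "s \<in> S"
  note Fc = subfield_closed[OF F] note Kc = subfield_closed[OF K] note Gc = mult_subgroupD[OF G]
  have Sc: "x \<in> carrier R" "x \<noteq> \<zero>" if "x \<in> S" for x using that S Gc by auto
  interpret G: group "units_of R" by (rule units_group)
  let ?H = "F - {\<zero>}"
  have H: "subgroup ?H (units_of R)" using mult_subgroup_subfield[OF F] subgroup_units_iff by simp
  have SG: "x \<in> carrier (units_of R)" if "x \<in> S" for x using Sc[OF that] field_Units by (simp add: units_of_carrier)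
  have coset: "?H #>\<^bsub>units_of R\<^esub> v = {k \<otimes> v | k. k \<in> ?H}" for v by (auto simp: r_coset_def units_of_mult)
  \<comment> \<open>In the predicate x occurs only through its coset, so the choice depends on the
    coset alone.\<close>
  define r where "r x = (SOME t. t \<in> S \<and> ?H #>\<^bsub>units_of R\<^esub> t = ?H #>\<^bsub>units_of R\<^esub> x)" for x
  have r: "r x \<in> S" "x \<otimes> inv (r x) \<in> F" if x: "x \<in> S" for x
  proof -
    have *: "r x \<in> S \<and> ?H #>\<^bsub>units_of R\<^esub> r x = ?H #>\<^bsub>units_of R\<^esub> x" unfolding r_def by (rule someI[of _ x]) (use x in simp)
    thus rS: "r x \<in> S" by simp
    have "x \<in> ?H #>\<^bsub>units_of R\<^esub> r x" using G.rcos_self[OF SG[OF x] H] * by simp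
    then obtain k where k: "k \<in> F" "x = k \<otimes> r x" unfolding coset by auto
    have "x \<otimes> inv (r x) = k \<otimes> (r x \<otimes> inv (r x))"
      using k Fc(1) Sc[OF rS] nonzero_inv(1)[OF Sc[OF rS]] by (metis m_assoc)
    thus "x \<otimes> inv (r x) \<in> F" using k(1) Fc(1) nonzero_inv(3)[OF Sc[OF rS]] by simp
  qed
  have rr: "r x = r y" if xy: "x \<in> S" "y \<in> S" "x = k \<otimes> y" "k \<in> F" for x y k
  proof -
    have "k \<noteq> \<zero>" using Sc(2)[OF xy(1)] Sc(1)[OF xy(2)] xy(3) by (metis l_null)
    hence "x \<in> ?H #>\<^bsub>units_of R\<^esub> y" unfolding coset using xy(3,4) by blast
    from G.repr_independence[OF this SG[OF xy(2)] H] show ?thesis unfolding r_def by simp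
  qed
  define h where "h x = x \<otimes> inv (r x)" for x
  have h: "h x \<in> F" "h x \<in> G" "x = h x \<otimes> r x" "h x \<in> carrier R" if x: "x \<in> S" for x
  proof -
    show "h x \<in> F" using r x unfolding h_def by auto
    show "h x \<in> G" using Gc(4)[of x "inv (r x)"] Gc(5)[of "r x"] r(1)[OF x] x S unfolding h_def by auto
    show "x = h x \<otimes> r x" unfolding h_def using Sc[OF x] Sc[OF r(1)[OF x]] nonzero_inv[of "r x"]
      by (simp add: m_assoc)
    show "h x \<in> carrier R" using \<open>h x \<in> F\<close> Fc by auto
  qed
  have cc: "c x \<in> K" "c x \<in> carrier R" if "x \<in> S" for x using c that Kc(1) by auto
  define d where "d t = (\<Oplus>x\<in>{x\<in>S. r x = t}. c x \<otimes> h x)" for t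
  have dF: "d t \<in> F" for t
    unfolding d_def
  proof (rule subgroup_finsum_closed[OF subring.axioms(1)[OF subfieldE(1)[OF F]]])
    show "c x \<otimes> h x \<in> F" if "x \<in> {x\<in>S. r x = t}" for x using Fc(5)[OF subsetD[OF KF cc(1)] h(1)] that by simp
  qed (use S in simp)
  have "(\<Oplus>t\<in>r ` S. d t \<otimes> t) = (\<Oplus>t\<in>r ` S. \<Oplus>x\<in>{x\<in>S. r x = t}. c x \<otimes> x)"
  proof (rule finsum_cong')
    fix t assume "t \<in> r ` S"
    hence t: "t \<in> carrier R" using r(1) Sc by auto
    have "d t \<otimes> t = (\<Oplus>x\<in>{x\<in>S. r x = t}. c x \<otimes> h x \<otimes> t)"
      unfolding d_def by (rule finsum_ldistr) (use S t cc(2) h(4) in auto)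
    also have "\<dots> = (\<Oplus>x\<in>{x\<in>S. r x = t}. c x \<otimes> x)"
    proof (rule finsum_cong')
      fix x assume "x \<in> {x \<in> S. r x = t}"
      hence x: "x \<in> S" "r x = t" by auto
      have "c x \<otimes> h x \<otimes> t = c x \<otimes> (h x \<otimes> t)" using cc[OF x(1)] h(4)[OF x(1)] t by (simp add: m_assoc)
      thus "c x \<otimes> h x \<otimes> t = c x \<otimes> x" using h(3)[OF x(1)] x(2) by argo
    qed (use cc Sc in auto)
    finally show "d t \<otimes> t = (\<Oplus>x\<in>{x\<in>S. r x = t}. c x \<otimes> x)" .
  qed (auto intro!: finsum_closed simp: cc Sc)
  also have "\<dots> = (\<Oplus>x\<in>\<Union>((\<lambda>t. {x\<in>S. r x = t}) ` (r ` S)). c x \<otimes> x)"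
    by (rule add.finprod_UN_disjoint[symmetric, simplified]) (use S(1) cc(2) Sc(1) in \<open>auto simp: pairwise_def disjnt_def\<close>)
  also have "\<Union>((\<lambda>t. {x\<in>S. r x = t}) ` (r ` S)) = S" by auto
  finally have z: "(\<Oplus>t\<in>r ` S. d t \<otimes> t) = \<zero>" using eq by simp
  have "d (r s) = \<zero>"
  proof (rule class_independentD[OF up _ _ _ _ _ _ _ z])
    fix i j k assume ij: "i \<in> r ` S" "j \<in> r ` S" "i \<noteq> j" "k \<in> F"
    \<comment> \<open>Chosen representatives are fixed by r, so two of them that are proportional
      over F coincide.\<close>
    have "r (r x) = r x" if "x \<in> S" for x
    proof -
      have "x = h x \<otimes> r x" "h x \<in> F" using h that by auto
      thus ?thesis using rr[of x "r x" "h x"] r(1)[OF that] that by argo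
    qed
    hence "r i = i" "r j = j" "i \<in> S" "j \<in> S" using ij r by auto
    thus "i \<noteq> k \<otimes> j" using rr[of i j k] ij(3,4) by argo
  qed (use S(1) S(2) Fc(1,3) r(1) dF Gc(1) s in auto)
  hence z2: "(\<Oplus>x\<in>{x\<in>S. r x = r s}. c x \<otimes> h x) = \<zero>" unfolding d_def .
  show "c s = \<zero>"
  proof (rule class_independentD[OF low _ _ _ _ _ _ _ z2])
    fix i j k assume "i \<in> {x\<in>S. r x = r s}" "j \<in> {x\<in>S. r x = r s}" and ij: "i \<noteq> j" "k \<in> K"
    hence i: "i \<in> S" "r i = r s" "j \<in> S" "r j = r s" by auto
    show "h i \<noteq> k \<otimes> h j"
    proof
      assume e: "h i = k \<otimes> h j"
      have "i = k \<otimes> h j \<otimes> r s" using h(3)[OF i(1)] e i(2) by argo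
      also have "\<dots> = k \<otimes> (h j \<otimes> r s)" using ij i h(4) Kc(1) r(1)[OF s] Sc by (simp add: m_assoc)
      also have "\<dots> = k \<otimes> j" using h(3)[OF i(3)] i(4) by argo
      finally show False using ne i ij by blast
    qed
  qed (use S Kc(1,3) Gc(1) h(1,2) cc(1) s in auto)
qed

section \<open>Maximal subfields, and p-th powers in extensions of degree below p\<close>

lemma subfield_Union_chain:
  assumes "subset.chain UNIV C" "C \<noteq> {}" "\<And>F. F \<in> C \<Longrightarrow> subfield F R"
  shows "subfield (\<Union>C) R"
proof -
  have two: "\<exists>F\<in>C. x \<in> F \<and> y \<in> F" if xy: "x \<in> \<Union>C" "y \<in> \<Union>C" for x y
    proof -
    obtain A B where XY: "A \<in> C" "B \<in> C" "x \<in> A" "y \<in> B" using xy by auto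
    hence "A \<subseteq> B \<or> B \<subseteq> A" using assms(1) unfolding subset_chain_def by auto
    thus ?thesis using XY by auto
  qed
  obtain F0 where F0: "F0 \<in> C" using assms(2) by auto
  show ?thesis
  proof (rule subfieldI'[OF subringI])
    show "\<Union>C \<subseteq> carrier R" using assms(3) subfield_closed(1) by blast
    show "\<one> \<in> \<Union>C" using F0 assms(3) subfield_closed(3) by blast
    show "\<ominus> h \<in> \<Union>C" if "h \<in> \<Union>C" for h using that assms(3) subfield_closed(4) by blast
    show "h1 \<otimes> h2 \<in> \<Union>C" if "h1 \<in> \<Union>C" "h2 \<in> \<Union>C" for h1 h2
      using two[OF that] subfield_closed(5)[OF assms(3)] by (metis UnionI)
    show "h1 \<oplus> h2 \<in> \<Union>C" if "h1 \<in> \<Union>C" "h2 \<in> \<Union>C" for h1 h2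
      using two[OF that] subfield_closed(6)[OF assms(3)] by (metis UnionI)
    show "inv k \<in> \<Union>C" if "k \<in> \<Union>C - {\<zero>}" for k using that assms(3) subfield_closed(7) by blast
  qed
qed

text \<open>Zorn's lemma, packaged for two properties of F: that no element of K becomes a new p-th
  power in F, and that the part of a group inside F is independent over K.\<close>

lemma exists_maximal_subfield:
  assumes K: "subfield K R" "P K"
    and chain: "\<And>C. \<lbrakk> subset.chain UNIV C; C \<noteq> {}; \<And>F. F \<in> C \<Longrightarrow> subfield F R \<and> K \<subseteq> F \<and> P F \<rbrakk> \<Longrightarrow> P (\<Union>C)"
  obtains F where "subfield F R" "K \<subseteq> F" "P F"
    "\<And>F'. \<lbrakk> subfield F' R; F \<subseteq> F'; P F' \<rbrakk> \<Longrightarrow> F' = F"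
proof -
  let ?A = "{F. subfield F R \<and> K \<subseteq> F \<and> P F}"
  have "\<exists>M\<in>?A. \<forall>N\<in>?A. M \<subseteq> N \<longrightarrow> N = M"
  proof (rule subset_Zorn_nonempty)
    show "?A \<noteq> {}" using K by auto
    fix C assume C: "C \<noteq> {}" "subset.chain ?A C"
    hence c: "subset.chain UNIV C" "C \<subseteq> ?A" by (auto simp: subset_chain_def)
    show "\<Union>C \<in> ?A"
      using subfield_Union_chain[OF c(1) C(1)] chain[OF c(1) C(1)] c(2) C(1) by blast
  qed
  then obtain F where F: "F \<in> ?A" "\<forall>N\<in>?A. F \<subseteq> N \<longrightarrow> N = F" by auto
  show thesis by (rule that[of F]) (use F in auto)
qed

end

text \<open>
  Up to sign, $f(0)$ is the leading coefficient times the product of the roots, all of which have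
  $n$-th power $c$.
\<close>

lemma (in algebraically_closed) eval_zero_pow_of_roots:
  assumes "f \<in> carrier (poly_ring L)" "f \<noteq> []" "c \<in> carrier L"
    and "\<And>r. \<lbrakk> r \<in> carrier L; eval f r = \<zero> \<rbrakk> \<Longrightarrow> r [^] (n::nat) = c"
  shows "(eval f \<zero>) [^] n = (lead_coeff f) [^] n \<otimes> (((\<ominus> \<one>) [^] n \<otimes> c) [^] (degree f))"
  using assms
proof (induct "degree f" arbitrary: f)
  case 0
  then obtain b where f: "f = [b]" by (cases f) auto
  have "b \<in> carrier L" using 0(2) f polynomial_in_carrier[OF carrier_is_subring, of f]
    by (auto simp: univ_poly_carrier[symmetric])
  thus ?case using f by simp
next
  case (Suc d)
  have "roots f \<noteq> {#}" using roots_over_carrier[OF Suc(3)] Suc(2) unfolding splitted_def by auto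
  then obtain r where r: "r \<in> carrier L" "[ \<one>, \<ominus> r ] \<in> carrier (poly_ring L)" "[ \<one>, \<ominus> r ] pdivides f"
    using not_empty_rootsE[OF Suc(3)] by metis
  then obtain q where q: "q \<in> carrier (poly_ring L)" "f = [ \<one>, \<ominus> r ] \<otimes>\<^bsub>poly_ring L\<^esub> q"
    unfolding pdivides_def by blast
  hence fm: "f = poly_mult [ \<one>, \<ominus> r ] q" by (simp add: univ_poly_mult)
  have pol: "polynomial (carrier L) [ \<one>, \<ominus> r ]" "polynomial (carrier L) q"
    using q r by (auto simp: univ_poly_carrier)
  have ne: "q \<noteq> []" using fm Suc(4) poly_mult_zero(2)[of "[ \<one>, \<ominus> r ]"] r by auto
  have car: "set q \<subseteq> carrier L" "set [ \<one>, \<ominus> r ] \<subseteq> carrier L"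
    using polynomial_in_carrier[OF carrier_is_subring pol(2)] r by auto
  have ev: "eval f x = (x \<ominus> r) \<otimes> eval q x" if "x \<in> carrier L" for x
    unfolding fm using eval_poly_mult[OF car(2,1) that] r that by (simp add: a_minus_def)
  have qr: "s [^] n = c" if "s \<in> carrier L" "eval q s = \<zero>" for s
    using Suc(6)[OF that(1)] ev[OF that(1)] that r by simp
  have deg: "degree f = Suc (degree q)"
    unfolding fm using poly_mult_degree_eq[OF carrier_is_subring pol] ne by simp
  have lc: "lead_coeff f = lead_coeff q"
    unfolding fm using poly_mult_lead_coeff[OF carrier_is_subring pol _ ne] car(1) ne
    by (cases q) auto
  have rn: "r [^] n = c" using Suc(6)[OF r(1)] ev[OF r(1)] r eval_in_carrier[OF car(1) r(1)] by (simp add: a_minus_def r_neg)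
  have IH: "(eval q \<zero>) [^] n = (lead_coeff q) [^] n \<otimes> (((\<ominus> \<one>) [^] n \<otimes> c) [^] (degree q))"
    by (rule Suc(1)) (use deg Suc(2) q ne Suc(5) qr in auto)
  have e0: "eval q \<zero> \<in> carrier L" by (rule eval_in_carrier[OF car(1)]) simp
  have lcc: "lead_coeff q \<in> carrier L" using car(1) ne by (cases q) auto
  \<comment> \<open>Each linear factor X - r contributes -r to the value at zero, and all the (-r)^n
    agree.\<close>
  have mr: "(\<ominus> r) [^] n = (\<ominus> \<one>) [^] n \<otimes> c"
  proof -
    have "\<ominus> r = \<ominus> \<one> \<otimes> r" using r by (simp add: l_minus)
    thus ?thesis using r rn nat_pow_distrib[of "\<ominus> \<one>" r n] by simp
  qed
  let ?e = "(\<ominus> \<one>) [^] n \<otimes> c"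
  have ec: "?e \<in> carrier L" using Suc(5) by simp
  have "(eval f \<zero>) [^] n = (\<ominus> r) [^] n \<otimes> (eval q \<zero>) [^] n"
    using ev[of \<zero>] r e0 nat_pow_distrib[of "\<ominus> r" "eval q \<zero>" n] by (simp add: a_minus_def)
  also have "\<dots> = (lead_coeff q) [^] n \<otimes> (?e [^] (degree q) \<otimes> ?e)"
    unfolding IH mr using ec lcc by (simp add: m_ac del: nat_pow_Suc)
  also have "\<dots> = (lead_coeff f) [^] n \<otimes> ?e [^] (degree f)"
    unfolding lc deg by simp
  finally show ?case .
qed

context field
begin

text \<open>The polynomial X^n - c. At n = 0 truncated subtraction turns the list into X - c, hence
  the positivity assumption in the facts about it.\<close>

definition binomial_poly :: "nat \<Rightarrow> 'a \<Rightarrow> 'a list" where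
  "binomial_poly n c = \<one> # replicate (n - 1) \<zero> @ [\<ominus> c]"

lemma binomial_poly:
  assumes "subfield K R" "c \<in> K" "n > 0"
  shows "binomial_poly n c \<in> carrier (K[X])" "binomial_poly n c \<noteq> []" "degree (binomial_poly n c) = n"
    "x \<in> carrier R \<Longrightarrow> eval (binomial_poly n c) x = x [^] n \<ominus> c"
proof -
  note Kc = subfield_closed[OF assms(1)]
  show "binomial_poly n c \<in> carrier (K[X])"
    using assms Kc unfolding binomial_poly_def univ_poly_carrier[symmetric] polynomial_def by auto
  show "binomial_poly n c \<noteq> []" "degree (binomial_poly n c) = n"
    unfolding binomial_poly_def using assms by auto
  assume x: "x \<in> carrier R"
  show "eval (binomial_poly n c) x = x [^] n \<ominus> c"
    unfolding binomial_poly_def using x assms Kc(1)[OF assms(2)]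
      eval_replicate[of "[\<ominus> c]" x "n - 1"] by (simp add: a_minus_def)
qed

lemma algebraic_of_root:
  assumes F: "subfield F R" and "a \<in> carrier R" and "q \<in> carrier (F[X])" "q \<noteq> []" "eval q a = \<zero>"
  shows "(algebraic over F) a" "degree (Irr F a) \<le> degree q"
proof -
  show alg: "(algebraic over F) a" by (rule algebraicI[OF assms(3,4,5)])
  show "degree (Irr F a) \<le> degree q"
    by (rule pdivides_imp_degree_le[OF subfieldE(1)[OF F] IrrE(1)[OF F assms(2) alg] assms(3,4)
        Irr_minimal[OF F assms(2) alg assms(3,5)]])
qed

lemma algebraic_of_pow:
  assumes "subfield F R" "a \<in> carrier R" "a [^] (n::nat) \<in> F" "n > 0"
  shows "(algebraic over F) a" "degree (Irr F a) \<le> n"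
proof -
  note b = binomial_poly[OF assms(1,3,4)]
  have "eval (binomial_poly n (a [^] n)) a = \<zero>" using b(4)[OF assms(2)] assms(2) by (simp add: a_minus_def r_neg)
  note r = algebraic_of_root[OF assms(1,2) b(1,2) this]
  show "(algebraic over F) a" "degree (Irr F a) \<le> n" using r b(3) by auto
qed

text \<open>The powers of u below its degree are independent in F(a), whose dimension is the degree
  of a. The bound keeps every element of F(a) below degree p once a is.\<close>

lemma degree_Irr_mem_simple_extension:
  assumes F: "subfield F R" and a: "a \<in> carrier R" "(algebraic over F) a" and u: "u \<in> simple_extension F a"
  shows "degree (Irr F u) \<le> degree (Irr F a)"
proof -
  have sf: "subfield (simple_extension F a) R" using simple_extension_is_subfield[OF F a(1)] a by simp
  have uc: "u \<in> carrier R" using subfield_closed(1)[OF sf u] .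
  have alg: "(algebraic over F) u" using simple_extesion_mem_imp_algebraic[OF F a u] .
  have "set (exp_base u (degree (Irr F u))) \<subseteq> simple_extension F a"
    unfolding exp_base_def using subfield_closed(8)[OF sf u] by auto
  from independent_length_le_dimension[OF F dimension_simple_extension[OF F a] exp_base_independent[OF F uc alg] this]
  show ?thesis by (simp add: exp_base_def)
qed

end

text \<open>
  Let $m$ be the degree of $g$. The constant term $d$ of its minimal polynomial is, up to sign, its
  norm, so $d^p = \pm g^{pm}$; as $m$ is prime to $p$, also $\pm g^p$ is a $p$-th power in $F$.
\<close>

lemma (in algebraically_closed) pth_power_of_small_degree:
  assumes F: "subfield F L" and p: "prime (p::nat)" and g: "g \<in> carrier L" "g [^] p \<in> F"
    and small: "degree (Irr F g) < p"
  shows "\<exists>b\<in>F. b [^] p = g [^] p"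
proof (cases "g = \<zero>")
  case True thus ?thesis using subfield_closed[OF F] by blast
next
  case False
  note Fc = subfield_closed[OF F]
  have p0: "p > 0" using p prime_gt_0_nat by blast
  note alg = algebraic_of_pow(1)[OF F g p0]
  note Irr = IrrE[OF F g(1) alg]
  let ?f = "Irr F g" and ?c = "g [^] p" and ?m = "degree (Irr F g)"
  note b = binomial_poly[OF F g(2) p0]
  have b0: "eval (binomial_poly p ?c) g = \<zero>" using b(4)[OF g(1)] g(1) by (simp add: a_minus_def r_neg)
  have pd: "?f pdivides binomial_poly p ?c" by (rule Irr_minimal[OF F g(1) alg b(1) b0])
  have fc: "?f \<in> carrier (poly_ring L)" using Irr(1) carrier_polynomial_shell[OF subfieldE(1)[OF F]] by auto
  have fne: "?f \<noteq> []" using Irr(2) univ_poly_zero[of L F] unfolding ring_irreducible_def by auto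
  \<comment> \<open>The minimal polynomial of g divides X^p - g^p, so its roots all share the p-th
    power of g.\<close>
  have roots: "r [^] p = ?c" if r: "r \<in> carrier L" "eval ?f r = \<zero>" for r
  proof -
    have "eval (binomial_poly p ?c) r = \<zero>" using pdivides_imp_root_sharing[OF fc pd r] .
    thus ?thesis using b(4)[OF r(1)] r g(1) by (simp add: r_right_minus_eq)
  qed
  let ?e = "(\<ominus> \<one>) [^] p \<otimes> ?c"
  have eF: "?e \<in> F" using Fc g(2) by auto
  have ec: "?e \<in> carrier L" using eF Fc by auto
  have m1: "(\<ominus> \<one>) [^] p \<otimes> (\<ominus> \<one>) [^] p = \<one>"
    using nat_pow_distrib[of "\<ominus> \<one>" "\<ominus> \<one>" p] l_minus[of \<one> "\<ominus> \<one>"] by simp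
  have e0: "?e \<noteq> \<zero>"
  proof
    assume "?e = \<zero>"
    hence "\<zero> = ((\<ominus> \<one>) [^] p \<otimes> (\<ominus> \<one>) [^] p) \<otimes> ?c" using g(1) by (simp add: m_assoc)
    hence "?c = \<zero>" using m1 g(1) by simp
    thus False using pow_nonzero[OF g(1) False] by simp
  qed
  let ?d = "eval ?f \<zero>"
  have "?d [^] p = lead_coeff ?f [^] p \<otimes> ?e [^] ?m"
    by (rule eval_zero_pow_of_roots[OF fc fne nat_pow_closed[OF g(1)] roots])
  hence dp: "?d [^] p = ?e [^] ?m"
    unfolding Irr(3) nat_pow_one using l_one[OF nat_pow_closed[OF ec]] by (rule trans)
  have "set ?f \<subseteq> F" using Irr(1) univ_poly_carrier polynomial_incl by metis
  hence dF: "?d \<in> F" by (rule eval_mem_subfield[OF F Fc(2)])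
  have mpos: "?m > 0" using pirreducible_degree[OF F Irr(1,2)] by auto
  have "coprime ?m p" using p mpos small
    by (metis coprime_commute dvd_imp_le leD prime_imp_coprime)
  then obtain s t where st: "?m * s = p * t + 1" using bezout_nat[of ?m p] mpos by auto
  have dc: "?d \<in> carrier L" using dF Fc by auto
  have et0: "?e [^] t \<noteq> \<zero>" "?e [^] t \<in> carrier L" using pow_nonzero[OF ec e0] ec by auto
  \<comment> \<open>From d^p = e^m and m s = p t + 1 the p-th power of d^s is e^(p t + 1); dividing
    d^s by e^t leaves a p-th root of e.\<close>
  let ?b = "?d [^] s \<otimes> inv (?e [^] t)"
  have bF: "?b \<in> F" using dF eF et0 Fc(5,7,8) by auto
  have bc: "?b \<in> carrier L" using bF Fc by auto
  have "?b [^] p = (?d [^] s) [^] p \<otimes> (inv (?e [^] t)) [^] p"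
    using dc et0 nonzero_inv by (simp add: nat_pow_distrib)
  also have "(?d [^] s) [^] p = ?e [^] (p * t + 1)"
    unfolding nat_pow_pow[OF dc] mult.commute[of s p] nat_pow_pow[OF dc, symmetric] dp
      nat_pow_pow[OF ec] st ..
  also have "(inv (?e [^] t)) [^] p = inv (?e [^] (p * t))"
    using inv_pow[OF et0(2,1)] ec by (simp add: nat_pow_pow mult.commute)
  also have "?e [^] (p * t + 1) \<otimes> inv (?e [^] (p * t)) = ?e \<otimes> (?e [^] (p * t) \<otimes> inv (?e [^] (p * t)))"
    using ec nonzero_inv[of "?e [^] (p * t)"] pow_nonzero[OF ec e0, of "p * t"] by (simp add: m_ac)
  also have "\<dots> = ?e" using nonzero_inv(3)[of "?e [^] (p * t)"] pow_nonzero[OF ec e0, of "p * t"] ec by simp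
  finally have bp: "?b [^] p = ?e" .
  \<comment> \<open>The sign in e = (-1)^p g^p is itself a p-th power and is removed by passing to
    -b.\<close>
  have "(\<ominus> \<one> \<otimes> ?b) [^] p = (\<ominus> \<one>) [^] p \<otimes> ?e" using bc bp nat_pow_distrib[of "\<ominus> \<one>" ?b p] by simp
  also have "\<dots> = ?c" using m1 g(1) m_assoc[of "(\<ominus> \<one>) [^] p" "(\<ominus> \<one>) [^] p" ?c] by simp
  finally show ?thesis using bF Fc by (intro bexI[of _ "\<ominus> \<one> \<otimes> ?b"]) auto
qed

text \<open>Let a have degree below p over a maximal F. Every g in F(a) then has degree below p; if
  g^p lies in K, the norm argument makes it a p-th power of F, and the property of F makes it one of
  K. So F(a) inherits the property, and F(a) = F.\<close>

lemma (in algebraically_closed) pth_power_stable_closure: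
  assumes K: "subfield K L" and p: "prime (p::nat)"
  obtains F where "subfield F L" "K \<subseteq> F"
    "\<And>g. \<lbrakk> g \<in> F; g [^] p \<in> K \<rbrakk> \<Longrightarrow> \<exists>b\<in>K. b [^] p = g [^] p"
    "\<And>q a. \<lbrakk> q \<in> carrier (F[X]); q \<noteq> []; degree q < p; a \<in> carrier L; eval q a = \<zero> \<rbrakk> \<Longrightarrow> a \<in> F"
proof -
  let ?P = "\<lambda>F. \<forall>g\<in>F. g [^] p \<in> K \<longrightarrow> (\<exists>b\<in>K. b [^] p = g [^] p)"
  have "?P K" by auto
  then obtain F where F: "subfield F L" "K \<subseteq> F" "?P F"
      "\<And>F'. \<lbrakk> subfield F' L; F \<subseteq> F'; ?P F' \<rbrakk> \<Longrightarrow> F' = F"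
    by (rule exists_maximal_subfield[OF K, of ?P]) blast+
  have "a \<in> F" if q: "q \<in> carrier (F[X])" "q \<noteq> []" "degree q < p" and a: "a \<in> carrier L" "eval q a = \<zero>" for q a
  proof -
    note alg = algebraic_of_root[OF F(1) a(1) q(1,2) a(2)]
    let ?F = "simple_extension F a"
    have sf: "subfield ?F L" using simple_extension_is_subfield[OF F(1) a(1)] alg(1) by simp
    have "?P ?F"
    proof (intro ballI impI)
      fix g assume g: "g \<in> ?F" "g [^] p \<in> K"
      have gc: "g \<in> carrier L" using subfield_closed(1)[OF sf g(1)] .
      have "degree (Irr F g) < p"
        using degree_Irr_mem_simple_extension[OF F(1) a(1) alg(1) g(1)] alg(2) q(3) by simp
      then obtain b where "b \<in> F" "b [^] p = g [^] p"
        using pth_power_of_small_degree[OF F(1) p gc] g(2) F(2) by blast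
      thus "\<exists>b\<in>K. b [^] p = g [^] p" using F(3) g(2) by metis
    qed
    moreover have "F \<subseteq> ?F" using simple_extension_incl[OF subfieldE(3)[OF F(1)] a(1)] .
    ultimately have "?F = F" using F(4)[OF sf] by simp
    thus "a \<in> F" using simple_extension_mem[OF subfieldE(1)[OF F(1)] a(1)] by simp
  qed
  thus thesis using F(3) by (intro that[OF F(1,2)]) auto
qed

section \<open>Coordinates in simple extensions, and Kummer extensions of prime degree\<close>

context field
begin

lemma square_eq_cases:
  assumes "x \<in> carrier R" "y \<in> carrier R" "x \<otimes> x = y \<otimes> y"
  shows "x = y \<or> x = \<ominus> y"
proof -
  have "(x \<ominus> y) \<otimes> (x \<oplus> y) = x \<otimes> x \<ominus> y \<otimes> y"
    using assms(1,2) by algebra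
  also have "\<dots> = \<zero>" using assms by (simp add: a_minus_def r_neg)
  finally have "x \<ominus> y = \<zero> \<or> x \<oplus> y = \<zero>" using integral[of "x \<ominus> y" "x \<oplus> y"] assms(1,2) by simp
  thus ?thesis
  proof
    assume "x \<ominus> y = \<zero>" thus ?thesis using assms(1,2) by (simp add: r_right_minus_eq)
  next
    assume "x \<oplus> y = \<zero>" thus ?thesis using assms(1,2) minus_equality[of x y] by simp
  qed
qed

lemma eval_map_rev:
  assumes "c \<in> {..<n} \<rightarrow> carrier R" "a \<in> carrier R"
  shows "eval (map c (rev [0..<n])) a = (\<Oplus>k\<in>{..<n}. c k \<otimes> a [^] k)"
  using assms(1)
proof (induct n)
  case (Suc n)
  have "(\<Oplus>k\<in>{..<Suc n}. c k \<otimes> a [^] k) = c n \<otimes> a [^] n \<oplus> (\<Oplus>k\<in>{..<n}. c k \<otimes> a [^] k)"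
    unfolding lessThan_Suc by (rule finsum_insert) (use funcset_mem[OF Suc(2)] assms(2) in auto)
  thus ?case using Suc by (auto simp: Pi_iff)
qed simp

text \<open>Sums shorter than the degree are allowed because the bound on the degree is at times
  only an inequality, as for y^q in the separability argument.\<close>

lemma power_sum_eq_zeroD:
  assumes F: "subfield F R" and a: "a \<in> carrier R" "(algebraic over F) a" and n: "n \<le> degree (Irr F a)"
    and c: "c \<in> {..<n} \<rightarrow> F" and eq: "(\<Oplus>k\<in>{..<n}. c k \<otimes> a [^] k) = \<zero>" and k: "k < n"
  shows "c k = \<zero>"
proof -
  let ?d = "degree (Irr F a)" and ?Ks = "map c (rev [0..<n])"
  have "independent F (exp_base a ?d)" by (rule exp_base_independent[OF F a])
  hence ind: "independent F (exp_base a n)"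
    using exp_base_append[of a "?d - n" n] exp_base_append[of a n "?d - n"] n independent_split(1)[OF F]
    by (metis drop_exp_base append_take_drop_id diff_diff_cancel)
  have cF: "c i \<in> F" if "i < n" for i using c that by auto
  have "combine ?Ks (exp_base a (length ?Ks)) = \<zero>"
    unfolding combine_eq_eval using eval_map_rev[of c n a] cF subfield_closed(1)[OF F] a eq by auto
  hence "set (take (length (exp_base a n)) ?Ks) \<subseteq> {\<zero>}"
    by (intro independent_imp_trivial_combine[OF F ind]) (use cF in auto)
  thus ?thesis using k by (auto simp: exp_base_def image_subset_iff)
qed

lemma simple_extension_mem_power_sum:
  assumes F: "subfield F R" and a: "a \<in> carrier R" "(algebraic over F) a" and u: "u \<in> simple_extension F a"
  obtains c where "c \<in> {..<degree (Irr F a)} \<rightarrow> F" "u = (\<Oplus>k\<in>{..<degree (Irr F a)}. c k \<otimes> a [^] k)"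
proof -
  let ?d = "degree (Irr F a)"
  have "u \<in> Span F (exp_base a ?d)" using Span_exp_base[OF F a] u by simp
  then obtain Ks where Ks: "set Ks \<subseteq> F" "length Ks = length (exp_base a ?d)" "u = combine Ks (exp_base a ?d)"
    using Span_mem_iff_length_version[OF F exp_base_closed[OF a(1)]] by auto
  have l: "length Ks = ?d" using Ks(2) by (simp add: exp_base_def)
  have u1: "u = eval Ks a" using Ks(3) combine_eq_eval[of Ks a] l by simp
  have cF: "coeff Ks k \<in> F" if "k < ?d" for k
    using coeff_nth[of k Ks] that l Ks(1) nth_mem[of "length Ks - 1 - k" Ks] by auto
  have "u = (\<Oplus>k\<in>{..<?d}. coeff Ks k \<otimes> a [^] k)"
    using eval_map_rev[of "coeff Ks" ?d a] coeff_list[of Ks] cF subfield_closed(1)[OF F] a(1)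
    unfolding u1 l by auto
  thus thesis using that[of "coeff Ks"] cF by auto
qed

end

text \<open>The aim is that an element u of F(a) with u^(p^n) in F has the form f a^k with f in F.
  At p = 2 this calls for \<open>fourth_root\<close>: with F the rationals and a = i one has (1 +
  i)^4 = -4, yet 1 + i is no rational multiple of a power of i.\<close>

locale kummer_extension = field R for R (structure) +
  fixes F :: "'a set" and p :: nat and a \<zeta> :: 'a
  assumes F: "subfield F R" and p: "prime p" and a: "a \<in> carrier R" and apF: "a [^] p \<in> F"
    and deg: "degree (Irr F a) = p"
    and \<zeta>: "\<zeta> \<in> F" "\<zeta> [^] p = \<one>" "\<zeta> \<noteq> \<one>"
    and roots_of_unity: "\<And>\<xi>. \<lbrakk> \<xi> \<in> carrier R; \<xi> [^] p = \<one> \<rbrakk> \<Longrightarrow> \<xi> \<in> F"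
    and fourth_root: "p = 2 \<Longrightarrow> \<exists>i\<in>F. i \<otimes> i = \<ominus> \<one>"
begin

abbreviation E where "E \<equiv> simple_extension F a"

lemma p_pos: "p > 0" using p prime_gt_0_nat by blast

lemmas F_closed = subfield_closed[OF F]

lemma \<zeta>_carrier: "\<zeta> \<in> carrier R" "\<zeta> \<noteq> \<zero>"
proof -
  show c: "\<zeta> \<in> carrier R" using F_closed(1)[OF \<zeta>(1)] .
  show "\<zeta> \<noteq> \<zero>"
  proof
    assume "\<zeta> = \<zero>"
    hence "\<zeta> [^] p = \<zero>" using p_pos nat_pow_zero[of p] by simp
    thus False using \<zeta>(2) by simp
  qed
qed

lemma alg: "(algebraic over F) a" using algebraic_of_pow(1)[OF F a apF p_pos] .

lemma E_subfield: "subfield E R" using simple_extension_is_subfield[OF F a] alg by simp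
lemmas E_closed = subfield_closed[OF E_subfield]
lemma F_incl: "F \<subseteq> E" by (rule simple_extension_incl[OF subfieldE(3)[OF F] a])
lemma a_mem: "a \<in> E" using simple_extension_mem[OF subfieldE(1)[OF F] a] .

text \<open>Divide h by X^p - a^p, which vanishes at a and at \<zeta> a. The remainder vanishes at a
  and has degree below p, the degree of a, so it is zero.\<close>

lemma eval_conjugate_zero:
  assumes h: "h \<in> carrier (F[X])" "eval h a = \<zero>" shows "eval h (\<zeta> \<otimes> a) = \<zero>"
proof -
  let ?P = "binomial_poly p (a [^] p)"
  note P = binomial_poly[OF F apF p_pos]
  have za: "\<zeta> \<otimes> a \<in> carrier R" using a \<zeta>_carrier by simp
  have Pa: "eval ?P a = \<zero>" using P(4)[OF a] a by (simp add: a_minus_def r_neg)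
  have Pza: "eval ?P (\<zeta> \<otimes> a) = \<zero>"
    using P(4)[OF za] a \<zeta>(2) \<zeta>_carrier by (simp add: nat_pow_distrib a_minus_def r_neg)
  obtain q r where qr: "q \<in> carrier (F[X])" "r \<in> carrier (F[X])"
      "h = (?P \<otimes>\<^bsub>F[X]\<^esub> q) \<oplus>\<^bsub>F[X]\<^esub> r" "r = [] \<or> degree r < degree ?P"
    using field_long_division_theorem_shell[OF F h(1) P(1)] P(2) unfolding univ_poly_zero by auto
  have ev: "eval h x = eval ?P x \<otimes> eval q x \<oplus> eval r x" if x: "x \<in> carrier R" for x
  proof -
    interpret e: ring_hom_ring "F[X]" R "\<lambda>p. eval p x"
      by (rule eval_ring_hom[OF subfieldE(1)[OF F] x])
    show ?thesis unfolding qr(3) using qr P(1) by simp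
  qed
  have car: "eval q x \<in> carrier R" "eval r x \<in> carrier R" if "x \<in> carrier R" for x
    using qr eval_poly_in_carrier[OF subfieldE(1)[OF F]] that by (auto simp: univ_poly_carrier)
  have ra: "eval r a = \<zero>" using ev[OF a] h(2) Pa car[OF a] by simp
  have "r = []"
  proof (rule ccontr)
    assume ne: "r \<noteq> []"
    from algebraic_of_root(2)[OF F a qr(2) ne ra] have "p \<le> degree r" using deg by simp
    thus False using qr(4) ne P(3) by simp
  qed
  thus ?thesis using ev[OF za] Pza car[OF za] by simp
qed

text \<open>The $F$-automorphism of $F(a)$ with $a \mapsto \zeta a$; well defined by the preceding lemma.\<close>

definition conj :: "'a \<Rightarrow> 'a" where
  "conj u = eval (SOME f. f \<in> carrier (F[X]) \<and> eval f a = u) (\<zeta> \<otimes> a)"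

lemma conj_eval:
  assumes f: "f \<in> carrier (F[X])" shows "conj (eval f a) = eval f (\<zeta> \<otimes> a)"
proof -
  let ?g = "SOME g. g \<in> carrier (F[X]) \<and> eval g a = eval f a"
  have g: "?g \<in> carrier (F[X])" "eval ?g a = eval f a"
    using someI[of "\<lambda>g. g \<in> carrier (F[X]) \<and> eval g a = eval f a" f] f by auto
  have za: "\<zeta> \<otimes> a \<in> carrier R" using a \<zeta>_carrier by simp
  interpret e: ring_hom_ring "F[X]" R "\<lambda>p. eval p a" by (rule eval_ring_hom[OF subfieldE(1)[OF F] a])
  interpret e': ring_hom_ring "F[X]" R "\<lambda>p. eval p (\<zeta> \<otimes> a)" by (rule eval_ring_hom[OF subfieldE(1)[OF F] za])
  have "eval (?g \<ominus>\<^bsub>F[X]\<^esub> f) a = \<zero>"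
    using g f e.hom_closed[OF f] by (simp add: a_minus_def e.R.minus_eq r_neg)
  hence "eval (?g \<ominus>\<^bsub>F[X]\<^esub> f) (\<zeta> \<otimes> a) = \<zero>" using eval_conjugate_zero g f by simp
  hence "eval ?g (\<zeta> \<otimes> a) \<ominus> eval f (\<zeta> \<otimes> a) = \<zero>" using g f by (simp add: a_minus_def e.R.minus_eq)
  thus ?thesis unfolding conj_def using e'.hom_closed[OF f] e'.hom_closed[OF g(1)] by (simp add: r_right_minus_eq)
qed

lemma E_eval: "E = (\<lambda>f. eval f a) ` carrier (F[X])"
  by (rule simple_extension_as_eval_img[OF subfieldE(3)[OF F] a])

lemma conj_simps:
  shows conj_closed: "u \<in> E \<Longrightarrow> conj u \<in> E"
    and conj_add: "\<lbrakk> u \<in> E; v \<in> E \<rbrakk> \<Longrightarrow> conj (u \<oplus> v) = conj u \<oplus> conj v"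
    and conj_mult: "\<lbrakk> u \<in> E; v \<in> E \<rbrakk> \<Longrightarrow> conj (u \<otimes> v) = conj u \<otimes> conj v"
    and conj_F: "f \<in> F \<Longrightarrow> conj f = f"
    and conj_a: "conj a = \<zeta> \<otimes> a"
proof -
  have za: "\<zeta> \<otimes> a \<in> carrier R" "\<zeta> \<otimes> a \<in> E" using a \<zeta>_carrier E_closed(5)[OF _ a_mem] F_incl \<zeta>(1) by auto
  interpret e: ring_hom_ring "F[X]" R "\<lambda>p. eval p a" by (rule eval_ring_hom[OF subfieldE(1)[OF F] a])
  interpret e': ring_hom_ring "F[X]" R "\<lambda>p. eval p (\<zeta> \<otimes> a)" by (rule eval_ring_hom[OF subfieldE(1)[OF F] za(1)])
  show "conj u \<in> E" if u: "u \<in> E"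
  proof -
    obtain f where f: "f \<in> carrier (F[X])" "u = eval f a" using u E_eval by auto
    have sF: "set f \<subseteq> F" using f(1) univ_poly_carrier polynomial_incl by metis
    hence "eval f (\<zeta> \<otimes> a) \<in> E" using F_incl by (intro eval_mem_subfield[OF E_subfield za(2)]) auto
    thus ?thesis using conj_eval[OF f(1)] f(2) by simp
  qed
  show "conj (u \<oplus> v) = conj u \<oplus> conj v" "conj (u \<otimes> v) = conj u \<otimes> conj v" if uv: "u \<in> E" "v \<in> E"
  proof -
    obtain f g where fg: "f \<in> carrier (F[X])" "u = eval f a" "g \<in> carrier (F[X])" "v = eval g a" using uv E_eval by auto
    show "conj (u \<oplus> v) = conj u \<oplus> conj v"
      using conj_eval[of "f \<oplus>\<^bsub>F[X]\<^esub> g"] conj_eval[OF fg(1)] conj_eval[OF fg(3)] fg by simp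
    show "conj (u \<otimes> v) = conj u \<otimes> conj v"
      using conj_eval[of "f \<otimes>\<^bsub>F[X]\<^esub> g"] conj_eval[OF fg(1)] conj_eval[OF fg(3)] fg by simp
  qed
  show "conj f = f" if f: "f \<in> F"
  proof (cases "f = \<zero>")
    case True thus ?thesis using conj_eval[of "[]"] by (simp add: univ_poly_zero_closed)
  next
    case False
    have "[f] \<in> carrier (F[X])" using f False by (auto simp: univ_poly_carrier[symmetric] polynomial_def)
    from conj_eval[OF this] show ?thesis using F_closed(1)[OF f] by simp
  qed
  show "conj a = \<zeta> \<otimes> a"
    using conj_eval[OF var_closed(1)[OF subfieldE(1)[OF F]]] eval_var a za(1) by simp
qed

lemma conj_pow: "u \<in> E \<Longrightarrow> conj (u [^] (n::nat)) = conj u [^] n"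
  by (induct n) (use conj_F[OF F_closed(3)] conj_mult E_closed(8) in auto)

lemma conj_eval_at: "set f \<subseteq> F \<Longrightarrow> x \<in> E \<Longrightarrow> conj (eval f x) = eval f (conj x)"
proof (induct f)
  case (Cons b f)
  have bE: "b \<in> E" "b \<in> F" using Cons(2) F_incl by auto
  have xn: "x [^] length f \<in> E" using E_closed(8)[OF Cons(3)] .
  have fE: "eval f x \<in> E" using eval_mem_subfield[OF E_subfield Cons(3)] Cons(2) F_incl by auto
  show ?case
    using conj_add[OF E_closed(5)[OF bE(1) xn] fE] conj_mult[OF bE(1) xn]
      conj_F[OF bE(2)] conj_pow[OF Cons(3)] Cons by simp
qed (use conj_F F_closed(2) in auto)

lemma conj_p_times: assumes u: "u \<in> E" shows "(conj ^^ p) u = u"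
proof -
  obtain f where f: "f \<in> carrier (F[X])" "u = eval f a" using u E_eval by auto
  have sF: "set f \<subseteq> F" using f(1) univ_poly_carrier polynomial_incl by metis
  \<comment> \<open>As \<zeta> is fixed by \<open>conj\<close>, each iteration multiplies the
    argument by \<zeta>; at s = p it is a again.\<close>
  have "(conj ^^ s) u = eval f (\<zeta> [^] s \<otimes> a)" for s
  proof (induct s)
    case 0 thus ?case using f a by simp
  next
    case (Suc s)
    have z: "\<zeta> [^] s \<in> E" "\<zeta> [^] s \<in> F" using F_closed(8)[OF \<zeta>(1)] F_incl by auto
    have "conj (\<zeta> [^] s \<otimes> a) = \<zeta> [^] Suc s \<otimes> a"
      using conj_mult[OF z(1) a_mem] conj_F[OF z(2)] conj_a a \<zeta>_carrier by (simp add: m_assoc)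
    thus ?case using Suc conj_eval_at[OF sF E_closed(5)[OF z(1) a_mem]] by simp
  qed
  thus ?thesis using \<zeta>(2) f a by simp
qed

text \<open>A coincidence gives \<zeta>^(k - j) = 1 with an exponent prime to p, hence \<zeta> = 1.
  So \<open>conj\<close> has distinct eigenvalues on 1, a, ..., a^(p-1).\<close>

lemma zeta_pow_neq: assumes "j < k" "k < p" shows "\<zeta> [^] j \<noteq> \<zeta> [^] k"
proof
  assume e: "\<zeta> [^] j = \<zeta> [^] k"
  let ?n = "k - j"
  have "\<zeta> [^] k = \<zeta> [^] j \<otimes> \<zeta> [^] ?n" using assms \<zeta>_carrier by (simp add: nat_pow_mult)
  hence n1: "\<zeta> [^] ?n = \<one>" using e \<zeta>_carrier pow_nonzero[of \<zeta> j] nonzero_inv(4)[of "\<zeta> [^] j"]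
    by (metis m_assoc nat_pow_closed nonzero_inv(1) l_one)
  have "\<not> p dvd ?n" using assms by (auto dest: dvd_imp_le)
  from power_coprime_eq[OF p this \<zeta>_carrier(1) \<zeta>(2)] show False using n1 \<zeta>(3) by auto
qed

text \<open>Comparing coordinates of u and \<open>conj u\<close> gives c k \<zeta>^k = \<xi> c k for
  every k. The \<zeta>^k being distinct, a single coordinate survives.\<close>

lemma eigenvector:
  assumes u: "u \<in> E" "u \<noteq> \<zero>" and \<xi>: "\<xi> \<in> F" "conj u = \<xi> \<otimes> u"
  shows "\<exists>k<p. \<exists>f\<in>F. u = f \<otimes> a [^] k"
proof -
  obtain c where c: "c \<in> {..<p} \<rightarrow> F" "u = (\<Oplus>k\<in>{..<p}. c k \<otimes> a [^] k)"
    using simple_extension_mem_power_sum[OF F a alg u(1)] deg by auto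
  have cF: "c k \<in> F" if "k < p" for k using c(1) that by auto
  have cc: "c k \<in> carrier R" if "k < p" for k using cF[OF that] F_closed(1) by auto
  have xc: "\<xi> \<in> carrier R" using \<xi> F_closed(1) by auto
  have za: "\<zeta> \<otimes> a \<in> carrier R" using a \<zeta>_carrier by simp
  let ?f = "map c (rev [0..<p])"
  have sf: "set ?f \<subseteq> F" using cF by auto
  have uf: "u = eval ?f a" using eval_map_rev[of c p a] cc a c(2) by auto
  have "conj u = eval ?f (\<zeta> \<otimes> a)" using conj_eval_at[OF sf a_mem] uf conj_a by simp
  also have "\<dots> = (\<Oplus>k\<in>{..<p}. c k \<otimes> (\<zeta> \<otimes> a) [^] k)" by (rule eval_map_rev) (use cc za in auto)
  also have "\<dots> = (\<Oplus>k\<in>{..<p}. (c k \<otimes> \<zeta> [^] k) \<otimes> a [^] k)"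
    by (rule finsum_cong') (use cc a \<zeta>_carrier in \<open>auto simp: nat_pow_distrib m_assoc\<close>)
  finally have e1: "conj u = (\<Oplus>k\<in>{..<p}. (c k \<otimes> \<zeta> [^] k) \<otimes> a [^] k)" .
  have e2: "(\<ominus> \<xi>) \<otimes> u = (\<Oplus>k\<in>{..<p}. (\<ominus> \<xi>) \<otimes> (c k \<otimes> a [^] k))"
    unfolding c(2) by (rule finsum_rdistr) (use cc a xc in auto)
  let ?d = "\<lambda>k. c k \<otimes> \<zeta> [^] k \<ominus> \<xi> \<otimes> c k"
  have "(\<Oplus>k\<in>{..<p}. ?d k \<otimes> a [^] k) = (\<Oplus>k\<in>{..<p}. (c k \<otimes> \<zeta> [^] k) \<otimes> a [^] k \<oplus> (\<ominus> \<xi>) \<otimes> (c k \<otimes> a [^] k))"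
  proof (rule finsum_cong')
    fix k assume "k \<in> {..<p}"
    hence car: "c k \<in> carrier R" "\<zeta> [^] k \<in> carrier R" "a [^] k \<in> carrier R" "\<xi> \<in> carrier R"
      using cc a \<zeta>_carrier xc by auto
    thus "?d k \<otimes> a [^] k = (c k \<otimes> \<zeta> [^] k) \<otimes> a [^] k \<oplus> (\<ominus> \<xi>) \<otimes> (c k \<otimes> a [^] k)" by algebra
  qed (use cc a \<zeta>_carrier xc in auto)
  also have "\<dots> = conj u \<oplus> (\<ominus> \<xi>) \<otimes> u"
    unfolding e1 e2 by (rule finsum_addf) (use cc a \<zeta>_carrier xc in auto)
  also have "\<dots> = \<zero>" using \<xi>(2) E_closed(1)[OF u(1)] xc by (simp add: l_minus r_neg)
  finally have z: "(\<Oplus>k\<in>{..<p}. ?d k \<otimes> a [^] k) = \<zero>" .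
  have dz: "?d k = \<zero>" if k: "k < p" for k
    by (rule power_sum_eq_zeroD[OF F a alg _ _ z k]) (use deg cF \<zeta>(1) \<xi>(1) F_closed in auto)
  have "\<exists>k<p. c k \<noteq> \<zero>"
  proof (rule ccontr)
    assume "\<not> (\<exists>k<p. c k \<noteq> \<zero>)"
    hence "u = (\<Oplus>k\<in>{..<p}. \<zero>)" unfolding c(2) by (intro finsum_cong') (use a in auto)
    thus False using u(2) by simp
  qed
  then obtain k where k: "k < p" "c k \<noteq> \<zero>" by auto
  have zk: "\<zeta> [^] j = \<xi>" if j: "j < p" "c j \<noteq> \<zero>" for j
  proof -
    have car: "c j \<in> carrier R" "\<zeta> [^] j \<in> carrier R" using cc j \<zeta>_carrier by auto
    have "c j \<otimes> \<zeta> [^] j = c j \<otimes> \<xi>"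
      using dz[OF j(1)] car xc by (simp add: r_right_minus_eq m_comm)
    thus ?thesis using m_lcancel[OF j(2) car(1,2) xc] by simp
  qed
  have z0: "c j = \<zero>" if "j < p" "j \<noteq> k" for j
    using zk[OF that(1)] zk[OF k] zeta_pow_neq[of j k] zeta_pow_neq[of k j] that k(1) by (metis nat_neq_iff)
  have "u = (\<Oplus>j\<in>{..<p}. if k = j then c j \<otimes> a [^] j else \<zero>)"
    unfolding c(2) by (rule finsum_cong') (use z0 cc a in auto)
  also have "\<dots> = c k \<otimes> a [^] k"
    by (rule add.finprod_singleton) (use k cc a in auto)
  finally show ?thesis using k cF by blast
qed

text \<open>\<open>conj\<close> fixes u^p, so \<open>conj u\<close> divided by u is a p-th root of
  unity. It lies in F and makes u an eigenvector.\<close>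

lemma pth_root_aux:
  assumes u: "u \<in> E" "u \<noteq> \<zero>" "u [^] p \<in> F"
  shows "\<exists>k<p. \<exists>f\<in>F. u = f \<otimes> a [^] k"
proof -
  let ?x = "conj u \<otimes> inv u"
  have car: "u \<in> carrier R" "conj u \<in> carrier R" using E_closed(1) u conj_closed by auto
  note i = nonzero_inv[OF car(1) u(2)]
  have "?x [^] p = conj (u [^] p) \<otimes> inv (u [^] p)"
    using car i inv_pow[OF car(1) u(2)] by (simp add: nat_pow_distrib conj_pow[OF u(1)])
  also have "\<dots> = \<one>" using conj_F[OF u(3)] nonzero_inv(3)[of "u [^] p"] pow_nonzero[OF car(1) u(2)] car by simp
  finally have "?x \<in> F" using roots_of_unity[of ?x] car i by auto
  moreover have "conj u = ?x \<otimes> u" using car i by (simp add: m_assoc)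
  ultimately show ?thesis by (rule eigenvector[OF u(1,2)])
qed

text \<open>
  The quotient $w = \sigma u / u$ has $w^p = \zeta^j \<in> F$, hence $w = b a^k$ with $b \<in> F$ and
  $\sigma w = \zeta^k w$. From $\sigma^p = 1$ one gets $w^p \zeta^{k p (p-1)/2} = 1$. For odd $p$ this
  says $w^p = 1$; for $p = 2$ and $k = 1$ it says $w^2 = -1$. In both cases $w \<in> F$, so $u$ is an
  eigenvector of $\sigma$.
\<close>

lemma pth_root:
  assumes u: "u \<in> E" "u \<noteq> \<zero>" and f: "f \<in> F" "u [^] p = f \<otimes> a [^] (j::nat)"
  shows "\<exists>k<p. \<exists>f\<in>F. u = f \<otimes> a [^] k"
proof -
  let ?w = "conj u \<otimes> inv u"
  have car: "u \<in> carrier R" "conj u \<in> carrier R" using E_closed(1) u conj_closed by auto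
  note i = nonzero_inv[OF car(1) u(2)]
  have wE: "?w \<in> E" using E_closed(5,7) u conj_closed by auto
  have wc: "?w \<in> carrier R" using E_closed(1)[OF wE] .
  have uw: "conj u = ?w \<otimes> u" using car i by (simp add: m_assoc)
  have up0: "u [^] p \<noteq> \<zero>" using pow_nonzero[OF car(1) u(2)] .
  have ajE: "a [^] j \<in> E" "f \<in> E" using E_closed(8)[OF a_mem] f F_incl by auto
  have zj: "\<zeta> [^] j \<in> carrier R" "\<zeta> [^] j \<noteq> \<zero>" using \<zeta>_carrier pow_nonzero by auto
  have fc: "f \<in> carrier R" "a [^] j \<in> carrier R" using f F_closed(1) a by auto
  have "conj u [^] p = \<zeta> [^] j \<otimes> u [^] p"
    using conj_pow[OF u(1), of p] f(2) conj_mult[OF ajE(2,1)] conj_F[OF f(1)] conj_pow[OF a_mem, of j] conj_a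
      a \<zeta>_carrier fc by (simp add: nat_pow_distrib m_ac)
  hence "?w [^] p = \<zeta> [^] j \<otimes> (u [^] p \<otimes> inv (u [^] p))"
    using car i zj nonzero_inv[OF _ up0] by (simp add: nat_pow_distrib inv_pow[OF car(1) u(2)] m_assoc)
  hence wp: "?w [^] p = \<zeta> [^] j" using nonzero_inv(3)[OF _ up0] car zj by simp
  have w0: "?w \<noteq> \<zero>"
  proof
    assume "?w = \<zero>"
    hence "?w [^] p = \<zero>" using p_pos nat_pow_zero[of p] by simp
    thus False using wp zj(2) by simp
  qed
  have "?w \<in> F"
  proof -
    have "?w [^] p \<in> F" using wp F_closed(8)[OF \<zeta>(1)] by simp
    then obtain k b where kb: "k < p" "b \<in> F" "?w = b \<otimes> a [^] k" using pth_root_aux[OF wE w0] by auto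
    have bE: "b \<in> E" "a [^] k \<in> E" using kb F_incl E_closed(8)[OF a_mem] by auto
    have cw: "conj ?w = \<zeta> [^] k \<otimes> ?w"
      unfolding kb(3) conj_mult[OF bE] conj_F[OF kb(2)] conj_pow[OF a_mem] conj_a
      using E_closed(1)[OF bE(1)] a \<zeta>_carrier by (simp add: nat_pow_distrib m_ac)
    \<comment> \<open>\<open>conj\<close> multiplies w^s by \<zeta>^(k s), so the exponents of
      \<zeta> accumulate to k (0 + 1 + ... + (s - 1)).\<close>
    have it: "(conj ^^ s) u = ?w [^] s \<otimes> (\<zeta> [^] (k * (\<Sum>i<s. i)) \<otimes> u)" for s
    proof (induct s)
      case 0 thus ?case using car by simp
    next
      case (Suc s)
      let ?t = "\<Sum>i<s. i"
      have zF: "\<zeta> [^] (k * ?t) \<in> F" using F_closed(8)[OF \<zeta>(1)] .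
      have zE: "\<zeta> [^] (k * ?t) \<in> E" using zF F_incl by auto
      have zc: "\<zeta> [^] n \<in> carrier R" for n :: nat using \<zeta>_carrier by simp
      have mac: "x \<otimes> y \<otimes> (z \<otimes> (w \<otimes> v)) = (y \<otimes> w) \<otimes> ((x \<otimes> z) \<otimes> v)"
        if "x \<in> carrier R" "y \<in> carrier R" "z \<in> carrier R" "w \<in> carrier R" "v \<in> carrier R" for x y z w v
        using that by (simp add: m_ac)
      have "(conj ^^ Suc s) u = conj (?w [^] s \<otimes> (\<zeta> [^] (k * ?t) \<otimes> u))" using Suc by simp
      also have "\<dots> = (\<zeta> [^] k \<otimes> ?w) [^] s \<otimes> (\<zeta> [^] (k * ?t) \<otimes> (?w \<otimes> u))"
        using conj_mult[OF E_closed(8)[OF wE] E_closed(5)[OF zE u(1)]] conj_mult[OF zE u(1)] conj_F[OF zF]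
          conj_pow[OF wE] cw uw by simp
      also have "(\<zeta> [^] k \<otimes> ?w) [^] s = \<zeta> [^] (k * s) \<otimes> ?w [^] s"
        using zc wc \<zeta>_carrier by (simp only: nat_pow_distrib nat_pow_pow)
      also have "\<zeta> [^] (k * s) \<otimes> ?w [^] s \<otimes> (\<zeta> [^] (k * ?t) \<otimes> (?w \<otimes> u))
          = (?w [^] s \<otimes> ?w) \<otimes> ((\<zeta> [^] (k * s) \<otimes> \<zeta> [^] (k * ?t)) \<otimes> u)"
        using mac[OF zc[of "k * s"] nat_pow_closed[OF wc, of s] zc[of "k * ?t"] wc car(1)] .
      also have "\<zeta> [^] (k * s) \<otimes> \<zeta> [^] (k * ?t) = \<zeta> [^] (k * (\<Sum>i<Suc s. i))"
        using \<zeta>_carrier by (simp add: nat_pow_mult algebra_simps)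
      finally show ?case by simp
    qed
    let ?T = "\<Sum>i<p. i"
    have zT: "\<zeta> [^] (k * ?T) \<in> carrier R" using \<zeta>_carrier by simp
    have "u = ?w [^] p \<otimes> (\<zeta> [^] (k * ?T) \<otimes> u)" using it[of p] conj_p_times[OF u(1)] by simp
    hence "\<one> \<otimes> u = (?w [^] p \<otimes> \<zeta> [^] (k * ?T)) \<otimes> u"
      using car nat_pow_closed[OF wc, of p] zT by (simp add: m_assoc)
    hence wT: "?w [^] p \<otimes> \<zeta> [^] (k * ?T) = \<one>"
      using m_rcancel[OF u(2) car(1) one_closed, of "?w [^] p \<otimes> \<zeta> [^] (k * ?T)"] nat_pow_closed[OF wc, of p] zT by simp
    show "?w \<in> F"
    proof (cases "p = 2")
      case False
      \<comment> \<open>For odd p the sum 0 + ... + (p - 1) is a multiple of p, so the power of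
        \<zeta> disappears.\<close>
      have "2 * (\<Sum>i<n. i) = n * (n - 1)" for n :: nat
        by (induct n) (auto simp: algebra_simps)
      hence "p dvd 2 * ?T" by (metis dvd_triv_left)
      moreover have "coprime p 2" using False p by (metis primes_coprime two_is_prime_nat)
      ultimately have "p dvd ?T" using coprime_dvd_mult_right_iff by blast
      then obtain m where "?T = p * m" by auto
      hence "\<zeta> [^] (k * ?T) = \<one>" using nat_pow_pow[OF \<zeta>_carrier(1), of p "k * m"] \<zeta>(2) by (simp add: mult.left_commute)
      hence "?w [^] p = \<one>" using wT nat_pow_closed[OF wc, of p] by simp
      thus ?thesis using roots_of_unity[OF wc] by simp
    next
      case True
      \<comment> \<open>For p = 2 the sum is 1 and \<zeta> = -1 survives; this is where
        \<open>fourth_root\<close> enters.\<close>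
      hence T: "?T = 1" by (simp add: numeral_2_eq_2)
      show ?thesis
      proof (cases "k = 0")
        case True thus ?thesis using kb F_closed(1) by simp
      next
        case False
        hence k1: "k = 1" using kb(1) \<open>p = 2\<close> by simp
        have sq: "x [^] p = x \<otimes> x" if "x \<in> carrier R" for x using that \<open>p = 2\<close> by (simp add: numeral_2_eq_2)
        have "\<zeta> = \<one> \<or> \<zeta> = \<ominus> \<one>"
          using square_eq_cases[OF \<zeta>_carrier(1) one_closed] \<zeta>(2) sq \<zeta>_carrier by simp
        hence z: "\<zeta> = \<ominus> \<one>" using \<zeta>(3) by simp
        obtain \<iota> where \<iota>: "\<iota> \<in> F" "\<iota> \<otimes> \<iota> = \<ominus> \<one>" using fourth_root \<open>p = 2\<close> by auto
        have "(?w \<otimes> ?w) \<otimes> \<zeta> = \<one>" using wT k1 T sq[OF wc] \<zeta>_carrier by simp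
        hence "\<ominus> (?w \<otimes> ?w) = \<one>" using z wc by (simp add: r_minus)
        hence "?w \<otimes> ?w = \<ominus> \<one>" using wc by (metis add.inv_inv m_closed)
        hence "?w = \<iota> \<or> ?w = \<ominus> \<iota>" using square_eq_cases[OF wc F_closed(1)[OF \<iota>(1)]] \<iota>(2) by simp
        thus ?thesis using \<iota>(1) F_closed(4) by auto
      qed
    qed
  qed
  thus ?thesis using eigenvector[OF u] uw by simp
qed

text \<open>The induction hypothesis for u^p yields only u^p = f a^k, not an element of F; this is
  why \<open>pth_root\<close> admits the factor a^j.\<close>

lemma p_power_root:
  assumes "u \<in> E" "u \<noteq> \<zero>" "u [^] (p ^ n) \<in> F"
  shows "\<exists>k<p. \<exists>f\<in>F. u = f \<otimes> a [^] k"
  using assms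
proof (induct n arbitrary: u)
  case 0
  have "u \<in> carrier R" using E_closed(1) 0 by auto
  hence "u = u \<otimes> a [^] (0::nat)" "u \<in> F" using 0 by auto
  thus ?case using p_pos by blast
next
  case (Suc n)
  have uc: "u \<in> carrier R" using E_closed(1) Suc(2) by auto
  have "(u [^] p) [^] (p ^ n) \<in> F" using Suc(4) uc by (simp add: nat_pow_pow)
  from Suc(1)[OF E_closed(8)[OF Suc(2)] pow_nonzero[OF uc Suc(3)] this]
  obtain k f where "f \<in> F" "u [^] p = f \<otimes> a [^] (k::nat)" by blast
  thus ?case using pth_root[OF Suc(2,3)] by blast
qed

end

section \<open>Independence of p-primary groups by Kummer theory\<close>

context field
begin

lemma class_independent_powers:
  assumes F: "subfield F R" and a: "a \<in> carrier R" "(algebraic over F) a" and n: "n \<le> degree (Irr F a)"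
  shows "class_independent F {a [^] k | k. k < n}"
proof (rule class_independentI)
  fix S c s assume S: "finite S" "S \<subseteq> {a [^] k | k. k < n}"
    and c: "c \<in> S \<rightarrow> F" and eq: "(\<Oplus>s\<in>S. c s \<otimes> s) = \<zero>" and s: "s \<in> S"
  note Fc = subfield_closed[OF F]
  have "\<forall>x\<in>S. \<exists>k<n. x = a [^] k" using S by auto
  then obtain k where k: "\<And>x. x \<in> S \<Longrightarrow> k x < n" "\<And>x. x \<in> S \<Longrightarrow> a [^] (k x) = x" by metis
  have inj: "inj_on k S" by (metis inj_onI k(2))
  have cF: "c x \<in> F" "c x \<in> carrier R" if "x \<in> S" for x using funcset_mem[OF c that] Fc(1) by auto
  \<comment> \<open>Exponents not occurring in S receive coefficient zero, so that the relation runs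
    over all powers below n.\<close>
  let ?d = "\<lambda>i. if i \<in> k ` S then c (a [^] i) else \<zero>"
  have dF: "?d i \<in> F" for i using k cF Fc(2) by auto
  have dc: "?d i \<in> carrier R" for i using Fc(1)[OF dF] .
  have "(\<Oplus>i\<in>{..<n}. ?d i \<otimes> a [^] i) = (\<Oplus>i\<in>k ` S. ?d i \<otimes> a [^] i)"
  proof (rule add.finprod_mono_neutral_cong_left[symmetric])
    show "(\<lambda>i. ?d i \<otimes> a [^] i) \<in> {..<n} \<rightarrow> carrier R" using dc a by blast
  qed (use k a in auto)
  also have "\<dots> = (\<Oplus>x\<in>S. ?d (k x) \<otimes> a [^] (k x))"
    by (rule finsum_reindex[OF Pi_I inj]) (rule m_closed[OF dc nat_pow_closed[OF a(1)]])
  also have "\<dots> = (\<Oplus>x\<in>S. c x \<otimes> x)"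
  proof (rule finsum_cong')
    show "(\<lambda>x. c x \<otimes> x) \<in> S \<rightarrow> carrier R"
    proof
      fix x assume x: "x \<in> S"
      have "x \<in> carrier R" using nat_pow_closed[OF a(1), of "k x"] k(2)[OF x] by simp
      thus "c x \<otimes> x \<in> carrier R" using cF(2)[OF x] by simp
    qed
    show "?d (k x) \<otimes> a [^] (k x) = c x \<otimes> x" if "x \<in> S" for x using that k(2) by simp
  qed simp
  finally have z: "(\<Oplus>i\<in>{..<n}. ?d i \<otimes> a [^] i) = \<zero>" using eq by simp
  have "?d (k s) = \<zero>" by (rule power_sum_eq_zeroD[OF F a n _ z k(1)[OF s]]) (use dF in blast)
  thus "c s = \<zero>" using s k(2)[OF s] by simp
qed

text \<open>K - {0} is a single class; it is obtained by rescaling the one-element family of powers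
  of \<open>\<one>\<close>.\<close>

lemma class_independent_subset:
  assumes K: "subfield K R" and G: "G \<subseteq> K - {\<zero>}"
  shows "class_independent K G"
proof -
  note Kc = subfield_closed[OF K]
  have "\<one> [^] (1::nat) \<in> K" using Kc(3) by simp
  note alg = algebraic_of_pow(1)[OF K one_closed this zero_less_one]
  have "1 \<le> degree (Irr K \<one>)" using pirreducible_degree[OF K IrrE(1,2)[OF K one_closed alg]] by simp
  note ci = class_independent_powers[OF K one_closed alg this]
  show ?thesis
  proof (rule class_independent_rescale[OF ci K])
    fix x assume "x \<in> G"
    hence x: "x \<in> K" "x \<noteq> \<zero>" using G by auto
    have "\<one> \<in> {\<one> [^] k |k. k < (1::nat)}" by auto
    thus "\<exists>f\<in>K. \<exists>g\<in>{\<one> [^] k |k. k < (1::nat)}. f \<noteq> \<zero> \<and> x = f \<otimes> g"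
      using x Kc(1)[OF x(1)] by (intro bexI[of _ x] bexI[of _ \<one>]) simp_all
  qed auto
qed

text \<open>The list of n ones is 1 + X + ... + X^(n-1). It yields roots of unity, bounds their
  degree by p - 1, and relates the inverse of u - 1 to long sums of powers.\<close>

lemma eval_geometric:
  assumes "x \<in> carrier R"
  shows "eval (replicate n \<one>) x \<in> carrier R" "eval (replicate n \<one>) x \<otimes> (x \<ominus> \<one>) = x [^] n \<ominus> \<one>"
    "eval (replicate n \<one>) x = (\<Oplus>j\<in>{..<n}. x [^] j)"
proof -
  have "(\<Oplus>j\<in>{..<n}. \<one> \<otimes> x [^] j) = (\<Oplus>j\<in>{..<n}. x [^] j)" by (rule finsum_cong') (use assms in auto)
  thus "eval (replicate n \<one>) x = (\<Oplus>j\<in>{..<n}. x [^] j)"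
    using eval_map_rev[of "\<lambda>_. \<one>" n x] assms by (simp add: map_replicate_const)
  have car: "eval (replicate n \<one>) x \<in> carrier R" for n
    by (rule eval_in_carrier) (use assms in auto)
  thus "eval (replicate n \<one>) x \<in> carrier R" .
  show "eval (replicate n \<one>) x \<otimes> (x \<ominus> \<one>) = x [^] n \<ominus> \<one>"
  proof (induct n)
    case 0 thus ?case using assms by (simp add: a_minus_def r_neg)
  next
    case (Suc n)
    let ?e = "eval (replicate n \<one>) x" and ?y = "x [^] n"
    have "eval (replicate (Suc n) \<one>) x \<otimes> (x \<ominus> \<one>) = (?y \<oplus> ?e) \<otimes> (x \<ominus> \<one>)" using assms by simp
    also have "\<dots> = ?y \<otimes> (x \<ominus> \<one>) \<oplus> ?e \<otimes> (x \<ominus> \<one>)" using car[of n] assms by (simp add: l_distr)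
    also have "\<dots> = ?y \<otimes> (x \<ominus> \<one>) \<oplus> (?y \<ominus> \<one>)" unfolding Suc ..
    also have "\<dots> = ?y \<otimes> x \<ominus> \<one>" using nat_pow_closed[OF assms, of n] assms by algebra
    finally show ?case by simp
  qed
qed

lemma eval_geometric_one: "eval (replicate n \<one>) \<one> = [n] \<cdot> \<one>"
proof (induct n)
  case (Suc n) thus ?case by (simp add: a_comm)
qed simp

lemma geometric_poly_carrier: "subfield F R \<Longrightarrow> replicate n \<one> \<in> carrier (F[X])"
  using subfield_closed(3)[of F] by (cases n) (auto simp: univ_poly_carrier[symmetric] polynomial_def)

end

context algebraically_closed
begin

lemma exists_root:
  assumes "f \<in> carrier (poly_ring L)" "degree f > 0"
  obtains x where "x \<in> carrier L" "eval f x = \<zero>"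
proof -
  have "roots f \<noteq> {#}" using roots_over_carrier[OF assms(1)] assms(2) unfolding splitted_def by auto
  then obtain x where "x \<in> carrier L" "x \<in># roots f" using not_empty_rootsE[OF assms(1)] by metis
  thus thesis using roots_mem_iff_is_root[OF assms(1)] that unfolding is_root_def by auto
qed

text \<open>A root of 1 + X + ... + X^(p-1) differs from 1, because the value at 1 is p, which is
  nonzero in L.\<close>

lemma exists_nontrivial_root_of_unity:
  assumes p: "prime (p::nat)" and "[p] \<cdot> \<one> \<noteq> \<zero>"
  obtains \<zeta> where "\<zeta> \<in> carrier L" "\<zeta> [^] p = \<one>" "\<zeta> \<noteq> \<one>"
proof -
  have "degree (replicate p \<one>) > 0" using prime_gt_1_nat[OF p] by simp
  then obtain z where z: "z \<in> carrier L" "eval (replicate p \<one>) z = \<zero>"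
    using exists_root[OF geometric_poly_carrier[OF carrier_is_subfield]] by blast
  have "z [^] p \<ominus> \<one> = \<zero>" using eval_geometric(2)[OF z(1), of p] z by simp
  hence "z [^] p = \<one>" using z by (simp add: r_right_minus_eq)
  moreover have "z \<noteq> \<one>" using z(2) eval_geometric_one[of p] assms(2) by auto
  ultimately show thesis using that z(1) by blast
qed

text \<open>In degree below p the norm argument gives b in F with b^p = a^p. Then a / b is a p-th
  root of unity, which lies in F, and so would a.\<close>

lemma degree_Irr_of_pth_root:
  assumes F: "subfield F L" and p: "prime (p::nat)" and a: "a \<in> carrier L" "a \<notin> F" "a [^] p \<in> F"
    and roots_of_unity: "\<And>\<xi>. \<lbrakk> \<xi> \<in> carrier L; \<xi> [^] p = \<one> \<rbrakk> \<Longrightarrow> \<xi> \<in> F"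
  shows "degree (Irr F a) = p"
proof -
  note Fc = subfield_closed[OF F]
  have p0: "p > 0" using p prime_gt_0_nat by blast
  have "degree (Irr F a) \<le> p" using algebraic_of_pow(2)[OF F a(1,3) p0] .
  moreover have "\<not> degree (Irr F a) < p"
  proof
    assume "degree (Irr F a) < p"
    then obtain b where b: "b \<in> F" "b [^] p = a [^] p"
      using pth_power_of_small_degree[OF F p a(1,3)] by auto
    have a0: "a \<noteq> \<zero>" using a Fc by auto
    have bc: "b \<in> carrier L" using b Fc by auto
    note e = pow_eq_quotient[OF a(1) a0 bc b(2) p0]
    have "a \<otimes> inv b \<in> F" using roots_of_unity[OF _ e(2)] a(1) nonzero_inv(1)[OF bc e(1)] by simp
    hence "a \<otimes> inv b \<otimes> b \<in> F" using Fc(5) b by blast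
    thus False using e(3) a by simp
  qed
  ultimately show ?thesis by simp
qed

text \<open>A maximal F with G \<inter> F independent over K must contain G. Otherwise a suitable
  power a of an element of G generates a Kummer extension of degree p. Up to factors in F^\<times>,
  the elements of G \<inter> F(a) are the powers 1, a, ..., a^(p-1), so the tower over K and F makes
  G \<inter> F(a) independent, against maximality.\<close>

lemma kummer_class_independent:
  assumes K: "subfield K L" and p: "prime (p::nat)"
    and \<zeta>: "\<zeta> \<in> K" "\<zeta> [^] p = \<one>" "\<zeta> \<noteq> \<one>"
    and roots_of_unity: "\<And>\<xi>. \<lbrakk> \<xi> \<in> carrier L; \<xi> [^] p = \<one> \<rbrakk> \<Longrightarrow> \<xi> \<in> K"
    and fourth_root: "p = 2 \<Longrightarrow> \<exists>i\<in>K. i \<otimes> i = \<ominus> \<one>"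
    and G: "mult_subgroup G" and tors: "\<And>g. g \<in> G \<Longrightarrow> \<exists>n. g [^] (p ^ n) \<in> K"
  shows "class_independent K G"
proof -
  note Gc = mult_subgroupD[OF G]
  obtain F where F: "subfield F L" "K \<subseteq> F" "class_independent K (G \<inter> F)"
      "\<And>F'. \<lbrakk> subfield F' L; F \<subseteq> F'; class_independent K (G \<inter> F') \<rbrakk> \<Longrightarrow> F' = F"
  proof (rule exists_maximal_subfield[OF K, of "\<lambda>F. class_independent K (G \<inter> F)"])
    show "class_independent K (G \<inter> K)" by (rule class_independent_subset[OF K]) (use Gc in auto)
    fix C assume C: "subset.chain UNIV C" "C \<noteq> {}"
      and ci: "\<And>F. F \<in> C \<Longrightarrow> subfield F L \<and> K \<subseteq> F \<and> class_independent K (G \<inter> F)"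
    show "class_independent K (G \<inter> \<Union>C)"
    proof (rule class_independent_finite_subsets)
      fix S assume S: "finite S" "S \<subseteq> G \<inter> \<Union>C"
      hence "S \<subseteq> \<Union>C" by auto
      then obtain F where "F \<in> C" "S \<subseteq> F" using finite_subset_Union_chain[OF S(1) _ C(2,1)] by auto
      thus "\<exists>H. S \<subseteq> H \<and> class_independent K H" using ci S(2) by (intro exI[of _ "G \<inter> F"]) auto
    qed
  qed blast
  have "G \<subseteq> F"
  proof (rule ccontr)
    assume "\<not> G \<subseteq> F"
    then obtain g where g: "g \<in> G" "g \<notin> F" by auto
    have ex: "\<exists>n. g [^] (p ^ n) \<in> F" using tors[OF g(1)] F(2) by auto
    \<comment> \<open>By minimality the preceding p-power a of g lies outside F while a^p lies in
      F.\<close>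
    define n where "n = (LEAST n. g [^] (p ^ n) \<in> F)"
    have n: "g [^] (p ^ n) \<in> F" unfolding n_def using ex by (rule LeastI_ex)
    have gc: "g \<in> carrier L" using Gc g by auto
    have "n \<noteq> 0" using n g gc by (intro notI) simp
    then obtain m where m: "n = Suc m" by (cases n) auto
    define a where "a = g [^] (p ^ m)"
    have a: "a \<in> carrier L" "a \<notin> F" "a [^] p \<in> F"
      using gc n not_less_Least[of m "\<lambda>n. g [^] (p ^ n) \<in> F"] m
      unfolding a_def n_def[symmetric] by (auto simp: nat_pow_pow mult.commute)
    have mu: "\<xi> \<in> F" if "\<xi> \<in> carrier L" "\<xi> [^] p = \<one>" for \<xi> using roots_of_unity[OF that] F(2) by auto
    have deg: "degree (Irr F a) = p" by (rule degree_Irr_of_pth_root[OF F(1) p a mu])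
    have i4: "\<exists>i\<in>F. i \<otimes> i = \<ominus> \<one>" if "p = 2" using fourth_root[OF that] F(2) by blast
    interpret k: kummer_extension L F p a \<zeta>
      by (intro kummer_extension.intro kummer_extension_axioms.intro field_axioms)
        (fact F(1) p a(1) a(3) deg subsetD[OF F(2) \<zeta>(1)] \<zeta>(2,3) mu i4)+
    let ?E = "simple_extension F a"
    have GE: "mult_subgroup (G \<inter> ?E)" by (rule mult_subgroup_Int_subfield[OF G k.E_subfield])
    have up: "class_independent F (G \<inter> ?E)"
    proof (rule class_independent_rescale[OF class_independent_powers[OF F(1) a(1) k.alg, of p] F(1)])
      show "p \<le> degree (Irr F a)" using deg by simp
      show "{a [^] k |k. k < p} \<subseteq> carrier L" using a by auto
      fix x assume x: "x \<in> G \<inter> ?E"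
      obtain n where "x [^] (p ^ n) \<in> F" using tors x F(2) by auto
      then obtain k f where kf: "k < p" "f \<in> F" "x = f \<otimes> a [^] k"
        using k.p_power_root[of x n] x Gc(2) by auto
      moreover have "f \<noteq> \<zero>" using kf(3) x Gc(2)[of x] a(1) by auto
      ultimately show "\<exists>f\<in>F. \<exists>g\<in>{a [^] k |k. k < p}. f \<noteq> \<zero> \<and> x = f \<otimes> g" by blast
    qed
    have "G \<inter> ?E \<inter> F = G \<inter> F" using k.F_incl by auto
    hence "class_independent K (G \<inter> ?E)"
      using class_independent_tower[OF K F(1,2) GE _ up] F(3) by simp
    hence "?E = F" using F(4)[OF k.E_subfield k.F_incl] by simp
    thus False using k.a_mem a by simp
  qed
  hence "G \<inter> F = G" by auto
  thus ?thesis using F(3) by simp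
qed

end

section \<open>From condition 2 to independence, prime by prime\<close>

locale kneser_data = field R for R (structure) +
  fixes K U :: "'a set"
  assumes K: "subfield K R" and U: "mult_subgroup U" and K_U: "K - {\<zero>} \<subseteq> U"
    and torsion: "\<And>u. u \<in> U \<Longrightarrow> \<exists>n>0. u [^] (n::nat) \<in> K"
    and essential: "\<And>q u. \<lbrakk> prime (q::nat); u \<in> U; u [^] q = \<one> \<rbrakk> \<Longrightarrow> u \<in> K"
    and one_plus_i: "\<And>i. \<lbrakk> i \<in> U; i \<notin> K; i \<otimes> i = \<ominus> \<one> \<rbrakk> \<Longrightarrow> \<one> \<oplus> i \<notin> U"
    and char_torsion: "\<And>q u. \<lbrakk> prime (q::nat); [q] \<cdot> \<one> = \<zero>; u \<in> U; u [^] q \<in> K \<rbrakk> \<Longrightarrow> u \<in> K"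
begin

lemmas K_closed = subfield_closed[OF K]
lemmas U_closed = mult_subgroupD[OF U]

end

text \<open>Here all auxiliary extensions exist inside L. \<open>kneser_data\<close> alone is
  condition 2, together with the hypothesis on the characteristic, restated for single
  elements.\<close>

locale kneser_group = algebraically_closed L + kneser_data L K U for L (structure) and K U
begin

text \<open>The preimage in U of the p-primary part of U/K^\<times>; it contains K - {0} for every
  p.\<close>

definition primary_part :: "nat \<Rightarrow> 'a set" where
  "primary_part p = {u \<in> U. \<exists>n. u [^] (p ^ n) \<in> K}"

text \<open>The preimage in U of the product of the q-primary parts of U/K^\<times> with q \<le> n.
  The induction over primes is an induction on n, starting from K - {0}.\<close>

definition smooth_part :: "nat \<Rightarrow> 'a set" where
  "smooth_part n = {u \<in> U. \<exists>m>0. u [^] m \<in> K \<and> (\<forall>q. prime q \<and> q dvd m \<longrightarrow> q \<le> n)}"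

lemma mult_subgroup_exponents:
  assumes P: "P (1::nat)" "\<And>m n. P m \<Longrightarrow> P n \<Longrightarrow> P (m * n)"
  shows "mult_subgroup {u \<in> U. \<exists>m. P m \<and> u [^] m \<in> K}" (is "mult_subgroup ?A")
proof -
  have "x \<otimes> y \<in> ?A" if xy: "x \<in> ?A" "y \<in> ?A" for x y
  proof -
    obtain k m where km: "x [^] k \<in> K" "y [^] m \<in> K" "x \<in> U" "y \<in> U" "P k" "P m" using xy by auto
    have "(x \<otimes> y) [^] (k * m) = (x [^] k) [^] m \<otimes> (y [^] m) [^] k"
      using U_closed(1)[OF km(3)] U_closed(1)[OF km(4)] by (simp add: nat_pow_distrib nat_pow_pow mult.commute)
    also have "\<dots> \<in> K" using km K_closed(5,8) by blast
    finally show ?thesis using U_closed(4)[OF km(3,4)] P(2)[OF km(5,6)] by blast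
  qed
  moreover have "inv x \<in> ?A" if x: "x \<in> ?A" for x
  proof -
    obtain k where k: "x [^] k \<in> K" "x \<in> U" "P k" using x by auto
    note xc = U_closed(1,2)[OF k(2)]
    have "(inv x) [^] k \<in> K" using inv_pow[OF xc] K_closed(7)[OF k(1)] pow_nonzero[OF xc] by simp
    thus ?thesis using U_closed(5)[OF k(2)] k(3) by blast
  qed
  moreover have "\<one> \<in> ?A" using U_closed(3) K_closed(3) P(1) by auto
  moreover have "?A \<subseteq> U" by blast
  ultimately show ?thesis using U unfolding mult_subgroup_def by (meson subset_trans)
qed

lemma primary_part_mult_subgroup: "mult_subgroup (primary_part p)"
proof -
  have "mult_subgroup {u \<in> U. \<exists>m. (\<exists>n. m = p ^ n) \<and> u [^] m \<in> K}"
  proof (rule mult_subgroup_exponents)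
    show "\<exists>n. 1 = p ^ n" by (rule exI[of _ 0]) simp
  qed (metis power_add)
  moreover have "primary_part p = {u \<in> U. \<exists>m. (\<exists>n. m = p ^ n) \<and> u [^] m \<in> K}"
    unfolding primary_part_def by auto
  ultimately show ?thesis by simp
qed

lemma smooth_part_eq:
  "smooth_part n = {u \<in> U. \<exists>m. (m > 0 \<and> (\<forall>q. prime q \<and> q dvd m \<longrightarrow> q \<le> n)) \<and> u [^] m \<in> K}"
  unfolding smooth_part_def by blast

lemma smooth_part_mult_subgroup: "mult_subgroup (smooth_part n)"
  unfolding smooth_part_eq by (rule mult_subgroup_exponents) (auto simp: prime_dvd_mult_iff)

lemma K_smooth_part: "K - {\<zero>} \<subseteq> smooth_part n"
proof
  fix x assume x: "x \<in> K - {\<zero>}"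
  have "(0::nat) < 1 \<and> (\<forall>q. prime q \<and> q dvd (1::nat) \<longrightarrow> q \<le> n)" "x [^] (1::nat) \<in> K"
    using x K_closed(1) by auto
  thus "x \<in> smooth_part n" using x K_U unfolding smooth_part_eq by blast
qed

text \<open>Let m = m' p^k with m' prime to p, and m' x = p^k y + 1. In u = u^(-p^k y) u^(m' x) the
  first factor has exponent m', the second has exponent p^k.\<close>

lemma smooth_part_decomp:
  assumes p: "prime p" and u: "u \<in> smooth_part p"
  shows "\<exists>v\<in>smooth_part (p - 1). \<exists>w\<in>primary_part p. u = v \<otimes> w"
proof -
  obtain m where m: "m > 0" "u [^] m \<in> K" "\<And>q. prime q \<Longrightarrow> q dvd m \<Longrightarrow> q \<le> p" "u \<in> U"
    using u unfolding smooth_part_def by auto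
  obtain k m' where km: "\<not> p dvd m'" "m = m' * p ^ k"
    using prime_power_canonical[OF p m(1)] by blast
  have m'0: "m' \<noteq> 0" using km m(1) by (intro notI) simp
  have sm: "q \<le> p - 1" if "prime q" "q dvd m'" for q
  proof -
    have "q \<noteq> p" using that km(1) by auto
    moreover have "q \<le> p" using m(3)[OF that(1)] that(2) km(2) by simp
    ultimately show ?thesis by simp
  qed
  have "coprime m' (p ^ k)" using km(1) p by (metis coprime_commute coprime_power_right_iff prime_imp_coprime)
  then obtain x y where xy: "m' * x = p ^ k * y + 1" using bezout_nat[OF m'0, of "p ^ k"] by auto
  note uc = U_closed(1,2)[OF m(4)]
  let ?w = "u [^] (m' * x)" and ?v = "inv (u [^] (p ^ k * y))"
  have vU: "u [^] (p ^ k * y) \<in> U" "?v \<in> U" "?w \<in> U" using m(4) U_closed(5,6) by auto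
  have "?v \<otimes> ?w = ?v \<otimes> (u [^] (p ^ k * y) \<otimes> u)" using xy uc by simp
  also have "\<dots> = u" using nonzero_inv[OF U_closed(1,2)[OF vU(1)]] U_closed(1)[OF vU(1)] uc by (simp add: m_assoc[symmetric])
  finally have e: "u = ?v \<otimes> ?w" by simp
  have "?w [^] (p ^ k) = (u [^] m) [^] x" using uc km(2) by (simp add: nat_pow_pow ac_simps)
  hence "?w [^] (p ^ k) \<in> K" using K_closed(8)[OF m(2)] by simp
  hence w: "?w \<in> primary_part p" using vU unfolding primary_part_def by blast
  have "(u [^] (p ^ k * y)) [^] m' = (u [^] m) [^] y" using uc km(2) by (simp add: nat_pow_pow ac_simps)
  hence "(u [^] (p ^ k * y)) [^] m' \<in> K" using K_closed(8)[OF m(2)] by simp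
  hence "u [^] (p ^ k * y) \<in> smooth_part (p - 1)" using vU(1) m'0 sm unfolding smooth_part_def by blast
  hence "?v \<in> smooth_part (p - 1)" using mult_subgroupD(5)[OF smooth_part_mult_subgroup] by blast
  thus ?thesis using w e by blast
qed

lemma smooth_part_mono: "n \<le> n' \<Longrightarrow> smooth_part n \<subseteq> smooth_part n'"
  unfolding smooth_part_def using order_trans by blast

lemma smooth_part_nonprime:
  assumes "\<not> prime p" shows "smooth_part p \<subseteq> smooth_part (p - 1)"
proof -
  have "q \<le> p - 1" if "prime q" "q \<le> p" for q using assms that by (cases "q = p") auto
  thus ?thesis unfolding smooth_part_def by blast
qed

text \<open>In characteristic p a p-th root in U of an element of K lies in K, so the p-primary part
  is no larger than K - {0}.\<close>

lemma smooth_part_char: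
  assumes p: "prime p" "[p] \<cdot> \<one> = \<zero>" shows "smooth_part p \<subseteq> smooth_part (p - 1)"
proof
  fix u assume "u \<in> smooth_part p"
  then obtain v w where vw: "v \<in> smooth_part (p - 1)" "w \<in> primary_part p" "u = v \<otimes> w"
    using smooth_part_decomp[OF p(1)] by blast
  then obtain n where w: "w \<in> U" "w [^] (p ^ n) \<in> K" unfolding primary_part_def by auto
  have "U \<subseteq> carrier L" using U_closed(1) by blast
  from prime_power_descent[OF p(1) this U_closed(6) char_torsion[OF p] w] have "w \<in> K" .
  hence "w \<in> smooth_part (p - 1)" using K_smooth_part U_closed(2)[OF w(1)] by blast
  thus "u \<in> smooth_part (p - 1)" using vw mult_subgroupD(4)[OF smooth_part_mult_subgroup] by blast
qed

text \<open>
  The tower $K \<subseteq> F$: the part of $U$ whose exponents have only prime factors below $p$ lies in $F$, and the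
  $p$-primary part meets $F$ in $K$ because a $p$-th root $v \<in> F$ of an element of $K$ differs from
  some $b \<in> K$ by a $p$-th root of unity in $U$.
\<close>

lemma smooth_part_odd:
  assumes p: "prime p" "p \<noteq> 2" and pc: "[p] \<cdot> \<one> \<noteq> \<zero>"
    and IH: "class_independent K (smooth_part (p - 1))"
  shows "class_independent K (smooth_part p)"
proof -
  obtain F where F: "subfield F L" "K \<subseteq> F"
    "\<And>g. \<lbrakk> g \<in> F; g [^] p \<in> K \<rbrakk> \<Longrightarrow> \<exists>b\<in>K. b [^] p = g [^] p"
    "\<And>q a. \<lbrakk> q \<in> carrier (F[X]); q \<noteq> []; degree q < p; a \<in> carrier L; eval q a = \<zero> \<rbrakk> \<Longrightarrow> a \<in> F"
    by (rule pth_power_stable_closure[OF K p(1)]) (rule that; assumption)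
  note Fc = subfield_closed[OF F(1)]
  have p0: "p > 0" using p prime_gt_0_nat by blast
  \<comment> \<open>A nontrivial p-th root of unity satisfies an equation of degree p - 1, which F
    absorbs.\<close>
  have mu: "\<xi> \<in> F" if x: "\<xi> \<in> carrier L" "\<xi> [^] p = \<one>" for \<xi>
  proof (cases "\<xi> = \<one>")
    case True thus ?thesis using Fc by simp
  next
    case False
    note e = eval_geometric[OF x(1), of p]
    have "eval (replicate p \<one>) \<xi> \<otimes> (\<xi> \<ominus> \<one>) = \<zero>" using e x by (simp add: a_minus_def r_neg)
    hence "eval (replicate p \<one>) \<xi> = \<zero> \<or> \<xi> \<ominus> \<one> = \<zero>" using integral[OF _ e(1) minus_closed[OF x(1) one_closed]] by simp
    hence "eval (replicate p \<one>) \<xi> = \<zero>" using False x(1) by (simp add: r_right_minus_eq)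
    thus ?thesis using F(4)[OF geometric_poly_carrier[OF F(1)] _ _ x(1)] p0 by simp
  qed
  obtain \<zeta> where z: "\<zeta> \<in> carrier L" "\<zeta> [^] p = \<one>" "\<zeta> \<noteq> \<one>"
    using exists_nontrivial_root_of_unity[OF p(1) pc] .
  have P_F: "class_independent F (primary_part p)"
    by (rule kummer_class_independent[OF F(1) p(1) mu[OF z(1,2)] z(2,3) mu _ primary_part_mult_subgroup])
      (use p F(2) in \<open>auto simp: primary_part_def\<close>)
  have q_root: "a \<in> F" if "prime q" "q < p" "a \<in> carrier L" "a [^] q \<in> F" for q a
  proof -
    have q0: "q > 0" using that prime_gt_0_nat by blast
    note b = binomial_poly[OF F(1) that(4) q0]
    show ?thesis by (rule F(4)[OF b(1,2) _ that(3)]) (use b(3) b(4)[OF that(3)] that in \<open>simp_all add: a_minus_def r_neg\<close>)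
  qed
  \<comment> \<open>Only primes q \<le> p - 1 divide the exponent, and X^q - c has degree below p,
    so extracting roots one prime at a time never leaves F.\<close>
  have smooth_F: "smooth_part (p - 1) \<subseteq> F"
  proof
    fix u assume "u \<in> smooth_part (p - 1)"
    then obtain m where m: "m > 0" "u [^] m \<in> K" "\<And>q. prime q \<Longrightarrow> q dvd m \<Longrightarrow> q \<le> p - 1" "u \<in> U"
      unfolding smooth_part_def by auto
    have "v \<in> F" if "prime q" "q dvd m" "v \<in> U" "v [^] q \<in> F" for q v
      using q_root[OF that(1) _ U_closed(1)[OF that(3)] that(4)] m(3)[OF that(1,2)] p0 by simp
    thus "u \<in> F" using m(2) F(2) by (intro exponent_descent[of U m F u]) (use m U_closed(1,6) in blast)+
  qed
  have P_Int: "u \<in> K" if u: "u \<in> primary_part p" "u \<in> F" for u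
  proof -
    obtain n where n: "u \<in> U" "u [^] (p ^ n) \<in> K" using u unfolding primary_part_def by auto
    have step: "v \<in> K" if v: "v \<in> U" "v \<in> F" "v [^] p \<in> K" for v
    proof -
      note vc = U_closed(1,2)[OF v(1)]
      obtain b where b: "b \<in> K" "b [^] p = v [^] p" using F(3)[OF v(2,3)] by auto
      have bc: "b \<in> carrier L" using b K_closed by auto
      note e = pow_eq_quotient[OF vc bc b(2) p0]
      have "v \<otimes> inv b \<in> U" using U_closed(4)[OF v(1)] K_U K_closed(7)[OF b(1) e(1)] nonzero_inv(2)[OF bc e(1)] by blast
      hence "v \<otimes> inv b \<in> K" using essential[OF p(1) _ e(2)] by blast
      hence "v \<otimes> inv b \<otimes> b \<in> K" using K_closed(5) b(1) by blast
      thus ?thesis using e(3) by simp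
    qed
    show "u \<in> K"
      by (rule prime_power_descent[OF p(1), of "U \<inter> F" K u n]) (use n u(2) step U_closed(1,6) Fc(8) in blast)+
  qed
  show ?thesis
  proof (rule class_independent_tower[OF K F(1,2) smooth_part_mult_subgroup])
    show "class_independent F (smooth_part p)"
    proof (rule class_independent_rescale[OF P_F F(1)])
      show "primary_part p \<subseteq> carrier L" using U_closed(1) unfolding primary_part_def by auto
      fix x assume "x \<in> smooth_part p"
      then obtain v w where vw: "v \<in> smooth_part (p - 1)" "w \<in> primary_part p" "x = v \<otimes> w"
        using smooth_part_decomp[OF p(1)] by blast
      moreover have "v \<noteq> \<zero>" using mult_subgroupD(2)[OF smooth_part_mult_subgroup vw(1)] .
      ultimately show "\<exists>f\<in>F. \<exists>g\<in>primary_part p. f \<noteq> \<zero> \<and> x = f \<otimes> g" using smooth_F by blast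
    qed
    \<comment> \<open>If x = v w lies in F, so does w since v does; then w lies in K, and x belongs
      to the part handled by the induction hypothesis.\<close>
    show "class_independent K (smooth_part p \<inter> F)"
    proof (rule class_independent_mono[OF IH], rule subsetI)
      fix x assume x: "x \<in> smooth_part p \<inter> F"
      then obtain v w where vw: "v \<in> smooth_part (p - 1)" "w \<in> primary_part p" "x = v \<otimes> w"
        using smooth_part_decomp[OF p(1)] by blast
      have v: "v \<in> F" "v \<in> carrier L" "v \<noteq> \<zero>"
        using smooth_F vw(1) mult_subgroupD(1,2)[OF smooth_part_mult_subgroup vw(1)] by auto
      have w: "w \<in> carrier L" "w \<noteq> \<zero>" using mult_subgroupD(1,2)[OF primary_part_mult_subgroup vw(2)] by auto
      have "w = inv v \<otimes> x" using vw(3) v w nonzero_inv[OF v(2,3)] by (simp add: m_assoc[symmetric])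
      hence "w \<in> F" using v x Fc(5,7) by auto
      hence "w \<in> smooth_part (p - 1)" using P_Int[OF vw(2)] w(2) K_smooth_part by blast
      thus "x \<in> smooth_part (p - 1)" using vw mult_subgroupD(4)[OF smooth_part_mult_subgroup] by blast
    qed
  qed
qed

text \<open>Let \<iota> be a square root of -1. If it lies in K, Kummer theory applies at once.
  Otherwise it applies over K(\<iota>), and the 2-primary elements inside K(\<iota>) turn out to be
  K-multiples of 1 or \<iota>, which are independent.\<close>

lemma primary_part_two:
  assumes two: "[(2::nat)] \<cdot> \<one> \<noteq> \<zero>"
  shows "class_independent K (primary_part 2)"
proof -
  have one_one: "\<one> \<oplus> \<one> \<noteq> \<zero>" using two by (simp add: numeral_2_eq_2)
  have m1: "\<ominus> \<one> \<noteq> \<one>"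
  proof
    assume "\<ominus> \<one> = \<one>" thus False using one_one r_neg[OF one_closed] by simp
  qed
  have m1sq: "(\<ominus> \<one>) [^] (2::nat) = \<one>" using l_minus[of \<one> "\<ominus> \<one>"] by (simp add: numeral_2_eq_2)
  have sq: "x [^] (2::nat) = x \<otimes> x" if "x \<in> carrier L" for x using that by (simp add: numeral_2_eq_2)
  have mu: "\<xi> \<in> F" if "subfield F L" "\<xi> \<in> carrier L" "\<xi> [^] (2::nat) = \<one>" for \<xi> F
  proof -
    have "\<xi> = \<one> \<or> \<xi> = \<ominus> \<one>" using square_eq_cases[OF that(2) one_closed] sq[OF that(2)] that(3) by simp
    thus ?thesis using subfield_closed(3,4)[OF that(1)] by blast
  qed
  have "binomial_poly 2 (\<ominus> \<one>) \<in> carrier (poly_ring L)" "degree (binomial_poly 2 (\<ominus> \<one>)) > 0"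
    using binomial_poly(1,3)[OF carrier_is_subfield, of "\<ominus> \<one>" 2] by auto
  then obtain \<iota> where i0: "\<iota> \<in> carrier L" "eval (binomial_poly 2 (\<ominus> \<one>)) \<iota> = \<zero>" by (rule exists_root)
  hence "\<iota> [^] (2::nat) = \<ominus> \<one>"
    using binomial_poly(4)[OF carrier_is_subfield, of "\<ominus> \<one>" 2 \<iota>] by (simp add: r_right_minus_eq)
  hence ii: "\<iota> \<otimes> \<iota> = \<ominus> \<one>" "\<iota> [^] (2::nat) = \<ominus> \<one>" using sq[OF i0(1)] by auto
  have tors: "\<exists>n. g [^] (2 ^ n :: nat) \<in> K" if "g \<in> primary_part 2" for g using that unfolding primary_part_def by auto
  show ?thesis
  proof (cases "\<iota> \<in> K")
    case True
    show ?thesis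
      by (rule kummer_class_independent[OF K two_is_prime_nat K_closed(4)[OF K_closed(3)] m1sq m1 mu[OF K] _
          primary_part_mult_subgroup tors]) (use True ii in auto)
  next
    case False
    have iK: "\<iota> [^] (2::nat) \<in> K" using ii K_closed by auto
    have deg: "degree (Irr K \<iota>) = 2" by (rule degree_Irr_of_pth_root[OF K two_is_prime_nat i0(1) False iK mu[OF K]])
    have alg: "(algebraic over K) \<iota>" by (rule algebraic_of_pow(1)[OF K i0(1) iK]) simp
    let ?F = "simple_extension K \<iota>"
    have F: "subfield ?F L" using simple_extension_is_subfield[OF K i0(1)] alg by simp
    note Fc = subfield_closed[OF F]
    have KF: "K \<subseteq> ?F" by (rule simple_extension_incl[OF subfieldE(3)[OF K] i0(1)])
    have iF: "\<iota> \<in> ?F" using simple_extension_mem[OF subfieldE(1)[OF K] i0(1)] .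
    have coord: "x = \<zero> \<and> y = \<zero>" if xy: "x \<in> K" "y \<in> K" "x \<oplus> y \<otimes> \<iota> = \<zero>" for x y
    proof -
      have c: "x \<in> carrier L" "y \<in> carrier L" using xy K_closed by auto
      have "y = \<zero>"
      proof (rule ccontr)
        assume y: "y \<noteq> \<zero>"
        note i = nonzero_inv[OF c(2) y]
        have "y \<otimes> \<iota> = \<ominus> x" using xy(3) c i0(1) by (metis add.inv_equality a_comm m_closed)
        hence "inv y \<otimes> (y \<otimes> \<iota>) = inv y \<otimes> (\<ominus> x)" by simp
        hence "\<iota> = inv y \<otimes> (\<ominus> x)" using i c i0(1) by (simp add: m_assoc[symmetric])
        thus False using False K_closed(4,5,7) xy y by metis
      qed
      thus ?thesis using xy(3) c i0(1) by simp
    qed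
    have rep: "\<exists>x\<in>K. \<exists>y\<in>K. g = x \<oplus> y \<otimes> \<iota>" if g: "g \<in> ?F" for g
    proof -
      obtain c where c: "c \<in> {..<2::nat} \<rightarrow> K" "g = (\<Oplus>k\<in>{..<2::nat}. c k \<otimes> \<iota> [^] k)"
        using simple_extension_mem_power_sum[OF K i0(1) alg g] unfolding deg .
      have cK: "c 0 \<in> K" "c 1 \<in> K" using c(1) by auto
      have "{..<2::nat} = {1, 0}" by auto
      hence "g = c 1 \<otimes> \<iota> \<oplus> c 0" using c(2) cK K_closed(1) i0(1) by simp
      thus ?thesis using cK K_closed(1) i0(1) a_comm by (metis m_closed)
    qed
    \<comment> \<open>For \<open>g = x + y \<iota>\<close> either \<open>g\<^sup>2 \<in> K\<close> and \<open>x y = 0\<close>, or \<open>g\<^sup>2 \<in> K \<iota>\<close> and \<open>x = \<plusminus> y\<close>, which puts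
      \<open>1 + \<iota>\<close> into \<open>U\<close>.\<close>
    have key: "g \<in> K \<or> (\<iota> \<in> U \<and> (\<exists>b\<in>K. b \<noteq> \<zero> \<and> g = b \<otimes> \<iota>))"
      if "g \<in> U" "g \<in> ?F" "g [^] (2 ^ n :: nat) \<in> K" for g n
      using that
    proof (induct n arbitrary: g)
      case 0 thus ?case using U_closed(1) by simp
    next
      case (Suc n)
      note gc = U_closed(1,2)[OF Suc(2)]
      have "(g [^] (2::nat)) [^] (2 ^ n :: nat) \<in> K" using Suc(4) gc by (simp add: nat_pow_pow)
      from Suc(1)[OF U_closed(6)[OF Suc(2)] Fc(8)[OF Suc(3)] this]
      have h: "g \<otimes> g \<in> K \<or> (\<iota> \<in> U \<and> (\<exists>b\<in>K. b \<noteq> \<zero> \<and> g \<otimes> g = b \<otimes> \<iota>))" unfolding sq[OF gc(1)] .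
      obtain x y where xy: "x \<in> K" "y \<in> K" "g = x \<oplus> y \<otimes> \<iota>" using rep[OF Suc(3)] by auto
      have c: "x \<in> carrier L" "y \<in> carrier L" using xy K_closed by auto
      have "g \<otimes> g = x \<otimes> x \<oplus> (y \<otimes> y) \<otimes> (\<iota> \<otimes> \<iota>) \<oplus> (x \<otimes> y \<oplus> x \<otimes> y) \<otimes> \<iota>"
        unfolding xy(3) using c i0(1) by algebra
      hence gg: "g \<otimes> g = (x \<otimes> x \<ominus> y \<otimes> y) \<oplus> (x \<otimes> y \<oplus> x \<otimes> y) \<otimes> \<iota>"
        unfolding ii using c by (simp add: r_minus a_minus_def)
      have xx: "x \<otimes> x \<in> K" and yy: "y \<otimes> y \<in> K" and xyK: "x \<otimes> y \<in> K" using xy(1,2) K_closed(5) by auto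
      show ?case
      proof (cases "g \<otimes> g \<in> K")
        case True
        have "((x \<otimes> x \<ominus> y \<otimes> y) \<ominus> g \<otimes> g) \<oplus> (x \<otimes> y \<oplus> x \<otimes> y) \<otimes> \<iota> = g \<otimes> g \<ominus> g \<otimes> g"
          unfolding gg using c i0(1) by algebra
        also have "\<dots> = \<zero>" using gc by (simp add: a_minus_def r_neg)
        finally have "x \<otimes> y \<oplus> x \<otimes> y = \<zero>"
          using coord[OF K_closed(9)[OF K_closed(9)[OF xx yy] True] K_closed(6)[OF xyK xyK]] by simp
        \<comment> \<open>The factor 2 can be cancelled because the characteristic is not 2.\<close>
        hence "(\<one> \<oplus> \<one>) \<otimes> (x \<otimes> y) = \<zero>" using c by (simp add: l_distr)
        hence "x \<otimes> y = \<zero>" using integral[of "\<one> \<oplus> \<one>" "x \<otimes> y"] one_one c by auto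
        hence "x = \<zero> \<or> y = \<zero>" using integral c by blast
        thus ?thesis
        proof
          assume "y = \<zero>" thus ?thesis using xy c i0(1) by simp
        next
          assume "x = \<zero>"
          hence g: "g = y \<otimes> \<iota>" using xy(3) c i0(1) by simp
          hence y0: "y \<noteq> \<zero>" using gc(2) i0(1) by (metis l_null)
          note iv = nonzero_inv[OF c(2) y0]
          have "\<iota> = inv y \<otimes> g" using g iv c i0(1) by (simp add: m_assoc[symmetric])
          moreover have "inv y \<in> U" using K_U K_closed(7)[OF xy(2) y0] iv(2) by auto
          ultimately have "\<iota> \<in> U" using U_closed(4)[of "inv y" g] Suc(2) by simp
          thus ?thesis using g y0 xy(2) by blast
        qed
      next
        case False
        then obtain b where b: "\<iota> \<in> U" "b \<in> K" "g \<otimes> g = b \<otimes> \<iota>" using h by auto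
        have bc: "b \<in> carrier L" using b K_closed by auto
        have "(x \<otimes> x \<ominus> y \<otimes> y) \<oplus> ((x \<otimes> y \<oplus> x \<otimes> y) \<ominus> b) \<otimes> \<iota> = g \<otimes> g \<ominus> b \<otimes> \<iota>"
          unfolding gg using c i0(1) bc by algebra
        also have "\<dots> = \<zero>" using b(3) bc i0(1) by (simp add: a_minus_def r_neg)
        finally have "x \<otimes> x \<ominus> y \<otimes> y = \<zero>"
          using coord[OF K_closed(9)[OF xx yy] K_closed(9)[OF K_closed(6)[OF xyK xyK] b(2)]] by simp
        hence "x \<otimes> x = y \<otimes> y" using c by (simp add: r_right_minus_eq)
        hence x: "x = y \<or> x = \<ominus> y" using square_eq_cases c by blast
        have y0: "y \<noteq> \<zero>"
        proof
          assume "y = \<zero>"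
          hence "x = \<zero>" using x by auto
          thus False using gc(2) xy(3) \<open>y = \<zero>\<close> i0(1) by simp
        qed
        note iv = nonzero_inv[OF c(2) y0]
        have ivU: "inv y \<in> U" using K_U K_closed(7)[OF xy(2) y0] iv(2) by auto
        have gU: "inv y \<otimes> g \<in> U" using U_closed(4)[OF ivU Suc(2)] .
        \<comment> \<open>Up to the scalar y, g is 1 + \<iota> or \<iota> - 1 = \<iota> (1 +
          \<iota>). As \<iota> is in U, both put 1 + \<iota> into U.\<close>
        have "\<one> \<oplus> \<iota> \<in> U" using x
        proof
          assume "x = y"
          hence "inv y \<otimes> g = (inv y \<otimes> y) \<otimes> (\<one> \<oplus> \<iota>)" unfolding xy(3) using c i0(1) iv(1) by algebra
          thus ?thesis using gU iv i0(1) by simp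
        next
          assume "x = \<ominus> y"
          hence "inv y \<otimes> g = (inv y \<otimes> y) \<otimes> (\<iota> \<ominus> \<one>)" unfolding xy(3) using c i0(1) iv(1) by algebra
          also have "\<dots> = \<iota> \<ominus> \<one>" using iv i0(1) by simp
          also have "\<dots> = \<iota> \<oplus> \<iota> \<otimes> \<iota>" unfolding ii(1) by (simp add: a_minus_def)
          also have "\<dots> = \<iota> \<otimes> (\<one> \<oplus> \<iota>)" using i0(1) by algebra
          finally have e: "inv y \<otimes> g = \<iota> \<otimes> (\<one> \<oplus> \<iota>)" .
          note ic = nonzero_inv[OF U_closed(1,2)[OF b(1)]]
          have "inv \<iota> \<otimes> (inv y \<otimes> g) = \<one> \<oplus> \<iota>" unfolding e using ic i0(1) by (simp add: m_assoc[symmetric])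
          thus ?thesis using U_closed(4)[OF U_closed(5)[OF b(1)] gU] by simp
        qed
        thus ?thesis using one_plus_i[OF b(1) \<open>\<iota> \<notin> K\<close> ii(1)] by blast
      qed
    qed
    have low: "class_independent K (primary_part 2 \<inter> ?F)"
    proof (rule class_independent_rescale[OF class_independent_powers[OF K i0(1) alg, of 2] K])
      show "2 \<le> degree (Irr K \<iota>)" using deg by simp
      show "{\<iota> [^] k |k. k < (2::nat)} \<subseteq> carrier L" using i0 by auto
      fix g assume g: "g \<in> primary_part 2 \<inter> ?F"
      obtain n where n: "g \<in> U" "g [^] (2 ^ n :: nat) \<in> K" using g unfolding primary_part_def by auto
      have gF: "g \<in> ?F" using g by auto
      from key[OF n(1) gF n(2)] show "\<exists>f\<in>K. \<exists>h\<in>{\<iota> [^] k |k. k < (2::nat)}. f \<noteq> \<zero> \<and> g = f \<otimes> h"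
      proof
        assume "g \<in> K"
        moreover have "g = g \<otimes> \<iota> [^] (0::nat)" using U_closed(1)[OF n(1)] by simp
        ultimately show ?thesis using U_closed(2)[OF n(1)] by (metis (mono_tags, lifting) mem_Collect_eq pos2)
      next
        assume "\<iota> \<in> U \<and> (\<exists>b\<in>K. b \<noteq> \<zero> \<and> g = b \<otimes> \<iota>)"
        then obtain b where b: "b \<in> K" "b \<noteq> \<zero>" "g = b \<otimes> \<iota>" by auto
        hence "g = b \<otimes> \<iota> [^] (1::nat)" using i0(1) by simp
        thus ?thesis using b by (metis (mono_tags, lifting) mem_Collect_eq one_less_numeral_iff semiring_norm(76))
      qed
    qed
    have up: "class_independent ?F (primary_part 2)"
    proof (rule kummer_class_independent[OF F two_is_prime_nat Fc(4)[OF Fc(3)] m1sq m1 mu[OF F] _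
          primary_part_mult_subgroup])
      show "\<exists>i\<in>?F. i \<otimes> i = \<ominus> \<one>" using iF ii by auto
      show "\<exists>n. g [^] (2 ^ n :: nat) \<in> ?F" if "g \<in> primary_part 2" for g using tors[OF that] KF by auto
    qed
    show ?thesis by (rule class_independent_tower[OF K F KF primary_part_mult_subgroup low up])
  qed
qed

lemma smooth_part_one: "smooth_part 1 \<subseteq> K"
proof
  fix u assume "u \<in> smooth_part 1"
  then obtain m :: nat where m: "m > 0" "u [^] m \<in> K" "\<And>q. prime q \<Longrightarrow> q dvd m \<Longrightarrow> q \<le> 1" "u \<in> U"
    unfolding smooth_part_def by blast
  have "m = 1"
  proof (rule ccontr)
    assume "m \<noteq> 1"
    then obtain q where q: "prime q" "q dvd m" using prime_factor_nat by blast
    thus False using m(3)[OF q] prime_gt_1_nat[OF q(1)] by simp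
  qed
  thus "u \<in> K" using m(2,4) U_closed(1) by simp
qed

text \<open>A step adds something new only at a prime that is nonzero in L. At the prime 2 the
  smaller part lies in K, so the whole part is 2-primary.\<close>

lemma smooth_part_class_independent: "class_independent K (smooth_part n)"
proof (induct n)
  case 0
  have "smooth_part 0 \<subseteq> K - {\<zero>}" using smooth_part_mono[of 0 1] smooth_part_one mult_subgroupD(2)[OF smooth_part_mult_subgroup] by blast
  thus ?case by (rule class_independent_subset[OF K])
next
  case (Suc n)
  let ?p = "Suc n"
  show ?case
  proof (cases "prime ?p \<and> [?p] \<cdot> \<one> \<noteq> \<zero>")
    case False
    hence "smooth_part ?p \<subseteq> smooth_part n" using smooth_part_nonprime[of ?p] smooth_part_char[of ?p] by auto
    thus ?thesis by (rule class_independent_mono[OF Suc])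
  next
    case True
    show ?thesis
    proof (cases "?p = 2")
      case False
      show ?thesis by (rule smooth_part_odd[OF _ False]) (use True Suc in auto)
    next
      case p2: True
      have "smooth_part 2 \<subseteq> primary_part 2"
      proof
        fix u assume "u \<in> smooth_part 2"
        moreover have "2 - 1 = (1::nat)" by simp
        ultimately obtain v w where vw: "v \<in> smooth_part 1" "w \<in> primary_part 2" "u = v \<otimes> w"
          using smooth_part_decomp[OF two_is_prime_nat, of u] by metis
        have "v [^] (2 ^ 0 :: nat) \<in> K" "v \<in> U"
          using smooth_part_one vw(1) K_closed(1) unfolding smooth_part_def by auto
        hence "v \<in> primary_part 2" unfolding primary_part_def by blast
        thus "u \<in> primary_part 2" using vw mult_subgroupD(4)[OF primary_part_mult_subgroup] by blast
      qed
      thus ?thesis using class_independent_mono[OF primary_part_two] True p2 by metis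
    qed
  qed
qed

text \<open>A finite subset of U has bounded exponents modulo K^\<times>, and a bound on an exponent
  also bounds the primes dividing it.\<close>

theorem kneser: "class_independent K U"
proof (rule class_independent_finite_subsets)
  fix S assume S: "finite S" "S \<subseteq> U"
  have "\<exists>n. S \<subseteq> smooth_part n"
    using S
  proof (induct S)
    case (insert u S)
    then obtain n where n: "S \<subseteq> smooth_part n" by auto
    have u: "u \<in> U" using insert by simp
    obtain m :: nat where m: "m > 0" "u [^] m \<in> K" using torsion[OF u] by auto
    have "q \<le> m" if "q dvd m" for q using dvd_imp_le[OF that m(1)] .
    hence "u \<in> smooth_part m" using m u unfolding smooth_part_def by blast
    hence "insert u S \<subseteq> smooth_part (max n m)"
      using n smooth_part_mono[of n "max n m"] smooth_part_mono[of m "max n m"] by auto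
    thus ?case by blast
  qed simp
  thus "\<exists>H. S \<subseteq> H \<and> class_independent K H" using smooth_part_class_independent by blast
qed

end

text \<open>The embedding \<open>indexed_const\<close> into an algebraic closure is injective. The
  assumptions speak only of field operations and of membership in K and U, so they hold for the
  images, and a relation in R can be judged there.\<close>

theorem (in kneser_data) kneser_class_independent: "class_independent K U"
proof -
  let ?C = "alg_closure" and ?h = "indexed_const :: 'a \<Rightarrow> ('a list \<times> nat) multiset \<Rightarrow> 'a"
  interpret C: algebraic_closure ?C "?h ` carrier R" by (rule alg_closureE(1))
  interpret h: ring_hom_ring R ?C ?h
    using ring_hom_ringI2[OF ring_axioms C.ring_axioms alg_closureE(2)] .
  note Kc = K_closed note Uc = U_closed
  have inj: "x = y" if "?h x = ?h y" for x y using indexed_const_is_inj that unfolding inj_def by auto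
  have sub: "K \<subseteq> carrier R" "U \<subseteq> carrier R" using Kc(1) Uc(1) by auto
  have memK: "?h x \<in> ?h ` K \<longleftrightarrow> x \<in> K" for x using inj by auto
  have memU: "?h x \<in> ?h ` U \<longleftrightarrow> x \<in> U" for x using inj by auto
  have add_pow: "?h ([n] \<cdot> \<one>) = [n] \<cdot>\<^bsub>?C\<^esub> \<one>\<^bsub>?C\<^esub>" for n :: nat by (induct n) simp_all
  have hinv: "?h (inv x) = inv\<^bsub>?C\<^esub> (?h x)" if "x \<in> carrier R" "x \<noteq> \<zero>" for x
  proof -
    note i = nonzero_inv[OF that]
    have "?h x \<otimes>\<^bsub>?C\<^esub> ?h (inv x) = \<one>\<^bsub>?C\<^esub>" using h.hom_mult[OF that(1) i(1)] i(3) by simp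
    thus ?thesis using C.comm_inv_char[of "?h x" "?h (inv x)"] that i by simp
  qed
  have mU: "C.mult_subgroup (?h ` U)"
    unfolding C.mult_subgroup_def
  proof (intro conjI ballI subsetI)
    fix x assume "x \<in> ?h ` U"
    then obtain u where u: "u \<in> U" "x = ?h u" by auto
    have "?h u \<noteq> \<zero>\<^bsub>?C\<^esub>" using inj[of u \<zero>] Uc(2)[OF u(1)] h.hom_zero by metis
    thus "x \<in> carrier ?C - {\<zero>\<^bsub>?C\<^esub>}" using u Uc(1) by auto
    show "inv\<^bsub>?C\<^esub> x \<in> ?h ` U" using hinv[OF Uc(1,2)[OF u(1) ]] u Uc(5) by (metis imageI)
    fix y assume "y \<in> ?h ` U"
    then obtain v where v: "v \<in> U" "y = ?h v" by auto
    have "x \<otimes>\<^bsub>?C\<^esub> y = ?h (u \<otimes> v)" using u v Uc(1) by simp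
    thus "x \<otimes>\<^bsub>?C\<^esub> y \<in> ?h ` U" using Uc(4) u v by auto
  next
    show "\<one>\<^bsub>?C\<^esub> \<in> ?h ` U" using Uc(3) h.hom_one by (metis imageI)
  qed
  interpret k: kneser_group ?C "?h ` K" "?h ` U"
  proof (intro kneser_group.intro kneser_data.intro kneser_data_axioms.intro C.field_axioms)
    show "algebraically_closed ?C" by unfold_locales
    show "subfield (?h ` K) ?C" by (rule h.img_is_subfield(2)[OF K C.one_not_zero])
    show "C.mult_subgroup (?h ` U)" by (rule mU)
    show "?h ` K - {\<zero>\<^bsub>?C\<^esub>} \<subseteq> ?h ` U" using K_U h.hom_zero by auto
  next
    fix u assume "u \<in> ?h ` U"
    then obtain v where v: "v \<in> U" "u = ?h v" by auto
    obtain n where "n > 0" "v [^] (n::nat) \<in> K" using torsion[OF v(1)] by auto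
    thus "\<exists>n>0. u [^]\<^bsub>?C\<^esub> (n::nat) \<in> ?h ` K" using v h.hom_nat_pow[OF Uc(1)[OF v(1)]] memK by metis
  next
    fix q u assume q: "prime (q::nat)" "u \<in> ?h ` U" "u [^]\<^bsub>?C\<^esub> q = \<one>\<^bsub>?C\<^esub>"
    then obtain v where v: "v \<in> U" "u = ?h v" by auto
    have "?h (v [^] q) = ?h \<one>" using q(3) v h.hom_nat_pow[OF Uc(1)[OF v(1)]] by simp
    thus "u \<in> ?h ` K" using essential[OF q(1) v(1)] inj v by auto
  next
    fix i assume i: "i \<in> ?h ` U" "i \<notin> ?h ` K" "i \<otimes>\<^bsub>?C\<^esub> i = \<ominus>\<^bsub>?C\<^esub> \<one>\<^bsub>?C\<^esub>"
    then obtain v where v: "v \<in> U" "i = ?h v" by auto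
    have vc: "v \<in> carrier R" using Uc v by auto
    have "?h (v \<otimes> v) = ?h (\<ominus> \<one>)" using i(3) v vc by simp
    hence "\<one> \<oplus> v \<notin> U" using one_plus_i[OF v(1)] inj i(2) v memK by blast
    moreover have "\<one>\<^bsub>?C\<^esub> \<oplus>\<^bsub>?C\<^esub> i = ?h (\<one> \<oplus> v)" using v vc by simp
    ultimately show "\<one>\<^bsub>?C\<^esub> \<oplus>\<^bsub>?C\<^esub> i \<notin> ?h ` U" using memU by simp
  next
    fix q u assume q: "prime (q::nat)" "[q] \<cdot>\<^bsub>?C\<^esub> \<one>\<^bsub>?C\<^esub> = \<zero>\<^bsub>?C\<^esub>" "u \<in> ?h ` U" "u [^]\<^bsub>?C\<^esub> q \<in> ?h ` K"
    then obtain v where v: "v \<in> U" "u = ?h v" by auto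
    have "?h ([q] \<cdot> \<one>) = ?h \<zero>" using q(2) add_pow[of q] by simp
    hence "[q] \<cdot> \<one> = \<zero>" using inj by blast
    moreover have "v [^] q \<in> K" using q(4) v h.hom_nat_pow[OF Uc(1)[OF v(1)]] memK by metis
    ultimately show "u \<in> ?h ` K" using char_torsion[OF q(1)] v by auto
  qed
  show ?thesis
  proof (rule class_independentI)
    fix S c s assume S: "finite S" "S \<subseteq> U" and ne: "nonproportional K S"
      and c: "c \<in> S \<rightarrow> K" and eq: "(\<Oplus>s\<in>S. c s \<otimes> s) = \<zero>" and s: "s \<in> S"
    have car: "c x \<in> carrier R" "x \<in> carrier R" "c x \<in> K" if "x \<in> S" for x
      using Kc(1) funcset_mem[OF c that] Uc(1) S(2) that by auto
    have "(\<Oplus>\<^bsub>?C\<^esub>x\<in>S. ?h (c x) \<otimes>\<^bsub>?C\<^esub> ?h x) = (\<Oplus>\<^bsub>?C\<^esub>x\<in>S. (?h \<circ> (\<lambda>x. c x \<otimes> x)) x)"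
      by (rule C.finsum_cong') (use car in auto)
    also have "\<dots> = ?h (\<Oplus>x\<in>S. c x \<otimes> x)"
      using h.hom_finsum[of "\<lambda>x. c x \<otimes> x" S] car by (auto simp: comp_def)
    finally have z: "(\<Oplus>\<^bsub>?C\<^esub>x\<in>S. ?h (c x) \<otimes>\<^bsub>?C\<^esub> ?h x) = \<zero>\<^bsub>?C\<^esub>" using eq by simp
    have "?h (c s) = \<zero>\<^bsub>?C\<^esub>"
    proof (rule C.class_independentD[OF k.kneser _ _ S(1) _ _ _ _ z s])
      fix i j k assume ij: "i \<in> S" "j \<in> S" "i \<noteq> j" "k \<in> ?h ` K"
      then obtain l where l: "l \<in> K" "k = ?h l" by auto
      have "k \<otimes>\<^bsub>?C\<^esub> ?h j = ?h (l \<otimes> j)" using l car(2)[OF ij(2)] Kc(1) by simp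
      thus "?h i \<noteq> k \<otimes>\<^bsub>?C\<^esub> ?h j" using inj ne ij l by metis
    next
      show "\<one>\<^bsub>?C\<^esub> \<in> ?h ` K" using Kc(3) h.hom_one by (metis imageI)
    qed (use sub S car in auto)
    hence "?h (c s) = ?h \<zero>" by simp
    thus "c s = \<zero>" by (rule inj)
  qed
qed

section \<open>Spans, the algebra E, and independence of the representatives\<close>

context cring
begin

text \<open>Because the elements that a multiplies into E form a subspace, multiplication by a can
  be tested on a spanning list.\<close>

lemma subalgebra_preimage_mult:
  assumes "subalgebra K E R" "a \<in> carrier R" "K \<subseteq> carrier R"
  shows "subalgebra K {w \<in> carrier R. a \<otimes> w \<in> E} R" (is "subalgebra K ?V R")
proof -
  interpret E: subalgebra K E R by fact
  have cl: "v \<oplus> w \<in> E" "\<ominus> v \<in> E" if "v \<in> E" "w \<in> E" for v w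
    using E.m_closed[of v w] E.m_inv_closed[of v] that by (auto simp: a_inv_def)
  show ?thesis
  proof (intro subalgebra.intro subalgebra_axioms.intro add.subgroupI)
    show "?V \<noteq> {}" using E.one_closed assms(2) by (auto intro!: exI[of _ \<zero>])
    show "\<ominus> w \<in> ?V" if "w \<in> ?V" for w using that cl assms(2) by (auto simp: r_minus)
    show "v \<oplus> w \<in> ?V" if "v \<in> ?V" "w \<in> ?V" for v w using that cl assms(2) by (auto simp: r_distr)
    show "k \<otimes> w \<in> ?V" if "k \<in> K" "w \<in> ?V" for k w
    proof -
      have c: "k \<in> carrier R" "w \<in> carrier R" using that assms(3) by auto
      have "a \<otimes> (k \<otimes> w) = k \<otimes> (a \<otimes> w)" using c assms(2) by (simp add: m_lcomm)
      thus ?thesis using E.smult_closed[OF that(1)] that(2) c by auto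
    qed
  qed auto
qed

end

text \<open>Bilinearity: the subspace argument is applied once in each factor.\<close>

lemma (in field) Span_mult_subset:
  assumes K: "subfield K R" and V: "subalgebra K V R"
    and us: "set us \<subseteq> carrier R" and ws: "set ws \<subseteq> carrier R"
    and mult: "\<And>u w. \<lbrakk> u \<in> set us; w \<in> set ws \<rbrakk> \<Longrightarrow> u \<otimes> w \<in> V"
    and v: "v \<in> Span K us" and w: "w \<in> Span K ws"
  shows "v \<otimes> w \<in> V"
proof -
  have KR: "K \<subseteq> carrier R" using subfield_closed(1)[OF K] by auto
  have wc: "w \<in> carrier R" using Span_in_carrier[OF KR ws] w by auto
  have "set us \<subseteq> {v \<in> carrier R. w \<otimes> v \<in> V}"
  proof
    fix u assume u: "u \<in> set us"
    hence uc: "u \<in> carrier R" using us by auto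
    have "set ws \<subseteq> {w \<in> carrier R. u \<otimes> w \<in> V}" using ws mult[OF u] by auto
    hence "Span K ws \<subseteq> {w \<in> carrier R. u \<otimes> w \<in> V}"
      by (rule subalgebra_Span_incl[OF K subalgebra_preimage_mult[OF V uc KR]])
    thus "u \<in> {v \<in> carrier R. w \<otimes> v \<in> V}" using w uc m_comm[OF wc uc] by auto
  qed
  hence "Span K us \<subseteq> {v \<in> carrier R. w \<otimes> v \<in> V}"
    by (rule subalgebra_Span_incl[OF K subalgebra_preimage_mult[OF V wc KR]])
  thus ?thesis using v wc m_comm[of v w] by auto
qed

lemma (in ring) Span_mem_finsum:
  assumes "K \<subseteq> carrier R" "\<And>j. j \<in> set xs \<Longrightarrow> x j \<in> carrier R" "distinct xs" "v \<in> Span K (map x xs)"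
  shows "\<exists>c. (\<forall>j\<in>set xs. c j \<in> K) \<and> v = (\<Oplus>j\<in>set xs. c j \<otimes> x j)"
  using assms(2-4)
proof (induct xs arbitrary: v)
  case (Cons i xs)
  obtain k w where kw: "k \<in> K" "w \<in> Span K (map x xs)" "v = k \<otimes> x i \<oplus> w"
    using Cons(4) by (auto simp: line_extension_mem_iff)
  then obtain c where c: "\<forall>j\<in>set xs. c j \<in> K" "w = (\<Oplus>j\<in>set xs. c j \<otimes> x j)"
    using Cons(1)[OF _ _ kw(2)] Cons(2,3) by auto
  let ?c = "c(i := k)"
  have car: "c j \<in> carrier R" "x j \<in> carrier R" if "j \<in> set xs" for j using assms(1) Cons(2) c(1) that by auto
  have "k \<in> carrier R" "x i \<in> carrier R" using kw(1) assms(1) Cons(2) by auto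
  hence "(\<Oplus>j\<in>insert i (set xs). ?c j \<otimes> x j) = ?c i \<otimes> x i \<oplus> (\<Oplus>j\<in>set xs. ?c j \<otimes> x j)"
    by (intro finsum_insert) (use Cons(3) car in auto)
  also have "(\<Oplus>j\<in>set xs. ?c j \<otimes> x j) = (\<Oplus>j\<in>set xs. c j \<otimes> x j)"
    by (rule finsum_cong') (use Cons(3) car in auto)
  finally show ?case using kw(1,3) c by (intro exI[of _ ?c]) auto
qed simp

locale radical_system = field R for R (structure) +
  fixes K U :: "'a set" and I :: "'i set" and x :: "'i \<Rightarrow> 'a" and E :: "'a set"
  assumes K: "subfield K R" and U: "mult_subgroup U" and K_U: "K - {\<zero>} \<subseteq> U"
    and x_U: "\<And>i. i \<in> I \<Longrightarrow> x i \<in> U"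
    and cover: "\<And>u. u \<in> U \<Longrightarrow> \<exists>i\<in>I. \<exists>k\<in>K. u = k \<otimes> x i"
    and distinct: "\<And>i j k. \<lbrakk> i \<in> I; j \<in> I; k \<in> K; x i = k \<otimes> x j \<rbrakk> \<Longrightarrow> i = j"
    and E: "E = family_span K x I"
begin

lemmas K_closed = subfield_closed[OF K]
lemmas U_closed = mult_subgroupD[OF U]

text \<open>For u in U the choice is unambiguous: u is a scalar multiple of exactly one
  representative.\<close>

definition idx :: "'a \<Rightarrow> 'i" where "idx u = (SOME i. i \<in> I \<and> (\<exists>k\<in>K. u = k \<otimes> x i))"

lemma idx: assumes "u \<in> U" shows "idx u \<in> I" "\<exists>k\<in>K. k \<noteq> \<zero> \<and> u = k \<otimes> x (idx u)"
proof -
  have "idx u \<in> I \<and> (\<exists>k\<in>K. u = k \<otimes> x (idx u))"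
    unfolding idx_def by (rule someI_ex) (use cover[OF assms] in blast)
  then obtain k where k: "idx u \<in> I" "k \<in> K" "u = k \<otimes> x (idx u)" by auto
  show "idx u \<in> I" by fact
  have "k \<noteq> \<zero>" using k U_closed(2)[OF assms] U_closed(1)[OF x_U[OF k(1)]] by (metis l_null)
  thus "\<exists>k\<in>K. k \<noteq> \<zero> \<and> u = k \<otimes> x (idx u)" using k by blast
qed

lemma idx_eq_imp: assumes "u \<in> U" "v \<in> U" "idx u = idx v" shows "\<exists>k\<in>K. u = k \<otimes> v"
proof -
  obtain k where k: "k \<in> K" "u = k \<otimes> x (idx u)" using idx(2)[OF assms(1)] by blast
  obtain l where l: "l \<in> K" "l \<noteq> \<zero>" "v = l \<otimes> x (idx u)"
    using idx(2)[OF assms(2)] unfolding assms(3) by blast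
  note kl = k l
  let ?x = "x (idx u)"
  have c: "k \<in> carrier R" "l \<in> carrier R" "?x \<in> carrier R"
    using kl K_closed(1) U_closed(1) x_U idx(1)[OF assms(1)] by auto
  note i = nonzero_inv[OF c(2) kl(4)]
  have "(k \<otimes> inv l) \<otimes> (l \<otimes> ?x) = k \<otimes> (inv l \<otimes> l) \<otimes> ?x" using c i(1) by (simp add: m_assoc)
  also have "\<dots> = k \<otimes> ?x" using c i by simp
  finally have "u = (k \<otimes> inv l) \<otimes> v" unfolding kl(5)[symmetric] kl(2)[symmetric] by (rule sym)
  thus ?thesis using kl K_closed(5,7) by blast
qed

lemma Span_U_incl_E:
  assumes us: "set us \<subseteq> U" shows "Span K us \<subseteq> Span K (map x (map idx us))" "Span K us \<subseteq> E"
proof -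
  have ix: "idx u \<in> I" if "u \<in> set us" for u using idx(1) us that by blast
  have car: "set (map x (map idx us)) \<subseteq> carrier R" using ix x_U U_closed(1) by auto
  have "set us \<subseteq> Span K (map x (map idx us))"
  proof
    fix u assume u: "u \<in> set us"
    then obtain k where "k \<in> K" "u = k \<otimes> x (idx u)" using idx(2) us by blast
    moreover have "x (idx u) \<in> Span K (map x (map idx us))" using Span_base_incl[OF K car] u by auto
    ultimately show "u \<in> Span K (map x (map idx us))" using Span_smult_closed[OF K car] by metis
  qed
  thus *: "Span K us \<subseteq> Span K (map x (map idx us))"
    by (rule subalgebra_Span_incl[OF K Span_is_subalgebra[OF K car]])
  have "map idx us \<in> lists I" using ix by auto
  thus "Span K us \<subseteq> E" using * unfolding E family_span_def by blast
qed

text \<open>Removes the choice of representatives: E consists of all K-combinations of elements of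
  U. Closure under products is then inherited from U.\<close>

lemma E_iff: "v \<in> E \<longleftrightarrow> (\<exists>us. set us \<subseteq> U \<and> v \<in> Span K us)"
proof
  assume "v \<in> E"
  then obtain xs where xs: "xs \<in> lists I" "v \<in> Span K (map x xs)" unfolding E family_span_def by auto
  moreover have "set (map x xs) \<subseteq> U" using xs(1) x_U by auto
  ultimately show "\<exists>us. set us \<subseteq> U \<and> v \<in> Span K us" by blast
qed (use Span_U_incl_E(2) in blast)

lemma U_sub_E: "U \<subseteq> E"
proof
  fix u assume u: "u \<in> U"
  hence "u \<in> Span K [u]" using Span_base_incl[OF K, of "[u]"] U_closed(1) by auto
  thus "u \<in> E" using u E_iff by (metis empty_set insert_subset list.simps(15) empty_subsetI)
qed

lemma E_subalgebra: "subalgebra K E R"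
proof (intro subalgebra.intro subalgebra_axioms.intro add.subgroupI)
  have car: "set us \<subseteq> carrier R" if "set us \<subseteq> U" for us using that U_closed(1) by auto
  show "E \<subseteq> carrier R" using E_iff Span_in_carrier[OF K_closed(1)[THEN subsetI]] car by blast
  show "E \<noteq> {}" using U_sub_E U_closed(3) by auto
  have span: "subalgebra K (Span K us) R" if "set us \<subseteq> U" for us by (rule Span_is_subalgebra[OF K car[OF that]])
  show "v \<oplus> w \<in> E" if vw: "v \<in> E" "w \<in> E" for v w
  proof -
    obtain us ws where us: "set us \<subseteq> U" "v \<in> Span K us" "set ws \<subseteq> U" "w \<in> Span K ws" using vw E_iff by blast
    have s: "set (us @ ws) \<subseteq> U" using us by simp
    have "v \<in> Span K (us @ ws)" "w \<in> Span K (us @ ws)"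
      using mono_Span_sublist[OF K _ car[OF s], of us] mono_Span_sublist[OF K _ car[OF s], of ws] us(2,4) by auto
    hence "v \<oplus> w \<in> Span K (us @ ws)" using subgroup.m_closed[OF subalgebra.axioms(1)[OF span[OF s]]] by simp
    thus ?thesis using s E_iff by blast
  qed
  show "k \<otimes> v \<in> E" if "k \<in> K" "v \<in> E" for k v
    using that E_iff subalgebra.smult_closed[OF span] by metis
  show "\<ominus> v \<in> E" if "v \<in> E" for v
    using that E_iff subgroup.m_inv_closed[OF subalgebra.axioms(1)[OF span]] by (auto simp: a_inv_def)
qed

lemma E_carrier: "E \<subseteq> carrier R" using subalgebra_in_carrier[OF E_subalgebra] .

lemma E_mult: assumes "v \<in> E" "w \<in> E" shows "v \<otimes> w \<in> E"
proof -
  obtain us ws where us: "set us \<subseteq> U" "v \<in> Span K us" and ws: "set ws \<subseteq> U" "w \<in> Span K ws"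
    using assms E_iff by metis
  show ?thesis
    by (rule Span_mult_subset[OF K E_subalgebra _ _ _ us(2) ws(2)]) (use us(1) ws(1) U_closed(1,4) U_sub_E in blast)+
qed

lemma E_subring: "subring E R"
proof (rule subringI[OF E_carrier])
  show "\<one> \<in> E" using U_sub_E U_closed(3) by auto
  show "\<ominus> v \<in> E" if "v \<in> E" for v
    using subgroup.m_inv_closed[OF subalgebra.axioms(1)[OF E_subalgebra] that] by (simp add: a_inv_def)
  show "v \<oplus> w \<in> E" if "v \<in> E" "w \<in> E" for v w
    using subgroup.m_closed[OF subalgebra.axioms(1)[OF E_subalgebra] that] by simp
qed (rule E_mult)

lemma K_sub_E: "K \<subseteq> E"
proof
  fix k assume "k \<in> K"
  thus "k \<in> E" using U_sub_E K_U subringE(2)[OF E_subring] by (cases "k = \<zero>") auto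
qed

text \<open>Torsion makes each u a root of some X^n - c, so questions about a single element of E
  are settled in a finite extension of K.\<close>

lemma E_mem_finite_extension:
  assumes torsion: "\<And>u. u \<in> U \<Longrightarrow> \<exists>n>0. u [^] (n::nat) \<in> K" and v: "v \<in> E"
  obtains us where "set us \<subseteq> U" "v \<in> finite_extension K us" "\<And>u. u \<in> set us \<Longrightarrow> (algebraic over K) u"
proof -
  obtain us where us: "set us \<subseteq> U" "v \<in> Span K us" using v E_iff by auto
  have car: "set us \<subseteq> carrier R" using us U_closed(1) by auto
  have sr: "subring (finite_extension K us) R" by (rule finite_extension_is_subring[OF subfieldE(1)[OF K] car])
  have Kf: "K \<subseteq> finite_extension K us" by (rule finite_extension_incl[OF subfieldE(3)[OF K] car])
  have uf: "set us \<subseteq> finite_extension K us" by (rule finite_extension_mem[OF subfieldE(1)[OF K] car])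
  have "subalgebra K (finite_extension K us) R"
    using subring.axioms(1)[OF sr] subringE(6)[OF sr] Kf by (auto intro!: subalgebra.intro subalgebra_axioms.intro)
  hence "v \<in> finite_extension K us" using subalgebra_Span_incl[OF K _ uf] us(2) by blast
  moreover have "(algebraic over K) u" if "u \<in> set us" for u
  proof -
    have "u \<in> U" using us that by auto
    from torsion[OF this] obtain n where "n > 0" "u [^] (n::nat) \<in> K" by auto
    thus ?thesis using algebraic_of_pow(1)[OF K] car that by auto
  qed
  ultimately show thesis using that us(1) by blast
qed

lemma E_algebraic:
  assumes torsion: "\<And>u. u \<in> U \<Longrightarrow> \<exists>n>0. u [^] (n::nat) \<in> K" and v: "v \<in> E"
  shows "(algebraic over K) v"
proof -
  obtain us where us: "set us \<subseteq> U" "v \<in> finite_extension K us" "\<And>u. u \<in> set us \<Longrightarrow> (algebraic over K) u"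
    using E_mem_finite_extension[OF assms] by blast
  have car: "set us \<subseteq> carrier R" using us U_closed(1) by auto
  show ?thesis by (rule finite_extesion_mem_imp_algebraic[OF K car us(3,2)])
qed

text \<open>A nonzero v in E is algebraic, so its inverse lies in K(v) = K[v], which the ring E
  contains.\<close>

lemma E_subfield:
  assumes torsion: "\<And>u. u \<in> U \<Longrightarrow> \<exists>n>0. u [^] (n::nat) \<in> K"
  shows "subfield E R"
proof (rule subfieldI'[OF E_subring])
  fix v assume v: "v \<in> E - {\<zero>}"
  have vc: "v \<in> carrier R" using v E_carrier by auto
  have alg: "(algebraic over K) v" using E_algebraic[OF torsion] v by blast
  have sf: "subfield (simple_extension K v) R" using simple_extension_is_subfield[OF K vc] alg by simp
  have "inv v \<in> simple_extension K v"
    using subfield_closed(7)[OF sf simple_extension_mem[OF subfieldE(1)[OF K] vc]] v by simp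
  moreover have "simple_extension K v \<subseteq> E"
    using simple_extension_subring_incl[OF E_subring K_sub_E] v by auto
  ultimately show "inv v \<in> E" by auto
qed

text \<open>If x i depended on the others, moving it across with coefficient -1 would give a
  nontrivial relation among distinct classes.\<close>

lemma family_independent_of_class_independent:
  assumes ci: "class_independent K U" shows "family_independent K x I"
  unfolding family_independent_def
proof (intro ballI impI)
  fix xs assume xs: "xs \<in> lists I" "distinct xs"
  thus "independent K (map x xs)"
  proof (induct xs rule: list.induct)
    case (Cons i xs)
    have xI: "j \<in> I" if j: "j \<in> set (i # xs)" for j using j Cons(2) by auto
    have xc: "x j \<in> carrier R" if "j \<in> set (i # xs)" for j using U_closed(1)[OF x_U[OF xI[OF that]]] .
    have "x i \<notin> Span K (map x xs)"
    proof
      assume "x i \<in> Span K (map x xs)"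
      then obtain c where c: "x i = (\<Oplus>j\<in>set xs. c j \<otimes> x j)" "\<And>j. j \<in> set xs \<Longrightarrow> c j \<in> K"
        using Span_mem_finsum[OF subsetI[OF K_closed(1)], of K xs x "x i"] xc Cons(3) by auto
      let ?d = "\<lambda>j. if j = i then \<ominus> \<one> else c j"
      have ixs: "i \<notin> set xs" using Cons(3) by simp
      have cc: "c j \<in> carrier R" if "j \<in> set xs" for j using c(2)[OF that] K_closed(1) by auto
      have "(\<Oplus>j\<in>set (i # xs). ?d j \<otimes> x j) = ?d i \<otimes> x i \<oplus> (\<Oplus>j\<in>set xs. ?d j \<otimes> x j)"
        unfolding list.set(2) by (rule finsum_insert) (use ixs cc xc in auto)
      also have "(\<Oplus>j\<in>set xs. ?d j \<otimes> x j) = (\<Oplus>j\<in>set xs. c j \<otimes> x j)"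
        by (rule finsum_cong') (use ixs cc xc in auto)
      also have "?d i \<otimes> x i \<oplus> \<dots> = \<zero>" unfolding c(1)[symmetric] using xc by (simp add: l_minus l_neg)
      finally have z: "(\<Oplus>j\<in>set (i # xs). ?d j \<otimes> x j) = \<zero>" .
      have "?d i = \<zero>"
      proof (rule class_independentD[OF ci _ _ _ _ _ _ _ z])
        fix j l k assume "j \<in> set (i # xs)" "l \<in> set (i # xs)" "j \<noteq> l" "k \<in> K"
        thus "x j \<noteq> k \<otimes> x l" using distinct[of j l k] xI by blast
      qed (use K_closed U_closed(1) xI x_U c(2) in auto)
      thus False by simp
    qed
    moreover have "independent K (map x xs)" using Cons by auto
    ultimately show ?case using li_Cons[of "x i"] xc by simp
  qed simp
qed

text \<open>The elements of us lie in the span of the representatives of their classes. Were the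
  class of u not among these, its representative would depend on the others. Torsion, roots of unity
  and 1 + i are all treated through this fact.\<close>

lemma Span_mem_idx:
  assumes fi: "family_independent K x I" and u: "u \<in> U" and us: "set us \<subseteq> U" and mem: "u \<in> Span K us"
  shows "idx u \<in> idx ` set us"
proof (rule ccontr)
  assume n: "idx u \<notin> idx ` set us"
  let ?is = "remdups (map idx us)"
  have ix: "idx v \<in> I" if "v \<in> set us" for v using idx(1) us that by blast
  have "idx u # ?is \<in> lists I" "distinct (idx u # ?is)" using ix idx(1)[OF u] n by auto
  hence "independent K (map x (idx u # ?is))" using fi unfolding family_independent_def by blast
  hence ni: "x (idx u) \<notin> Span K (map x ?is)" using independent_backwards(1)[of K "x (idx u)" "map x ?is"] by simp
  have car: "set (map x (map idx us)) \<subseteq> carrier R" "set (map x ?is) \<subseteq> carrier R" "x (idx u) \<in> carrier R"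
    using ix idx(1)[OF u] x_U U_closed(1) by auto
  have "Span K (map x (map idx us)) = Span K (map x ?is)"
    by (rule Span_same_set[OF K car(1)]) (simp add: image_image)
  hence uS: "u \<in> Span K (map x ?is)" using Span_U_incl_E(1)[OF us] mem by blast
  obtain k where k: "k \<in> K" "k \<noteq> \<zero>" "u = k \<otimes> x (idx u)" using idx(2)[OF u] by auto
  have "x (idx u) \<in> Span K (map x ?is)"
    using Span_m_inv_simprule[OF K car(2), of k "x (idx u)"] k uS car(3) by auto
  thus False using ni by simp
qed

lemma Span_mem_proportional:
  assumes "family_independent K x I" "u \<in> U" "set us \<subseteq> U" "u \<in> Span K us"
  shows "\<exists>v\<in>set us. \<exists>k\<in>K. u = k \<otimes> v"
proof -
  obtain v where "v \<in> set us" "idx u = idx v" using Span_mem_idx[OF assms] by auto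
  thus ?thesis using idx_eq_imp[OF assms(2), of v] assms(3) by blast
qed

end

section \<open>Frobenius powers, minimal polynomials and cardinality of bases\<close>

context cring
begin

lemma binomial_expansion:
  assumes a: "a \<in> carrier R" and b: "b \<in> carrier R"
  shows "(a \<oplus> b) [^] (n::nat) = (\<Oplus>k\<in>{..n}. [(n choose k)] \<cdot> (a [^] k \<otimes> b [^] (n - k)))"
proof (induct n)
  case 0 thus ?case using a b by simp
next
  case (Suc n)
  let ?t = "\<lambda>n k. [(n choose k)] \<cdot> (a [^] k \<otimes> b [^] (n - k))"
  let ?r = "\<lambda>k. [(n choose k)] \<cdot> (a [^] k \<otimes> b [^] (Suc n - k))"
  let ?S = "\<Oplus>k\<in>{..n}. ?t n k"
  have f: "?t m \<in> A \<rightarrow> carrier R" "?r \<in> A \<rightarrow> carrier R" "(\<lambda>k. ?r (Suc k)) \<in> A \<rightarrow> carrier R"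
    "(\<lambda>k. ?t m (Suc k)) \<in> A \<rightarrow> carrier R" "(\<lambda>k. ?t m k \<otimes> a) \<in> A \<rightarrow> carrier R" for m A using a b by auto
  have Sc: "?S \<in> carrier R" by (rule finsum_closed[OF f(1)])
  have Sa: "?S \<otimes> a = (\<Oplus>k\<in>{..n}. ?t n k \<otimes> a)" by (rule finsum_ldistr) (use a f in auto)
  have "?S \<otimes> b = (\<Oplus>k\<in>{..n}. ?t n k \<otimes> b)" by (rule finsum_ldistr) (use b f in auto)
  also have "\<dots> = (\<Oplus>k\<in>{..n}. ?r k)"
  proof (rule finsum_cong')
    fix k assume "k \<in> {..n}"
    hence "Suc n - k = Suc (n - k)" by auto
    thus "?t n k \<otimes> b = ?r k" using a b by (simp add: add_pow_ldistr m_assoc)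
  qed (use f in auto)
  \<comment> \<open>The added term has binomial coefficient 0; with it the sum can be shifted by one
    index for Pascal's rule.\<close>
  also have "\<dots> = ?r (Suc n) \<oplus> (\<Oplus>k\<in>{..n}. ?r k)"
    using finsum_closed[OF f(2), of "{..n}"] by (simp add: binomial_eq_0)
  also have "\<dots> = (\<Oplus>k\<in>{..Suc n}. ?r k)" using finsum_Suc[OF f(2)] by simp
  also have "\<dots> = (\<Oplus>k\<in>{..n}. ?r (Suc k)) \<oplus> ?r 0" by (rule finsum_Suc2[OF f(2)])
  finally have Sb: "?S \<otimes> b = (\<Oplus>k\<in>{..n}. ?r (Suc k)) \<oplus> ?r 0" .
  have "(\<Oplus>k\<in>{..Suc n}. ?t (Suc n) k) = (\<Oplus>k\<in>{..n}. ?t (Suc n) (Suc k)) \<oplus> ?t (Suc n) 0"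
    by (rule finsum_Suc2[OF f(1)])
  also have "(\<Oplus>k\<in>{..n}. ?t (Suc n) (Suc k)) = (\<Oplus>k\<in>{..n}. ?t n k \<otimes> a \<oplus> ?r (Suc k))"
  proof (rule finsum_cong')
    fix k assume "k \<in> {..n}"
    have "?t n k \<otimes> a = [(n choose k)] \<cdot> (a [^] Suc k \<otimes> b [^] (n - k))"
      using a b by (simp add: add_pow_ldistr add_pow_rdistr m_ac)
    thus "?t (Suc n) (Suc k) = ?t n k \<otimes> a \<oplus> ?r (Suc k)"
      using a b by (simp add: add.nat_pow_mult)
  qed (use a b in auto)
  also have "\<dots> = (\<Oplus>k\<in>{..n}. ?t n k \<otimes> a) \<oplus> (\<Oplus>k\<in>{..n}. ?r (Suc k))"
    by (rule finsum_addf[OF f(5,3)])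
  also have "\<dots> \<oplus> ?t (Suc n) 0 = ?S \<otimes> a \<oplus> ((\<Oplus>k\<in>{..n}. ?r (Suc k)) \<oplus> ?r 0)"
    unfolding Sa[symmetric] using Sc a b finsum_closed[OF f(3), of "{..n}"] by (simp add: a_assoc)
  also have "\<dots> = ?S \<otimes> (a \<oplus> b)" unfolding Sb[symmetric] using Sc a b by (simp add: r_distr)
  finally show ?case unfolding nat_pow_Suc Suc by (rule sym)
qed

lemma prime_pow_add:
  assumes a: "a \<in> carrier R" and b: "b \<in> carrier R" and q: "prime (q::nat)" "[q] \<cdot> \<one> = \<zero>"
  shows "(a \<oplus> b) [^] q = a [^] q \<oplus> b [^] q"
proof -
  have qz: "[q] \<cdot> c = \<zero>" if "c \<in> carrier R" for c
    using add_pow_ldistr[OF one_closed that, of q] q(2) that by simp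
  let ?t = "\<lambda>k. [(q choose k)] \<cdot> (a [^] k \<otimes> b [^] (q - k))"
  have z: "?t k = \<zero>" if k: "0 < k" "k < q" for k
  proof -
    have "q dvd (q choose k)" using dvd_choose_prime[OF _ _ _ q(1), of k] k by simp
    then obtain m where m: "q choose k = q * m" unfolding dvd_def by blast
    have c: "a [^] k \<otimes> b [^] (q - k) \<in> carrier R" using a b by simp
    have "?t k = [m] \<cdot> ([q] \<cdot> (a [^] k \<otimes> b [^] (q - k)))" unfolding m by (rule add.nat_pow_pow[OF c, symmetric])
    thus ?thesis using qz a b by simp
  qed
  have q0: "0 < q" using q(1) prime_gt_0_nat by blast
  have "(a \<oplus> b) [^] q = (\<Oplus>k\<in>{..q}. ?t k)" by (rule binomial_expansion[OF a b])
  also have "\<dots> = (\<Oplus>k\<in>{0, q}. ?t k)"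
  proof (rule add.finprod_mono_neutral_cong_right)
    show "?t k = \<zero>" if "k \<in> {..q} - {0, q}" for k using z[of k] that by auto
  qed (use a b in auto)
  also have "\<dots> = b [^] q \<oplus> a [^] q" using a b q0 by simp
  finally show ?thesis using a b by (simp add: a_comm)
qed

end

context field
begin

text \<open>Vectors in the span of the later ones are dropped. The last conclusion records that the
  list becomes shorter unless it was independent from the start, as the dimension counts
  require.\<close>

lemma Span_reduce:
  assumes K: "subfield K R" and Us: "set Us \<subseteq> carrier R"
  obtains Vs where "independent K Vs" "Span K Vs = Span K Us" "length Vs < length Us \<or> independent K Us"
proof -
  have "\<exists>Vs. independent K Vs \<and> Span K Vs = Span K Us \<and> (length Vs < length Us \<or> independent K Us \<and> Vs = Us)"
    using Us
  proof (induct Us)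
    case (Cons u Us)
    then obtain Vs where Vs: "independent K Vs" "Span K Vs = Span K Us" "length Vs < length Us \<or> independent K Us \<and> Vs = Us" by auto
    show ?case
    proof (cases "u \<in> Span K Us")
      case True
      have "Span K (u # Us) = Span K Us"
        using mono_Span_subset[OF K, of "u # Us" Us] mono_Span[OF K, of Us u] True Cons(2) Span_base_incl[OF K, of Us] by auto
      thus ?thesis using Vs by (intro exI[of _ Vs]) auto
    next
      case False
      have "independent K (u # Vs)" using li_Cons[of u K Vs] Vs False Cons(2) by simp
      moreover have "Span K (u # Vs) = Span K (u # Us)" using Vs(2) by simp
      ultimately show ?thesis using Vs(3) by (intro exI[of _ "u # Vs"]) auto
    qed
  qed auto
  thus thesis using that by blast
qed

text \<open>A dependent list could be shortened without changing its span, against the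
  dimension.\<close>

lemma independent_of_Span_dimension:
  assumes K: "subfield K R" and Us: "set Us \<subseteq> carrier R" and dim: "dimension (length Us) K (Span K Us)"
  shows "independent K Us"
proof -
  obtain Vs where Vs: "independent K Vs" "Span K Vs = Span K Us" "length Vs < length Us \<or> independent K Us"
    using Span_reduce[OF K Us] .
  have "dimension (length Vs) K (Span K Us)" using dimension_independent[OF Vs(1)] Vs(2) by simp
  hence "length Vs = length Us" using dimension_is_inj[OF K _ dim] by simp
  thus ?thesis using Vs(3) by simp
qed

text \<open>Raising to the q-th power is additive in characteristic q and maps K into K, so a
  combination of the vectors becomes one of their q-th powers, with new coefficients.\<close>

lemma frobenius_Span:
  assumes K: "subfield K R" and q: "prime (q::nat)" "[q] \<cdot> \<one> = \<zero>"
    and Us: "set Us \<subseteq> carrier R" and m: "m \<in> Span K Us"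
  shows "m [^] q \<in> Span K (map (\<lambda>u. u [^] q) Us)"
proof -
  obtain Ks where Ks: "set Ks \<subseteq> K" "length Ks = length Us" "m = combine Ks Us"
    using m Span_mem_iff_length_version[OF K Us] by auto
  have q0: "q > 0" using q(1) prime_gt_0_nat by blast
  have KR: "K \<subseteq> carrier R" using subfield_closed(1)[OF K] by auto
  have "(combine Ks Us) [^] q = combine (map (\<lambda>k. k [^] q) Ks) (map (\<lambda>u. u [^] q) Us)"
    using Ks(2,1) Us
  proof (induct Ks Us rule: list_induct2)
    case Nil thus ?case using q0 nat_pow_zero[of q] by simp
  next
    case (Cons k Ks u Us)
    have c: "k \<in> carrier R" "u \<in> carrier R" "combine Ks Us \<in> carrier R"
      using Cons KR combine_in_carrier[of Ks Us] by auto
    thus ?case using Cons prime_pow_add[OF _ c(3) q, of "k \<otimes> u"] by (simp add: nat_pow_distrib)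
  qed
  moreover have "set (map (\<lambda>k. k [^] q) Ks) \<subseteq> K" using Ks(1) subfield_closed(8)[OF K] by auto
  moreover have "set (map (\<lambda>u. u [^] q) Us) \<subseteq> carrier R" using Us by auto
  ultimately show ?thesis using Span_mem_iff_length_version[OF K, of "map (\<lambda>u. u [^] q) Us"] Ks(2,3) by (metis length_map)
qed

text \<open>
  The span $T$ of the $q$-th powers contains $m^q$ for all $m \<in> M = K(us)$, and is a ring. If
  $qs = nt + 1$ then $u = u^{qs} u^{-nt} \<in> T$.
\<close>

lemma frobenius_Span_eq:
  assumes K: "subfield K R" and q: "prime (q::nat)" "[q] \<cdot> \<one> = \<zero>"
    and us: "set us \<subseteq> carrier R - {\<zero>}" and tors: "\<And>u. u \<in> set us \<Longrightarrow> \<exists>n. u [^] (n::nat) \<in> K \<and> \<not> q dvd n"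
    and Bs: "set Bs \<subseteq> carrier R" "Span K Bs = finite_extension K us"
  shows "Span K (map (\<lambda>u. u [^] q) Bs) = finite_extension K us"
proof -
  let ?M = "finite_extension K us" and ?Ws = "map (\<lambda>u. u [^] q) Bs"
  let ?T = "Span K ?Ws"
  have usc: "set us \<subseteq> carrier R" using us by auto
  note Kc = subfield_closed[OF K]
  have sr: "subring ?M R" by (rule finite_extension_is_subring[OF subfieldE(1)[OF K] usc])
  have uM: "set us \<subseteq> ?M" by (rule finite_extension_mem[OF subfieldE(1)[OF K] usc])
  have MR: "?M \<subseteq> carrier R" using subringE(1)[OF sr] .
  have saM: "subalgebra K ?M R" using Span_is_subalgebra[OF K Bs(1)] Bs(2) by simp
  have powM: "v [^] (n::nat) \<in> ?M" if "v \<in> ?M" for v n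
    by (induct n) (use that subringE(3,6)[OF sr] in auto)
  have BM: "set Bs \<subseteq> ?M" using Span_base_incl[OF K Bs(1)] Bs(2) by simp
  have Wc: "set ?Ws \<subseteq> carrier R" using Bs(1) by auto
  have "set ?Ws \<subseteq> ?M" using BM powM by auto
  hence TM: "?T \<subseteq> ?M" by (rule subalgebra_Span_incl[OF K saM])
  have saT: "subalgebra K ?T R" by (rule Span_is_subalgebra[OF K Wc])
  have KR: "K \<subseteq> carrier R" using Kc(1) by auto
  have pw: "m [^] q \<in> ?T" if "m \<in> ?M" for m using frobenius_Span[OF K q Bs(1)] that Bs(2) by simp
  have smul: "k \<otimes> v \<in> ?T" if "k \<in> K" "v \<in> ?T" for k v using Span_smult_closed[OF K Wc that] .
  have one_T: "\<one> \<in> ?T" using pw[OF subringE(3)[OF sr]] by simp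
  have TR: "?T \<subseteq> carrier R" using TM MR by auto
  \<comment> \<open>The product of the q-th powers of two basis vectors is the q-th power of an
    element of M, hence lies in T.\<close>
  have mult: "v \<otimes> w \<in> ?T" if vw: "v \<in> ?T" "w \<in> ?T" for v w
  proof (rule Span_mult_subset[OF K saT Wc Wc _ vw])
    fix y z assume "y \<in> set ?Ws" "z \<in> set ?Ws"
    then obtain b c where bc: "b \<in> set Bs" "c \<in> set Bs" "y = b [^] q" "z = c [^] q" by auto
    have "b \<otimes> c \<in> ?M" using bc BM subringE(6)[OF sr] by auto
    moreover have "(b \<otimes> c) [^] q = y \<otimes> z" unfolding bc(3,4) using bc Bs(1) by (intro nat_pow_distrib) auto
    ultimately show "y \<otimes> z \<in> ?T" using pw by metis
  qed
  have srT: "subring ?T R"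
  proof (rule subringI[OF TR one_T _ mult])
    show "\<ominus> h \<in> ?T" if "h \<in> ?T" for h
      using subgroup.m_inv_closed[OF Span_is_add_subgroup[OF K Wc] that] by (simp add: a_inv_def)
    show "h1 \<oplus> h2 \<in> ?T" if "h1 \<in> ?T" "h2 \<in> ?T" for h1 h2
      using subgroup.m_closed[OF Span_is_add_subgroup[OF K Wc] that] by simp
  qed
  have KT: "K \<subseteq> ?T"
  proof
    fix k assume "k \<in> K"
    hence "k \<otimes> \<one> \<in> ?T" "k \<otimes> \<one> = k" using smul one_T KR by auto
    thus "k \<in> ?T" by simp
  qed
  have "set us \<subseteq> ?T"
  proof
    fix u assume u: "u \<in> set us"
    obtain n where n: "u [^] (n::nat) \<in> K" "\<not> q dvd n" using tors[OF u] by auto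
    have uc: "u \<in> carrier R" "u \<noteq> \<zero>" using us u by auto
    have "coprime q n" using prime_imp_coprime[OF q(1) n(2)] .
    moreover have "q \<noteq> 0" using q(1) by auto
    ultimately obtain s t where st: "q * s = n * t + 1" using bezout_nat[of q n] by auto
    have nz: "u [^] (n * t) \<in> carrier R" "u [^] (n * t) \<noteq> \<zero>" using uc pow_nonzero by auto
    have k: "inv (u [^] (n * t)) \<in> K" using Kc(7)[OF _ nz(2)] Kc(8)[OF n(1), of t] uc by (simp add: nat_pow_pow)
    have "u [^] s \<in> ?M" using powM uM u by auto
    from pw[OF this] have T: "u [^] (q * s) \<in> ?T" using uc by (simp add: nat_pow_pow mult.commute)
    have "inv (u [^] (n * t)) \<otimes> u [^] (q * s) = inv (u [^] (n * t)) \<otimes> u [^] (n * t) \<otimes> u"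
      unfolding st using uc nz nonzero_inv(1)[OF nz] by (simp add: m_assoc)
    also have "\<dots> = u" using nonzero_inv(4)[OF nz] uc by simp
    finally show "u \<in> ?T" using smul[OF k T] by simp
  qed
  hence "?M \<subseteq> ?T" by (rule finite_extension_subring_incl[OF srT KT])
  thus ?thesis using TM by auto
qed

text \<open>The powers of y below its degree d are completed to a basis of M. The q-th powers of
  this basis span M and are as many as its dimension, hence independent; among them are the first d
  powers of y^q.\<close>

lemma degree_Irr_pow_ge:
  assumes K: "subfield K R" and q: "prime (q::nat)" "[q] \<cdot> \<one> = \<zero>"
    and us: "set us \<subseteq> carrier R - {\<zero>}" and tors: "\<And>u. u \<in> set us \<Longrightarrow> \<exists>n>0. u [^] (n::nat) \<in> K \<and> \<not> q dvd n"
    and y: "y \<in> finite_extension K us"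
  shows "degree (Irr K y) \<le> degree (Irr K (y [^] q))"
proof -
  let ?M = "finite_extension K us" and ?d = "degree (Irr K y)"
  have usc: "set us \<subseteq> carrier R" using us by auto
  have algu: "(algebraic over K) u" if u: "u \<in> set us" for u
  proof -
    obtain n where "n > 0" "u [^] (n::nat) \<in> K" using tors[OF u] by auto
    thus ?thesis using algebraic_of_pow(1)[OF K] usc u by auto
  qed
  have sf: "subfield ?M R" by (rule finite_extension_is_subfield[OF K usc algu])
  have yc: "y \<in> carrier R" using subfield_closed(1)[OF sf y] .
  have alg: "(algebraic over K) y" by (rule finite_extesion_mem_imp_algebraic[OF K usc algu y])
  have yqM: "y [^] q \<in> ?M" using subfield_closed(8)[OF sf y] .
  have algq: "(algebraic over K) (y [^] q)" by (rule finite_extesion_mem_imp_algebraic[OF K usc algu yqM])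
  obtain N where N: "dimension N K ?M" using finite_extension_finite_dimension(1)[OF K usc algu] by auto
  have "set (exp_base y ?d) \<subseteq> ?M" unfolding exp_base_def using subfield_closed(8)[OF sf y] by auto
  then obtain Vs where Vs: "length (Vs @ exp_base y ?d) = N" "independent K (Vs @ exp_base y ?d)"
      "Span K (Vs @ exp_base y ?d) = ?M"
    using complete_base[OF K N exp_base_independent[OF K yc alg]] by auto
  let ?Bs = "Vs @ exp_base y ?d"
  let ?Ws = "map (\<lambda>u. u [^] q) ?Bs"
  have Bc: "set ?Bs \<subseteq> carrier R" using independent_in_carrier[OF Vs(2)] .
  have "Span K ?Ws = ?M"
    by (rule frobenius_Span_eq[OF K q us _ Bc Vs(3)]) (use tors in blast)
  moreover have "length ?Ws = N" using Vs(1) by simp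
  ultimately have "dimension (length ?Ws) K (Span K ?Ws)" using N by simp
  moreover have "set ?Ws \<subseteq> carrier R" using Bc by auto
  ultimately have "independent K ?Ws" by (intro independent_of_Span_dimension[OF K])
  hence "independent K (map (\<lambda>u. u [^] q) (exp_base y ?d))" using independent_split(1)[OF K] by simp
  moreover have "map (\<lambda>u. u [^] q) (exp_base y ?d) = exp_base (y [^] q) ?d"
    unfolding exp_base_def using yc by (simp add: nat_pow_pow mult.commute)
  ultimately have ind: "independent K (exp_base (y [^] q) ?d)" by simp
  have yqc: "y [^] q \<in> carrier R" using yc by simp
  have sq: "subfield (simple_extension K (y [^] q)) R" using simple_extension_is_subfield[OF K yqc] algq by simp
  have "set (exp_base (y [^] q) ?d) \<subseteq> simple_extension K (y [^] q)"
    unfolding exp_base_def using subfield_closed(8)[OF sq simple_extension_mem[OF subfieldE(1)[OF K] yqc]] by auto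
  from independent_length_le_dimension[OF K dimension_simple_extension[OF K yqc algq] ind this]
  show ?thesis by (simp add: exp_base_def)
qed

lemma add_pow_one_mult:
  fixes m n :: nat
  shows "[(m * n)] \<cdot> \<one> = ([m] \<cdot> \<one>) \<otimes> ([n] \<cdot> \<one>)"
proof -
  have "([m] \<cdot> \<one>) \<otimes> ([n] \<cdot> \<one>) = [m] \<cdot> ([n] \<cdot> \<one>)" using add_pow_ldistr[OF one_closed, of "[n] \<cdot> \<one>" m] by simp
  also have "\<dots> = [(n * m)] \<cdot> \<one>" by (rule add.nat_pow_pow) simp
  finally show ?thesis by (simp add: mult.commute)
qed

text \<open>Here q is the additive order of 1, prime because a field has no zero divisors. The
  divisibility is later applied to every exponent of a polynomial with zero derivative.\<close>

lemma add_pow_one_eq_zero: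
  assumes "m > 0" "[(m::nat)] \<cdot> \<one> = \<zero>"
  obtains q where "prime (q::nat)" "[q] \<cdot> \<one> = \<zero>" "\<And>k. [(k::nat)] \<cdot> \<one> = \<zero> \<Longrightarrow> q dvd k"
proof -
  define q where "q = group.ord (add_monoid R) \<one>"
  have id: "[k] \<cdot> \<one> = \<zero> \<longleftrightarrow> q dvd k" for k :: nat
    using add.pow_eq_id[of \<one> k] by (simp add: q_def add_pow_def)
  have "prime_elem q"
  proof (rule prime_elemI)
    show "q \<noteq> 0" using assms id by auto
    show "\<not> q dvd 1" using id[of 1] by auto
    fix a b assume "q dvd a * b"
    hence "([a] \<cdot> \<one>) \<otimes> ([b] \<cdot> \<one>) = \<zero>" using id[of "a * b"] by (simp only: add_pow_one_mult)
    thus "q dvd a \<or> q dvd b" using integral id by auto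
  qed
  thus thesis using that id by auto
qed

end

lemma (in ring) normalize_eq_Nil: "normalize xs = [] \<Longrightarrow> set xs \<subseteq> {\<zero>}"
  by (induct xs) (auto split: if_splits)

context field
begin

lemma subfield_add_pow_closed: "subfield K R \<Longrightarrow> c \<in> K \<Longrightarrow> [(n::nat)] \<cdot> c \<in> K"
  by (induct n) (use subfield_closed in auto)

lemma coeff_mem_subfield:
  assumes "subfield K R" "p \<in> carrier (K[X])" shows "coeff p k \<in> K"
proof (cases "k < length p")
  case True
  have "set p \<subseteq> K" using assms(2) univ_poly_carrier polynomial_incl by metis
  thus ?thesis using coeff_nth[OF True] True by auto
next
  case False
  thus ?thesis using coeff_length[of p k] subfield_closed(2)[OF assms(1)] by simp
qed

text \<open>A divisor of an irreducible polynomial is a unit or an associate of it, and an associate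
  cannot divide a nonzero derivative, whose degree is smaller.\<close>

lemma separable_poly_Irr:
  assumes K: "subfield K R" and y: "y \<in> carrier R" "(algebraic over K) y" and ne: "poly_deriv (Irr K y) \<noteq> []"
  shows "separable_poly K (Irr K y)"
  unfolding separable_poly_def
proof (intro ballI impI)
  let ?p = "Irr K y"
  fix d assume d: "d \<in> carrier (K[X])" and dd: "d divides\<^bsub>K[X]\<^esub> ?p \<and> d divides\<^bsub>K[X]\<^esub> poly_deriv ?p"
  note I = IrrE[OF K y]
  have sr: "subring K R" using subfieldE(1)[OF K] .
  have cK: "coeff ?p k \<in> K" for k by (rule coeff_mem_subfield[OF K I(1)])
  have "set (map (\<lambda>k. [Suc k] \<cdot> coeff ?p (Suc k)) (rev [0..<degree ?p])) \<subseteq> K"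
    using subfield_add_pow_closed[OF K cK] by (auto simp del: add.nat_pow_Suc)
  hence pd: "poly_deriv ?p \<in> carrier (K[X])"
    unfolding poly_deriv_def univ_poly_carrier[symmetric] by (rule normalize_gives_polynomial)
  have len: "length (poly_deriv ?p) \<le> degree ?p"
    unfolding poly_deriv_def using normalize_length_le[of "map (\<lambda>k. [Suc k] \<cdot> coeff ?p (Suc k)) (rev [0..<degree ?p])"] by simp
  interpret UP: domain "K[X]" by (rule univ_poly_is_domain[OF sr])
  from divides_pirreducible_condition[OF I(2) d] dd
  have "d \<in> Units (K[X]) \<or> d \<sim>\<^bsub>K[X]\<^esub> ?p" by auto
  moreover have False if "d \<sim>\<^bsub>K[X]\<^esub> ?p"
  proof -
    have "?p divides\<^bsub>K[X]\<^esub> d" using that by (simp add: associated_def)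
    hence "?p divides\<^bsub>K[X]\<^esub> poly_deriv ?p" using dd UP.divides_trans I(1) by blast
    hence "?p pdivides poly_deriv ?p" using pdivides_iff_shell[OF K I(1) pd] by simp
    hence "degree ?p \<le> degree (poly_deriv ?p)" by (rule pdivides_imp_degree_le[OF sr I(1) pd ne])
    moreover have "length (poly_deriv ?p) > 0" using ne by simp
    ultimately show False using len by linarith
  qed
  ultimately show "d \<in> Units (K[X])" by blast
qed

text \<open>With zero derivative, every exponent carrying a nonzero coefficient is divisible by the
  characteristic q, so the minimal polynomial is one in X^q. Then y^q satisfies an equation of
  degree d / q < d, against the lower bound on its degree.\<close>

lemma poly_deriv_Irr_nonzero:
  assumes K: "subfield K R" and y: "y \<in> carrier R" "(algebraic over K) y"
    and alg: "\<And>q. \<lbrakk> prime (q::nat); [q] \<cdot> \<one> = \<zero> \<rbrakk> \<Longrightarrow> (algebraic over K) (y [^] q)"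
    and ge: "\<And>q. \<lbrakk> prime (q::nat); [q] \<cdot> \<one> = \<zero> \<rbrakk> \<Longrightarrow> degree (Irr K y) \<le> degree (Irr K (y [^] q))"
  shows "poly_deriv (Irr K y) \<noteq> []"
proof
  let ?p = "Irr K y"
  define d where "d = degree ?p"
  define c where "c = coeff ?p"
  assume "poly_deriv ?p = []"
  hence z: "set (map (\<lambda>k. [Suc k] \<cdot> c (Suc k)) (rev [0..<d])) \<subseteq> {\<zero>}"
    unfolding poly_deriv_def d_def c_def by (rule normalize_eq_Nil)
  note I = IrrE[OF K y]
  note Kc = subfield_closed[OF K]
  have cK: "c k \<in> K" for k unfolding c_def by (rule coeff_mem_subfield[OF K I(1)])
  have cc: "c k \<in> carrier R" for k using Kc(1)[OF cK] .
  have pne: "?p \<noteq> []" using I(2) univ_poly_zero[of R K] unfolding ring_irreducible_def by auto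
  have cd: "c d = \<one>" using lead_coeff_simp[OF pne] I(3) unfolding c_def d_def by simp
  have dpos: "d > 0" using pirreducible_degree[OF K I(1,2)] unfolding d_def by auto
  have z': "[k] \<cdot> \<one> = \<zero>" if k: "0 < k" "k \<le> d" "c k \<noteq> \<zero>" for k
  proof -
    obtain j where j: "k = Suc j" "j < d" using k by (cases k) auto
    have "[k] \<cdot> c k = \<zero>" using z j by (auto simp: image_subset_iff simp del: add.nat_pow_Suc)
    hence "([k] \<cdot> \<one>) \<otimes> c k = \<zero>" using add_pow_ldistr[OF one_closed cc[of k], of k] cc[of k] by simp
    thus ?thesis using integral[of "[k] \<cdot> \<one>" "c k"] k(3) cc[of k] by simp
  qed
  have d0: "[d] \<cdot> \<one> = \<zero>" using z'[OF dpos order_refl] cd by simp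
  obtain q where q: "prime (q::nat)" "[q] \<cdot> \<one> = \<zero>" "\<And>k. [(k::nat)] \<cdot> \<one> = \<zero> \<Longrightarrow> q dvd k"
    using add_pow_one_eq_zero[OF dpos d0] by blast
  obtain n where n: "d = q * n" using q(3)[OF d0] by auto
  have q1: "q > 1" using prime_gt_1_nat[OF q(1)] .
  have "n > 0" using n dpos by (cases n) auto
  hence nd: "n < d" using n q1 by simp
  let ?z = "y [^] q"
  have "(\<Oplus>j\<in>{..<Suc n}. c (q * j) \<otimes> ?z [^] j) = (\<Oplus>j\<in>{..<Suc n}. c (q * j) \<otimes> y [^] (q * j))"
    by (rule finsum_cong') (use cc y(1) in \<open>auto simp: nat_pow_pow\<close>)
  also have "\<dots> = (\<Oplus>k\<in>(\<lambda>j. q * j) ` {..<Suc n}. c k \<otimes> y [^] k)"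
    by (rule finsum_reindex[symmetric]) (use cc y(1) q1 in \<open>auto simp: inj_on_def\<close>)
  also have "\<dots> = (\<Oplus>k\<in>{..<Suc d}. c k \<otimes> y [^] k)"
  proof (rule add.finprod_mono_neutral_cong_left)
    show "(\<lambda>j. q * j) ` {..<Suc n} \<subseteq> {..<Suc d}" unfolding n by (auto simp: less_Suc_eq_le)
    show "c k \<otimes> y [^] k = \<zero>" if k: "k \<in> {..<Suc d} - (\<lambda>j. q * j) ` {..<Suc n}" for k
    proof -
      have "c k = \<zero>"
      proof (rule ccontr)
        assume ck: "c k \<noteq> \<zero>"
        have "q dvd k"
        proof (cases "k = 0")
          case False thus ?thesis using q(3)[OF z'[of k]] ck k by auto
        qed simp
        then obtain j where "k = q * j" by auto
        moreover have "k \<le> d" using k by auto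
        hence "q * j \<le> q * n" unfolding n \<open>k = q * j\<close> .
        hence "j \<le> n" using q1 by simp
        ultimately show False using k by auto
      qed
      thus ?thesis using y(1) by simp
    qed
  qed (use cc y(1) in auto)
  also have "\<dots> = eval ?p y"
  proof -
    have l: "length ?p = Suc d" using pne unfolding d_def by (cases ?p) auto
    have "eval ?p y = eval (map c (rev [0..<Suc d])) y" using coeff_list[of ?p] unfolding l c_def by simp
    thus ?thesis using eval_map_rev[of c "Suc d" y] cc y(1) by simp
  qed
  also have "\<dots> = \<zero>" by (rule I(4))
  finally have s: "(\<Oplus>j\<in>{..<Suc n}. c (q * j) \<otimes> ?z [^] j) = \<zero>" .
  \<comment> \<open>Since n + 1 \<le> d, the powers of y^q involved are independent; but the last
    coefficient is the leading one, 1.\<close>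
  have "c (q * n) = \<zero>"
    by (rule power_sum_eq_zeroD[OF K _ alg[OF q(1,2)] _ _ s]) (use y(1) nd ge[OF q(1,2)] cK in \<open>auto simp: d_def\<close>)
  thus False using cd n by simp
qed

lemma independent_list_length_bound:
  assumes K: "subfield K R" and "family_independent K (\<lambda>b. b) B" and "finite C" "C \<subseteq> B" and "set bs \<subseteq> carrier R" "C \<subseteq> Span K bs"
  shows "card C \<le> length bs"
proof -
  obtain cs where cs: "set cs = C" "distinct cs" using finite_distinct_list[OF assms(3)] by auto
  have "independent K (map (\<lambda>b. b) cs)" using assms(2,4) cs unfolding family_independent_def by auto
  hence ind: "independent K cs" by simp
  obtain Ws where Ws: "independent K Ws" "Span K Ws = Span K bs" "length Ws < length bs \<or> independent K bs"
    using Span_reduce[OF K assms(5)] .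
  have "length cs \<le> length bs"
  proof (cases "independent K bs")
    case True thus ?thesis using independent_length_le[OF K ind True] cs assms(6) by simp
  next
    case False thus ?thesis using independent_length_le[OF K ind Ws(1)] cs assms(6) Ws(2,3) by simp
  qed
  thus ?thesis using distinct_card[OF cs(2)] cs(1) by simp
qed

text \<open>For finite \<open>B'\<close> this is the bound by the length of a spanning list. For
  infinite \<open>B'\<close> each of its vectors uses finitely many elements of \<open>B\<close>.
  These finite sets exhaust \<open>B\<close>, since an element outside them would depend on them,
  and their union is no larger than \<open>B'\<close>.\<close>

lemma bases_card_le:
  assumes K: "subfield K R" and B: "is_basis K E B" and B': "is_basis K E B'" and carB: "B \<subseteq> carrier R" "B' \<subseteq> carrier R"
  shows "(card_of B, card_of B') \<in> ordLeq"
proof -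
  have fiB: "family_independent K (\<lambda>b. b) B" and spB: "family_span K (\<lambda>b. b) B = E"
    and spB': "family_span K (\<lambda>b. b) B' = E" using B B' unfolding is_basis_def by auto
  have in_span: "\<exists>cs. set cs \<subseteq> C \<and> v \<in> Span K cs" if "v \<in> family_span K (\<lambda>b. b) C" for v C
    using that unfolding family_span_def by (auto simp del: Span.simps)
  have incl: "C \<subseteq> family_span K (\<lambda>b. b) C" if C: "C \<subseteq> carrier R" for C
  proof
    fix v assume v: "v \<in> C"
    hence "v \<in> Span K [v]" using Span_base_incl[OF K, of "[v]"] C by auto
    moreover have "[v] \<in> lists C" using v by simp
    ultimately show "v \<in> family_span K (\<lambda>b. b) C" unfolding family_span_def by (metis UN_iff list.map_ident)
  qed
  show ?thesis
  proof (cases "finite B'")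
    case True
    then obtain bs where bs: "set bs = B'" "distinct bs" using finite_distinct_list by auto
    have "B \<subseteq> Span K bs"
    proof
      fix v assume "v \<in> B"
      hence "v \<in> E" using incl[OF carB(1)] spB by auto
      then obtain cs where cs: "set cs \<subseteq> B'" "v \<in> Span K cs" using in_span[of v B'] spB' by auto
      have "Span K cs \<subseteq> Span K bs" by (rule mono_Span_sublist[OF K]) (use cs bs carB in auto)
      thus "v \<in> Span K bs" using cs by auto
    qed
    hence bound: "card C \<le> card B'" if "finite C" "C \<subseteq> B" for C
      using independent_list_length_bound[OF K fiB that, of bs] bs carB that distinct_card[OF bs(2)] by auto
    have "finite B"
    proof (rule ccontr)
      assume "infinite B"
      then obtain C where "C \<subseteq> B" "finite C" "card C = Suc (card B')" using infinite_arbitrarily_large by blast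
      thus False using bound[of C] by simp
    qed
    moreover from this have "card B \<le> card B'" using bound by simp
    ultimately obtain f where "inj_on f B" "f ` B \<subseteq> B'" using True by (meson card_le_inj)
    thus ?thesis using card_of_ordLeq by blast
  next
    case False
    have "\<forall>b'\<in>B'. \<exists>cs. set cs \<subseteq> B \<and> b' \<in> Span K cs" using incl[OF carB(2)] spB spB' in_span by blast
    then obtain S where S: "\<And>b'. b' \<in> B' \<Longrightarrow> set (S b') \<subseteq> B" "\<And>b'. b' \<in> B' \<Longrightarrow> b' \<in> Span K (S b')" by metis
    have "B \<subseteq> (\<Union>b'\<in>B'. set (S b'))"
    proof
      fix b assume b: "b \<in> B"
      hence "b \<in> E" using incl[OF carB(1)] spB by auto
      then obtain cs where cs: "set cs \<subseteq> B'" "b \<in> Span K cs" using in_span[of b B'] spB' by auto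
      let ?D = "concat (map S cs)"
      have D: "set ?D \<subseteq> B" using S(1) cs(1) by auto
      hence Dc: "set ?D \<subseteq> carrier R" using carB by auto
      have "set cs \<subseteq> Span K ?D"
      proof
        fix b' assume b': "b' \<in> set cs"
        have "Span K (S b') \<subseteq> Span K ?D" by (rule mono_Span_sublist[OF K]) (use b' Dc in auto)
        thus "b' \<in> Span K ?D" using S(2) b' cs(1) by auto
      qed
      hence bD: "b \<in> Span K ?D" using mono_Span_subset[OF K _ Dc] cs(2) by blast
      have "b \<in> set ?D"
      proof (rule ccontr)
        assume n: "b \<notin> set ?D"
        have "b # remdups ?D \<in> lists B" "distinct (b # remdups ?D)" using b D n by (auto simp: subset_iff)
        hence "independent K (map (\<lambda>b. b) (b # remdups ?D))" using fiB unfolding family_independent_def by blast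
        hence "b \<notin> Span K (remdups ?D)" using independent_backwards(1) by fastforce
        moreover have "Span K (remdups ?D) = Span K ?D" by (rule Span_same_set[OF K, symmetric, OF Dc]) simp
        ultimately show False using bD by simp
      qed
      thus "b \<in> (\<Union>b'\<in>B'. set (S b'))" using cs(1) by auto
    qed
    hence "(card_of B, card_of (\<Union>b'\<in>B'. set (S b'))) \<in> ordLeq" by (rule card_of_mono1)
    moreover have "(card_of (\<Union>b'\<in>B'. set (S b')), card_of B') \<in> ordLeq"
    proof (rule card_of_UNION_ordLeq_infinite[OF False])
      show "(card_of B', card_of B') \<in> ordLeq" using card_of_Card_order card_of_mono1 by blast
      show "\<forall>i\<in>B'. (card_of (set (S i)), card_of B') \<in> ordLeq"
        using ordLess_imp_ordLeq[OF finite_ordLess_infinite2[OF finite_set False]] by blast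
    qed
    ultimately show ?thesis by (rule ordLeq_transitive)
  qed
qed

end

section \<open>Consequences of condition 1: degree, torsion and separability\<close>

context radical_system
begin

lemma x_inj: "inj_on x I"
proof (rule inj_onI)
  fix i j assume "i \<in> I" "j \<in> I" "x i = x j"
  moreover have "x j \<in> carrier R" using x_U[OF \<open>j \<in> I\<close>] U_closed(1) by blast
  ultimately show "i = j" using distinct[of i j \<one>] K_closed(3) by simp
qed

lemma x_image_basis:
  assumes fi: "family_independent K x I" shows "is_basis K E (x ` I)"
proof -
  have li: "lists (x ` I) = map x ` lists I" by (rule lists_image)
  have "family_independent K (\<lambda>b. b) (x ` I)"
    unfolding family_independent_def
  proof (intro ballI impI)
    fix bs assume "bs \<in> lists (x ` I)" "distinct bs"
    then obtain xs where "xs \<in> lists I" "bs = map x xs" "distinct xs" unfolding li using distinct_map by blast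
    thus "independent K (map (\<lambda>b. b) bs)" using fi unfolding family_independent_def by simp
  qed
  moreover have "family_span K (\<lambda>b. b) (x ` I) = family_span K x I"
    unfolding family_span_def li by (simp del: Span.simps)
  ultimately show ?thesis unfolding is_basis_def E by simp
qed

text \<open>The degree is defined by an arbitrary choice of basis, so that basis is compared in both
  directions with the one formed by the x i.\<close>

lemma ext_degree_eq:
  assumes fi: "family_independent K x I" shows "(ext_degree K E, card_of I) \<in> ordIso"
proof -
  let ?B = "SOME B. is_basis K E B"
  note b = x_image_basis[OF fi]
  have B: "is_basis K E ?B" using someI[of "is_basis K E", OF b] .
  have car: "C \<subseteq> carrier R" if "is_basis K E C" for C
  proof
    fix v assume "v \<in> C"
    hence "independent K (map (\<lambda>b. b) [v])" using that unfolding is_basis_def family_independent_def by (auto simp del: list.map)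
    thus "v \<in> carrier R" using independent_in_carrier by fastforce
  qed
  have "(card_of ?B, card_of (x ` I)) \<in> ordIso"
    using bases_card_le[OF K B b car[OF B] car[OF b]] bases_card_le[OF K b B car[OF b] car[OF B]]
    by (simp add: ordIso_iff_ordLeq)
  moreover have "(card_of (x ` I), card_of I) \<in> ordIso"
    using card_of_ordIsoI[OF inj_on_imp_bij_betw[OF x_inj]] ordIso_symmetric by blast
  ultimately show ?thesis unfolding ext_degree_def by (rule ordIso_transitive)
qed

lemma power_proportional_imp_mem:
  assumes "u \<in> U" "u [^] (k::nat) = c \<otimes> u [^] j" "j < k" "c \<in> K"
  shows "u [^] (k - j) \<in> K"
proof -
  note uc = U_closed(1,2)[OF assms(1)]
  have nz: "u [^] j \<noteq> \<zero>" "u [^] j \<in> carrier R" using pow_nonzero[OF uc] uc by auto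
  have cc: "c \<in> carrier R" using K_closed(1) assms by auto
  have "u [^] (k - j) \<otimes> u [^] j = c \<otimes> u [^] j" using assms(2,3) uc by (simp add: nat_pow_mult)
  hence "u [^] (k - j) = c" using m_rcancel[OF nz] uc cc by simp
  thus ?thesis using assms(4) by simp
qed

lemma idx_power_inj:
  assumes u: "u \<in> U" and n: "\<And>n. n > 0 \<Longrightarrow> u [^] (n::nat) \<notin> K" and eq: "idx (u [^] (j::nat)) = idx (u [^] (k::nat))"
  shows "j = k"
proof -
  have False if jk: "idx (u [^] j) = idx (u [^] k)" "j < k" for j k :: nat
  proof -
    obtain c where "c \<in> K" "u [^] k = c \<otimes> u [^] j"
      using idx_eq_imp[OF U_closed(6)[OF u] U_closed(6)[OF u], of k j] jk(1) by auto
    thus False using power_proportional_imp_mem[OF u _ jk(2)] n[of "k - j"] jk(2) by auto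
  qed
  from this[of j k] this[of k j] eq show ?thesis by (metis nat_neq_iff)
qed

text \<open>
  If the powers of $u$ lie in distinct classes and $w = (u-1)^{-1}$ is a combination of the list
  $us$, then $1 + u + \dots + u^{n-1} = u^n w - w$ involves at most $2 |us|$ classes.
\<close>

lemma torsion_of_subfield:
  assumes fi: "family_independent K x I" and sf: "subfield E R" and u: "u \<in> U"
  shows "\<exists>n>0. u [^] (n::nat) \<in> K"
proof (rule ccontr)
  assume "\<not> (\<exists>n>0. u [^] (n::nat) \<in> K)"
  hence nK: "u [^] (n::nat) \<notin> K" if "n > 0" for n using that by blast
  note uc = U_closed(1,2)[OF u]
  have KR: "K \<subseteq> carrier R" using K_closed(1) by auto
  have s0: "u \<ominus> \<one> \<noteq> \<zero>" using nK[of 1] K_closed(3) uc by (auto simp: r_right_minus_eq)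
  have sc: "u \<ominus> \<one> \<in> carrier R" using uc by simp
  have sE: "u \<ominus> \<one> \<in> E" using subfield_closed(3,9)[OF sf] U_sub_E u by blast
  define w where "w = inv (u \<ominus> \<one>)"
  have w: "w \<in> carrier R" "(u \<ominus> \<one>) \<otimes> w = \<one>" using nonzero_inv[OF sc s0] unfolding w_def by auto
  have "w \<in> E" unfolding w_def by (rule subfield_closed(7)[OF sf sE s0])
  then obtain us where us: "set us \<subseteq> U" "w \<in> Span K us" using E_iff by auto
  have usc: "set us \<subseteq> carrier R" using us U_closed(1) by auto
  \<comment> \<open>One more than the length of \<open>T\<close>, so by pigeonhole some u^k with k <
    n has a class not met by \<open>T\<close>.\<close>
  define n where "n = Suc (2 * length us)"
  let ?vs = "map (\<lambda>s. u [^] n \<otimes> s) us"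
  define T where "T = us @ ?vs"
  have unU: "u [^] k \<in> U" for k :: nat using U_closed(6)[OF u] .
  have T_U: "set T \<subseteq> U" unfolding T_def using us(1) U_closed(4)[OF unU] by auto
  have "card (idx ` set T) \<le> length T" using card_image_le[of "set T" idx] card_length[of T] by simp
  hence cT: "card (idx ` set T) < n" unfolding T_def n_def by simp
  have "\<exists>k<n. idx (u [^] k) \<notin> idx ` set T"
  proof (rule ccontr)
    assume "\<not> (\<exists>k<n. idx (u [^] k) \<notin> idx ` set T)"
    hence sub: "(\<lambda>k::nat. idx (u [^] k)) ` {..<n} \<subseteq> idx ` set T" by auto
    have "inj_on (\<lambda>k::nat. idx (u [^] k)) {..<n}" using idx_power_inj[OF u nK] by (simp add: inj_on_def)
    from card_inj_on_le[OF this sub] cT show False by simp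
  qed
  then obtain k where k: "k < n" "idx (u [^] k) \<notin> idx ` set T" by auto
  \<comment> \<open>All terms of the relation other than u^k. As \<open>T\<close> misses the class
    of u^k, that class would have to be shared with another power of u.\<close>
  define W where "W = T @ map (\<lambda>j. u [^] j) (filter (\<lambda>j. j \<noteq> k) [0..<n])"
  have W_U: "set W \<subseteq> U" unfolding W_def using T_U unU by auto
  have Wc: "set W \<subseteq> carrier R" using W_U U_closed(1) by auto
  let ?S = "Span K W"
  have sa: "subalgebra K ?S R" by (rule Span_is_subalgebra[OF K Wc])
  have SR: "?S \<subseteq> carrier R" using subalgebra_in_carrier[OF sa] .
  have add_S: "a \<oplus> b \<in> ?S" if "a \<in> ?S" "b \<in> ?S" for a b
    using subgroup.m_closed[OF subalgebra.axioms(1)[OF sa] that] by simp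
  have inv_S: "\<ominus> a \<in> ?S" if "a \<in> ?S" for a
    using subgroup.m_inv_closed[OF subalgebra.axioms(1)[OF sa] that] by (simp add: a_inv_def)
  have "set us \<subseteq> set W" unfolding W_def T_def by auto
  hence w_S: "w \<in> ?S" using mono_Span_sublist[OF K _ Wc] us(2) by blast
  have "set us \<subseteq> {v \<in> carrier R. u [^] n \<otimes> v \<in> ?S}"
  proof
    fix v assume v: "v \<in> set us"
    hence "u [^] n \<otimes> v \<in> set W" unfolding W_def T_def by auto
    thus "v \<in> {v \<in> carrier R. u [^] n \<otimes> v \<in> ?S}" using Span_base_incl[OF K Wc] usc v by auto
  qed
  hence "Span K us \<subseteq> {v \<in> carrier R. u [^] n \<otimes> v \<in> ?S}"
    by (rule subalgebra_Span_incl[OF K subalgebra_preimage_mult[OF sa nat_pow_closed[OF uc(1)] KR]])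
  hence uw_S: "u [^] n \<otimes> w \<in> ?S" using us(2) by auto
  let ?G = "eval (replicate n \<one>) u"
  note g = eval_geometric[OF uc(1), of n]
  have uj: "u [^] j \<in> carrier R" for j :: nat using uc by simp
  have "?G \<otimes> ((u \<ominus> \<one>) \<otimes> w) = (u [^] n \<ominus> \<one>) \<otimes> w" using g sc w(1) by (simp add: m_assoc[symmetric])
  hence "?G = u [^] n \<otimes> w \<oplus> \<ominus> w" using g(1) w uj by (simp add: l_distr l_minus a_minus_def)
  hence G_S: "?G \<in> ?S" using add_S[OF uw_S inv_S[OF w_S]] by simp
  have "{..<n} = insert k ({..<n} - {k})" using k by auto
  moreover have "(\<Oplus>j\<in>insert k ({..<n} - {k}). u [^] j) = u [^] k \<oplus> (\<Oplus>j\<in>{..<n} - {k}. u [^] j)"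
    by (rule finsum_insert) (use uc in auto)
  ultimately have G2: "?G = u [^] k \<oplus> (\<Oplus>j\<in>{..<n} - {k}. u [^] j)" using g(3) by simp
  have rest: "(\<Oplus>j\<in>{..<n} - {k}. u [^] j) \<in> ?S"
  proof (rule subgroup_finsum_closed[OF subalgebra.axioms(1)[OF sa]])
    fix j assume "j \<in> {..<n} - {k}"
    hence "u [^] j \<in> set W" unfolding W_def by auto
    thus "u [^] j \<in> ?S" using Span_base_incl[OF K Wc] by blast
  qed simp
  have "u [^] k = ?G \<oplus> \<ominus> (\<Oplus>j\<in>{..<n} - {k}. u [^] j)"
    unfolding G2 using uj subsetD[OF SR rest] by (simp add: a_assoc r_neg)
  hence "u [^] k \<in> ?S" using add_S[OF G_S inv_S[OF rest]] by simp
  from Span_mem_idx[OF fi unU W_U this] k(2)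
  obtain j where "j \<noteq> k" "idx (u [^] k) = idx (u [^] j)" unfolding W_def by auto
  thus False using idx_power_inj[OF u nK, of k j] by auto
qed

text \<open>Solving 1 + u + ... + u^(q-1) = 0 for 1 puts 1 in the span of the other powers, so 1 is
  proportional to some u^j with 0 < j < q. Then u^j lies in K, and u is a power of it.\<close>

lemma root_of_unity_mem:
  assumes fi: "family_independent K x I" and q: "prime (q::nat)" and u: "u \<in> U" "u [^] q = \<one>"
  shows "u \<in> K"
proof (rule ccontr)
  assume nK: "u \<notin> K"
  note uc = U_closed(1,2)[OF u(1)]
  have q0: "q > 0" using q prime_gt_0_nat by blast
  note g = eval_geometric[OF uc(1), of q]
  have "eval (replicate q \<one>) u \<otimes> (u \<ominus> \<one>) = \<zero>" unfolding g(2) u(2) by (simp add: a_minus_def r_neg)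
  moreover have "u \<ominus> \<one> \<noteq> \<zero>" using nK K_closed(3) uc by (auto simp: r_right_minus_eq)
  ultimately have "eval (replicate q \<one>) u = \<zero>" using integral[OF _ g(1) minus_closed[OF uc(1) one_closed]] by blast
  moreover note g(3)
  moreover have "{..<q} = insert 0 {1..<q}" using q0 by auto
  moreover have "(\<Oplus>j\<in>insert 0 {1..<q}. u [^] j) = u [^] (0::nat) \<oplus> (\<Oplus>j\<in>{1..<q}. u [^] j)"
    by (rule finsum_insert) (use uc in auto)
  ultimately have s: "\<one> \<oplus> (\<Oplus>j\<in>{1..<q}. u [^] j) = \<zero>" by simp
  let ?W = "map (\<lambda>j. u [^] j) [1..<q]"
  have W_U: "set ?W \<subseteq> U" using U_closed(6)[OF u(1)] by auto
  have Wc: "set ?W \<subseteq> carrier R" using W_U U_closed(1) by auto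
  have sa: "subalgebra K (Span K ?W) R" by (rule Span_is_subalgebra[OF K Wc])
  have "(\<Oplus>j\<in>{1..<q}. u [^] j) \<in> Span K ?W"
  proof (rule subgroup_finsum_closed[OF subalgebra.axioms(1)[OF sa]])
    fix j assume "j \<in> {1..<q}"
    hence "u [^] j \<in> set ?W" by auto
    thus "u [^] j \<in> Span K ?W" using Span_base_incl[OF K Wc] by blast
  qed simp
  hence "\<ominus> (\<Oplus>j\<in>{1..<q}. u [^] j) \<in> Span K ?W"
    using subgroup.m_inv_closed[OF subalgebra.axioms(1)[OF sa]] by (simp add: a_inv_def)
  moreover have "\<one> = \<ominus> (\<Oplus>j\<in>{1..<q}. u [^] j)"
    using s minus_equality[of \<one> "\<Oplus>j\<in>{1..<q}. u [^] j"] uc by (simp add: Pi_def)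
  ultimately have "\<one> \<in> Span K ?W" by simp
  then obtain v c where v: "v \<in> set ?W" "c \<in> K" "\<one> = c \<otimes> v"
    using Span_mem_proportional[OF fi U_closed(3) W_U] by blast
  then obtain j where j: "1 \<le> j" "j < q" "v = u [^] j" by auto
  have cc: "c \<in> carrier R" "v \<in> carrier R" using v(2) K_closed(1) j uc by auto
  have c0: "c \<noteq> \<zero>" using v(3) cc by auto
  have "v = inv c" using comm_inv_char[OF cc v(3)[symmetric]] by simp
  hence vK: "u [^] j \<in> K" using K_closed(7)[OF v(2) c0] j by simp
  have "\<not> q dvd j" using j by (auto dest: dvd_imp_le)
  from power_coprime_eq[OF q this uc(1) u(2)] show False using nK K_closed(8)[OF vK] by metis
qed

text \<open>As a combination of 1 and i, an element 1 + i of U would be proportional to one of them;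
  either equation can be solved for i in K.\<close>

lemma one_plus_i_not_mem:
  assumes fi: "family_independent K x I" and i: "i \<in> U" "i \<notin> K"
  shows "\<one> \<oplus> i \<notin> U"
proof
  assume s: "\<one> \<oplus> i \<in> U"
  note ic = U_closed(1,2)[OF i(1)]
  have W: "set [\<one>, i] \<subseteq> U" using i U_closed(3) by auto
  have Wc: "set [\<one>, i] \<subseteq> carrier R" using ic by auto
  have "\<one> \<oplus> i \<in> Span K [\<one>, i]"
    using subgroup.m_closed[OF Span_is_add_subgroup[OF K Wc], of \<one> i] Span_base_incl[OF K Wc] by simp
  then obtain v c where v: "v \<in> {\<one>, i}" "c \<in> K" "\<one> \<oplus> i = c \<otimes> v" using Span_mem_proportional[OF fi s W] by auto
  have cc: "c \<in> carrier R" using v K_closed(1) by auto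
  show False
  proof (cases "v = \<one>")
    case True
    hence e: "\<one> \<oplus> i = c" using v cc by simp
    have "i = (\<one> \<oplus> i) \<ominus> \<one>" using ic(1) by algebra
    hence "i = c \<ominus> \<one>" unfolding e .
    thus False using i(2) K_closed(3,9) v(2) by metis
  next
    case False
    hence e: "\<one> \<oplus> i = c \<otimes> i" using v by simp
    have "(c \<ominus> \<one>) \<otimes> i = c \<otimes> i \<ominus> i" using ic cc by algebra
    also have "\<dots> = \<one>" unfolding e[symmetric] using ic by algebra
    finally have o: "(c \<ominus> \<one>) \<otimes> i = \<one>" .
    have dK: "c \<ominus> \<one> \<in> K" using K_closed(3,9) v(2) by blast
    have d0: "c \<ominus> \<one> \<noteq> \<zero>" using o ic by auto
    have "i = inv (c \<ominus> \<one>)" using comm_inv_char[OF _ ic(1) o] K_closed(1)[OF dK] by simp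
    thus False using i(2) K_closed(7)[OF dK d0] by simp
  qed
qed

lemma E_separable_algebraic:
  assumes sf: "subfield E R" and torsion: "\<And>u. u \<in> U \<Longrightarrow> \<exists>n>0. u [^] (n::nat) \<in> K"
    and char_torsion: "\<And>q u. \<lbrakk> prime (q::nat); [q] \<cdot> \<one> = \<zero>; u \<in> U; u [^] q \<in> K \<rbrakk> \<Longrightarrow> u \<in> K"
  shows "separable_algebraic_ext K E"
  unfolding separable_algebraic_ext_def
proof (intro conjI ballI)
  show "subfield K R" "subfield E R" "K \<subseteq> E" using K sf K_sub_E by auto
  fix y assume y: "y \<in> E"
  show alg: "(algebraic over K) y" by (rule E_algebraic[OF torsion y])
  have yc: "y \<in> carrier R" using y E_carrier by auto
  obtain us where us: "set us \<subseteq> U" "y \<in> finite_extension K us" using E_mem_finite_extension[OF torsion y] by metis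
  have us0: "set us \<subseteq> carrier R - {\<zero>}" using us(1) U_closed(1,2) by blast
  \<comment> \<open>The q-part of the exponent is removed: u^m has a power with exponent q^k in K,
    so u^m itself lies in K.\<close>
  have prime_tors: "\<exists>n>0. u [^] (n::nat) \<in> K \<and> \<not> q dvd n"
    if q: "prime (q::nat)" "[q] \<cdot> \<one> = \<zero>" and u: "u \<in> set us" for q u
  proof -
    have uU: "u \<in> U" using us(1) u by auto
    obtain n where n: "n > 0" "u [^] (n::nat) \<in> K" using torsion[OF uU] by auto
    obtain k m where km: "\<not> q dvd m" "n = m * q ^ k" using prime_power_canonical[OF q(1) n(1)] by blast
    have "(u [^] m) [^] (q ^ k) \<in> K" using n(2) km(2) U_closed(1)[OF uU] by (simp add: nat_pow_pow)
    hence "u [^] m \<in> K"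
      by (rule prime_power_descent[OF q(1) _ U_closed(6), rotated -1]) (use char_torsion[OF q] U_closed(1,6) uU in blast)+
    moreover have "m > 0" using km(1) by (cases m) auto
    ultimately show ?thesis using km(1) by blast
  qed
  show "separable_poly K (Irr K y)"
  proof (rule separable_poly_Irr[OF K yc alg poly_deriv_Irr_nonzero[OF K yc alg]])
    fix q assume q: "prime (q::nat)" "[q] \<cdot> \<one> = \<zero>"
    show "(algebraic over K) (y [^] q)" by (rule E_algebraic[OF torsion subfield_closed(8)[OF sf y]])
    show "degree (Irr K y) \<le> degree (Irr K (y [^] q))"
      by (rule degree_Irr_pow_ge[OF K q us0 prime_tors[OF q] us(2)])
  qed
qed

end

section \<open>Translation of the group-theoretic hypotheses to elements\<close>

context field
begin

lemma subgroup_units_of_iff: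
  assumes U: "mult_subgroup U"
  shows "subgroup F ((units_of R)\<lparr>carrier := U\<rparr>) \<longleftrightarrow> mult_subgroup F \<and> F \<subseteq> U"
proof -
  interpret G: group "units_of R" by (rule units_group)
  have sU: "subgroup U (units_of R)" using U subgroup_units_iff by simp
  show ?thesis
    using G.incl_subgroup[OF sU, of F] G.subgroup_incl[OF _ sU, of F] subgroup_units_iff[of F]
      subgroup.subset[of F "(units_of R)\<lparr>carrier := U\<rparr>"] by auto
qed

text \<open>Forward, the cyclic group generated by some u other than 1 meets K^\<times>
  nontrivially. This gives torsion; for u^q = 1 it gives a power with exponent prime to q in K,
  hence u in K. Backward, an element of F has a power in F and K, which is 1, and descent through
  the primes of the exponent shows that the element is 1.\<close>

lemma essential_extension_iff:
  assumes K: "subfield K R" and U: "mult_subgroup U" and K_U: "K - {\<zero>} \<subseteq> U"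
  shows "essential_extension ((units_of R)\<lparr>carrier := U\<rparr>) (K - {\<zero>}) \<longleftrightarrow>
    (\<forall>u\<in>U. \<exists>n>0. u [^] (n::nat) \<in> K) \<and>
    (\<forall>q u. prime (q::nat) \<longrightarrow> u \<in> U \<longrightarrow> u [^] q = \<one> \<longrightarrow> u \<in> K)"
proof -
  note Kc = subfield_closed[OF K] note Uc = mult_subgroupD[OF U]
  have one: "\<one>\<^bsub>(units_of R)\<lparr>carrier := U\<rparr>\<^esub> = \<one>" by (simp add: units_of_one)
  have sH: "subgroup (K - {\<zero>}) ((units_of R)\<lparr>carrier := U\<rparr>)"
    using subgroup_units_of_iff[OF U] mult_subgroup_subfield[OF K] K_U by simp
  have "essential_extension ((units_of R)\<lparr>carrier := U\<rparr>) (K - {\<zero>}) \<longleftrightarrow>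
      (\<forall>F. mult_subgroup F \<and> F \<subseteq> U \<and> F \<inter> (K - {\<zero>}) = {\<one>} \<longrightarrow> F = {\<one>})"
    unfolding essential_extension_def one using sH subgroup_units_of_iff[OF U] by simp
  also have "\<dots> \<longleftrightarrow> (\<forall>u\<in>U. \<exists>n>0. u [^] (n::nat) \<in> K) \<and>
    (\<forall>q u. prime (q::nat) \<longrightarrow> u \<in> U \<longrightarrow> u [^] q = \<one> \<longrightarrow> u \<in> K)"
    (is "?ess \<longleftrightarrow> ?tors \<and> ?roots")
  proof (intro iffI conjI)
    assume ess: ?ess
    have power: "\<exists>n::nat. u [^] n \<in> K \<and> u [^] n \<noteq> \<one>" if u: "u \<in> U" "u \<noteq> \<one>" for u
    proof -
      interpret G: group "units_of R" by (rule units_group)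
      note uc = Uc(1,2)[OF u(1)]
      have sU: "subgroup U (units_of R)" using U subgroup_units_iff by simp
      have uG: "u \<in> carrier (units_of R)" using uc field_Units by (simp add: units_of_carrier)
      let ?F = "range (\<lambda>n::int. u [^]\<^bsub>units_of R\<^esub> n)"
      have nat: "u [^]\<^bsub>units_of R\<^esub> int n = u [^] n" for n :: nat
        using uG by (simp add: int_pow_int units_of_pow units_of_carrier)
      have F: "mult_subgroup ?F" using G.subgroup_of_powers[OF uG] subgroup_units_iff by simp
      have FU: "?F \<subseteq> U" using G.subgroup_int_pow_closed[OF sU u(1)] by auto
      have "u \<in> ?F" using nat[of 1] uc by (metis nat_pow_eone rangeI)
      hence "?F \<inter> (K - {\<zero>}) \<noteq> {\<one>}" using ess F FU u(2) by blast
      moreover have "\<one> \<in> ?F \<inter> (K - {\<zero>})" using mult_subgroupD(3)[OF F] Kc(3) by simp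
      ultimately have "\<not> ?F \<inter> (K - {\<zero>}) \<subseteq> {\<one>}" by (metis subset_singletonD empty_iff)
      then obtain k :: int where k: "u [^]\<^bsub>units_of R\<^esub> k \<in> K - {\<zero>}" "u [^]\<^bsub>units_of R\<^esub> k \<noteq> \<one>" by blast
      show ?thesis
      proof (cases "k \<ge> 0")
        case True
        hence "u [^] nat k = u [^]\<^bsub>units_of R\<^esub> k" using nat[of "nat k"] by (simp only: nat_0_le)
        thus ?thesis using k by (metis Diff_iff)
      next
        case False
        \<comment> \<open>A negative power in K is replaced by its inverse, which has a positive
          exponent.\<close>
        let ?n = "nat (- k)"
        have n0: "u [^] ?n \<in> carrier R" "u [^] ?n \<noteq> \<zero>" using pow_nonzero[OF uc] uc by auto
        have "u [^]\<^bsub>units_of R\<^esub> k \<otimes> u [^] ?n = u [^]\<^bsub>units_of R\<^esub> (k + int ?n)"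
          using G.int_pow_mult[OF uG, of k "int ?n"] nat[of ?n] by (simp add: units_of_mult)
        also have "\<dots> = \<one>" using False nat[of 0] by simp
        finally have e: "u [^]\<^bsub>units_of R\<^esub> k \<otimes> u [^] ?n = \<one>" .
        have kc: "u [^]\<^bsub>units_of R\<^esub> k \<in> carrier R" using k(1) Kc(1) by auto
        have "inv (u [^]\<^bsub>units_of R\<^esub> k) = u [^] ?n" using comm_inv_char[OF kc n0(1) e] .
        hence "u [^] ?n \<in> K" using k(1) Kc(7) by force
        moreover have "u [^] ?n \<noteq> \<one>" using e k(2) kc by auto
        ultimately show ?thesis by blast
      qed
    qed
    show ?tors
    proof
      fix u assume u: "u \<in> U"
      show "\<exists>n>0. u [^] (n::nat) \<in> K"
      proof (cases "u = \<one>")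
        case True thus ?thesis using Kc(3) by auto
      next
        case False
        then obtain n :: nat where n: "u [^] n \<in> K" "u [^] n \<noteq> \<one>" using power[OF u] by auto
        hence "n > 0" by (cases n) auto
        thus ?thesis using n(1) by blast
      qed
    qed
    show ?roots
    proof (intro allI impI)
      fix q u assume q: "prime (q::nat)" and u: "u \<in> U" "u [^] q = \<one>"
      show "u \<in> K"
      proof (cases "u = \<one>")
        case True thus ?thesis using Kc(3) by simp
      next
        case False
        then obtain n :: nat where n: "u [^] n \<in> K" "u [^] n \<noteq> \<one>" using power[OF u(1)] by auto
        have "\<not> q dvd n"
        proof
          assume "q dvd n"
          then obtain m where "n = q * m" ..
          thus False using n(2) nat_pow_pow[OF Uc(1)[OF u(1)], of q m] u(2) by simp
        qed
        from power_coprime_eq[OF q this Uc(1)[OF u(1)] u(2)] show ?thesis using Kc(8)[OF n(1)] by metis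
      qed
    qed
  next
    assume tr: "?tors \<and> ?roots"
    show ?ess
    proof (intro allI impI, elim conjE)
      fix F assume F: "mult_subgroup F" "F \<subseteq> U" "F \<inter> (K - {\<zero>}) = {\<one>}"
      note Fc = mult_subgroupD[OF F(1)]
      have FK: "g = \<one>" if "g \<in> F" "g \<in> K" for g using F(3) that Fc(2) by blast
      have "f = \<one>" if f: "f \<in> F" for f
      proof -
        obtain n where n: "n > 0" "f [^] (n::nat) \<in> K" using tr f F(2) by blast
        have "f \<in> {\<one>}"
        proof (rule exponent_descent[OF _ Fc(6) n(1) _ f])
          show "f [^] n \<in> {\<one>}" using FK[OF Fc(6)[OF f] n(2)] by simp
        qed (use FK tr F(2) Fc(1) in blast)+
        thus ?thesis by simp
      qed
      thus "F = {\<one>}" using Fc(3) by blast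
    qed
  qed
  finally show ?thesis .
qed

text \<open>Order 4 makes i^2 a square root of 1 other than 1. Conversely i^2 = 1 would give i = 1
  or i = -1, both in K. In characteristic 2 both sides are false.\<close>

lemma ord_eq_4_iff:
  assumes K: "subfield K R" and i: "i \<in> carrier R" "i \<noteq> \<zero>" "i \<notin> K"
  shows "group.ord (units_of R) i = 4 \<longleftrightarrow> i \<otimes> i = \<ominus> \<one>"
proof -
  interpret G: group "units_of R" by (rule units_group)
  have iU: "i \<in> Units R" using i field_Units by auto
  have id: "i [^] n = \<one> \<longleftrightarrow> G.ord i dvd n" for n :: nat
    using G.pow_eq_id[of i n] iU by (simp add: units_of_carrier units_of_pow units_of_one)
  have sq: "i [^] (2::nat) = i \<otimes> i" using i by (simp add: numeral_2_eq_2)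
  have i4: "i [^] (4::nat) = (i \<otimes> i) \<otimes> (i \<otimes> i)" using i sq nat_pow_mult[OF i(1), of 2 2] by simp
  have m: "\<ominus> \<one> \<otimes> \<ominus> \<one> = \<one>" using l_minus[of \<one> "\<ominus> \<one>"] by simp
  show ?thesis
  proof
    assume o: "G.ord i = 4"
    have "i [^] (4::nat) = \<one>" using id[of 4] o by simp
    hence "(i \<otimes> i) \<otimes> (i \<otimes> i) = \<one> \<otimes> \<one>" using i4 by simp
    hence "i \<otimes> i = \<one> \<or> i \<otimes> i = \<ominus> \<one>" using square_eq_cases[of "i \<otimes> i" \<one>] i by simp
    moreover have "i \<otimes> i \<noteq> \<one>" using id[of 2] o sq by auto
    ultimately show "i \<otimes> i = \<ominus> \<one>" by blast
  next
    assume e: "i \<otimes> i = \<ominus> \<one>"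
    have "i \<otimes> i \<noteq> \<one>"
    proof
      assume "i \<otimes> i = \<one>"
      hence "i = \<one> \<or> i = \<ominus> \<one>" using square_eq_cases[OF i(1) one_closed] by simp
      thus False using i(3) subfield_closed(3,4)[OF K] by blast
    qed
    hence n2: "\<not> G.ord i dvd 2" using id[of 2] sq by simp
    have d4: "G.ord i dvd 4" using id[of 4] i4 e m by simp
    have "G.ord i \<le> 4" using d4 by (auto dest: dvd_imp_le)
    moreover have "G.ord i \<noteq> 0" using d4 by (intro notI) simp
    moreover have "G.ord i \<noteq> 1" "G.ord i \<noteq> 2" using n2 by auto
    moreover have "G.ord i \<noteq> 3" using d4 by (intro notI) simp
    ultimately show "G.ord i = 4" by linarith
  qed
qed

lemma ring_char_eq_prime:
  assumes K: "subfield K R" and q: "prime (q::nat)" "[q] \<cdot> \<one> = \<zero>"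
  shows "ring_char (R\<lparr>carrier := K\<rparr>) = q"
proof -
  interpret k: ring "R\<lparr>carrier := K\<rparr>" by (rule subring_is_ring[OF subfieldE(1)[OF K]])
  have pow: "\<one> [^]\<^bsub>add_monoid (R\<lparr>carrier := K\<rparr>)\<^esub> n = [n] \<cdot> \<one>" for n :: nat
    by (induct n) (simp_all add: nat_pow_def add_pow_def)
  have id: "[n] \<cdot> \<one> = \<zero> \<longleftrightarrow> ring_char (R\<lparr>carrier := K\<rparr>) dvd n" for n :: nat
  proof -
    have "[n] \<cdot>\<^bsub>R\<lparr>carrier := K\<rparr>\<^esub> \<one> = [n] \<cdot> \<one>" using pow[of n] by (simp add: add_pow_def)
    thus ?thesis using k.add.pow_eq_id[of \<one> n] subfield_closed(3)[OF K] by (simp add: ring_char_def)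
  qed
  have "ring_char (R\<lparr>carrier := K\<rparr>) dvd q" using id q(2) by simp
  moreover have "ring_char (R\<lparr>carrier := K\<rparr>) \<noteq> 1" using id[of 1] by auto
  ultimately show ?thesis using q(1) by (metis One_nat_def prime_nat_iff)
qed

lemma primary_torsion_Mod_trivial:
  assumes K: "subfield K R"
    and triv: "primary_torsion (units_of R Mod (K - {\<zero>})) q = {\<one>\<^bsub>units_of R Mod (K - {\<zero>})\<^esub>}"
    and u: "u \<in> carrier R" "u \<noteq> \<zero>" "u [^] q \<in> K"
  shows "u \<in> K"
proof -
  interpret G: comm_group "units_of R" by (rule units_comm_group)
  let ?H = "K - {\<zero>}" and ?Q = "units_of R Mod (K - {\<zero>})"
  have sH: "subgroup ?H (units_of R)" using mult_subgroup_subfield[OF K] subgroup_units_iff by simp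
  interpret N: normal ?H "units_of R" by (rule G.subgroup_imp_normal[OF sH])
  have uU: "u \<in> carrier (units_of R)" using u field_Units by (simp add: units_of_carrier)
  let ?c = "\<lambda>v. ?H #>\<^bsub>units_of R\<^esub> v"
  have pow: "?c (u [^]\<^bsub>units_of R\<^esub> n) = ?c u [^]\<^bsub>?Q\<^esub> n" for n :: nat
    by (rule hom_nat_pow[OF N.r_coset_hom_Mod uU G.group_axioms N.factorgroup_is_group])
  have memc: "v \<in> ?H" if v: "v \<in> carrier (units_of R)" "?c v = ?H" for v
    using G.rcos_self[OF v(1) sH] v(2) by simp
  have "u [^]\<^bsub>units_of R\<^esub> q \<in> ?H"
    using u pow_nonzero[OF u(1,2)] uU by (simp add: units_of_pow units_of_carrier)
  hence "?c (u [^]\<^bsub>units_of R\<^esub> q) = ?H" using G.coset_join2[OF _ sH] uU by simp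
  hence "?c u [^]\<^bsub>?Q\<^esub> (q ^ 1) = \<one>\<^bsub>?Q\<^esub>" using pow[of q] by simp
  moreover have "?c u \<in> carrier ?Q" using uU by (auto simp: carrier_FactGroup)
  ultimately have "?c u \<in> primary_torsion ?Q q" unfolding primary_torsion_def by blast
  hence "?c u = ?H" using triv by simp
  thus ?thesis using memc[OF uU] by simp
qed

text \<open>Lying in the coset of x i means being a nonzero K-multiple of it. Surjectivity onto the
  cosets thus becomes \<open>cover\<close>, injectivity becomes \<open>distinct\<close>.\<close>

lemma coset_representatives_radical_system:
  assumes K: "subfield K R" and U: "mult_subgroup U" and K_U: "K - {\<zero>} \<subseteq> U"
    and rep: "coset_representatives ((units_of R)\<lparr>carrier := U\<rparr>) (K - {\<zero>}) I x" and E: "E = family_span K x I"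
  shows "radical_system R K U I x E"
proof (intro radical_system.intro radical_system_axioms.intro field_axioms K U K_U E)
  let ?G = "(units_of R)\<lparr>carrier := U\<rparr>" and ?H = "K - {\<zero>}"
  note Uc = mult_subgroupD[OF U]
  have sU: "subgroup U (units_of R)" using U subgroup_units_iff by simp
  interpret G: group ?G by (rule subgroup.subgroup_is_group[OF sU units_group])
  have H: "subgroup ?H ?G" using subgroup_units_of_iff[OF U] mult_subgroup_subfield[OF K] K_U by simp
  have coset: "?H #>\<^bsub>?G\<^esub> v = {h \<otimes> v | h. h \<in> ?H}" for v by (auto simp: r_coset_def units_of_mult)
  have bij: "bij_betw (\<lambda>i. ?H #>\<^bsub>?G\<^esub> x i) I (rcosets\<^bsub>?G\<^esub> ?H)" using rep unfolding coset_representatives_def by simp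
  show xU: "x i \<in> U" if "i \<in> I" for i using rep that unfolding coset_representatives_def by auto
  show "\<exists>i\<in>I. \<exists>k\<in>K. u = k \<otimes> x i" if u: "u \<in> U" for u
  proof -
    have "?H #>\<^bsub>?G\<^esub> u \<in> rcosets\<^bsub>?G\<^esub> ?H" using u unfolding RCOSETS_def by auto
    then obtain i where i: "i \<in> I" "?H #>\<^bsub>?G\<^esub> x i = ?H #>\<^bsub>?G\<^esub> u"
      unfolding bij_betw_imp_surj_on[OF bij, symmetric] by auto
    have "u \<in> ?H #>\<^bsub>?G\<^esub> x i" using G.rcos_self[OF _ H] i(2) u by simp
    thus ?thesis using i(1) unfolding coset by auto
  qed
  show "i = j" if ij: "i \<in> I" "j \<in> I" "k \<in> K" "x i = k \<otimes> x j" for i j k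
  proof -
    have "k \<noteq> \<zero>" using ij(4) Uc(1,2) xU ij(1,2) by (metis l_null)
    hence "x i \<in> ?H #>\<^bsub>?G\<^esub> x j" unfolding coset using ij(3,4) by blast
    hence "?H #>\<^bsub>?G\<^esub> x j = ?H #>\<^bsub>?G\<^esub> x i" by (rule G.repr_independence) (use xU[OF ij(2)] H in auto)
    thus "i = j" using bij ij(1,2) unfolding bij_betw_def inj_on_def by blast
  qed
qed

end

theorem theorem3p1:
  fixes L :: "('a, 'b) ring_scheme" and K U E :: "'a set"
    and I :: "'i set" and x :: "'i \<Rightarrow> 'a"
  assumes "field L" and "subfield K L"
    and "ring_char (L\<lparr>carrier := K\<rparr>) > 0 \<longrightarrow>
           primary_torsion (units_of L Mod (K - {\<zero>\<^bsub>L\<^esub>})) (ring_char (L\<lparr>carrier := K\<rparr>))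
             = {\<one>\<^bsub>units_of L Mod (K - {\<zero>\<^bsub>L\<^esub>})\<^esub>}"
    and "subgroup U (units_of L)" and "K - {\<zero>\<^bsub>L\<^esub>} \<subseteq> U"
    and "coset_representatives ((units_of L)\<lparr>carrier := U\<rparr>) (K - {\<zero>\<^bsub>L\<^esub>}) I x"
    and "E = ring.family_span L K x I"
  shows "unital_subalgebra K E L \<and>
    ((subfield E L \<and> ring.family_independent L K x I)
     \<longleftrightarrow>
     (essential_extension ((units_of L)\<lparr>carrier := U\<rparr>) (K - {\<zero>\<^bsub>L\<^esub>}) \<and>
      (\<forall>i \<in> U. group.ord (units_of L) i = 4 \<and> i \<notin> K \<longrightarrow> \<one>\<^bsub>L\<^esub> \<oplus>\<^bsub>L\<^esub> i \<notin> U))) \<and>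
    ((subfield E L \<and> ring.family_independent L K x I) \<longrightarrow>
      ring.separable_algebraic_ext L K E \<and>
      (ring.ext_degree L K E, group_index ((units_of L)\<lparr>carrier := U\<rparr>) (K - {\<zero>\<^bsub>L\<^esub>})) \<in> ordIso)"
proof -
  interpret L: field L by fact
  have U: "L.mult_subgroup U" using assms(4) L.subgroup_units_iff by simp
  interpret rs: radical_system L K U I x E
    by (rule L.coset_representatives_radical_system[OF assms(2) U assms(5,6,7)])
  let ?G = "(units_of L)\<lparr>carrier := U\<rparr>" and ?H = "K - {\<zero>\<^bsub>L\<^esub>}"
  let ?one = "subfield E L \<and> L.family_independent K x I"
  let ?two = "essential_extension ?G ?H \<and> (\<forall>i \<in> U. group.ord (units_of L) i = 4 \<and> i \<notin> K \<longrightarrow> \<one>\<^bsub>L\<^esub> \<oplus>\<^bsub>L\<^esub> i \<notin> U)"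
  \<comment> \<open>A prime that annihilates 1 is the characteristic, so the hypothesis on primary
    torsion applies; in characteristic zero no such prime exists.\<close>
  have char_torsion: "u \<in> K" if "prime (q::nat)" "[q] \<cdot>\<^bsub>L\<^esub> \<one>\<^bsub>L\<^esub> = \<zero>\<^bsub>L\<^esub>" "u \<in> U" "u [^]\<^bsub>L\<^esub> q \<in> K" for q u
    using L.primary_torsion_Mod_trivial[OF assms(2), of q u] L.ring_char_eq_prime[OF assms(2) that(1,2)]
      assms(3) prime_gt_0_nat[OF that(1)] rs.U_closed(1,2)[OF that(3)] that(4) by simp
  note ess = L.essential_extension_iff[OF assms(2) U assms(5)]
  have ord4: "group.ord (units_of L) i = 4 \<longleftrightarrow> i \<otimes>\<^bsub>L\<^esub> i = \<ominus>\<^bsub>L\<^esub> \<one>\<^bsub>L\<^esub>" if "i \<in> U" "i \<notin> K" for i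
    by (rule L.ord_eq_4_iff[OF assms(2) rs.U_closed(1,2)[OF that(1)] that(2)])
  have sub: "unital_subalgebra K E L" unfolding unital_subalgebra_def using rs.E_subalgebra rs.E_subring by simp
  have 12: ?two if one: ?one
  proof -
    have "\<forall>u\<in>U. \<exists>n>0. u [^]\<^bsub>L\<^esub> (n::nat) \<in> K" using rs.torsion_of_subfield one by blast
    moreover have "\<forall>q u. prime (q::nat) \<longrightarrow> u \<in> U \<longrightarrow> u [^]\<^bsub>L\<^esub> q = \<one>\<^bsub>L\<^esub> \<longrightarrow> u \<in> K"
      using rs.root_of_unity_mem one by blast
    ultimately have "essential_extension ?G ?H" unfolding ess by (rule conjI)
    thus ?two using rs.one_plus_i_not_mem one by blast
  qed
  have 21: ?one if two: ?two
  proof -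
    have tors: "\<exists>n>0. u [^]\<^bsub>L\<^esub> (n::nat) \<in> K" if "u \<in> U" for u using two that unfolding ess by blast
    have roots: "u \<in> K" if "prime (q::nat)" "u \<in> U" "u [^]\<^bsub>L\<^esub> q = \<one>\<^bsub>L\<^esub>" for q u
      using two that unfolding ess by blast
    have one_plus_i: "\<one>\<^bsub>L\<^esub> \<oplus>\<^bsub>L\<^esub> i \<notin> U" if "i \<in> U" "i \<notin> K" "i \<otimes>\<^bsub>L\<^esub> i = \<ominus>\<^bsub>L\<^esub> \<one>\<^bsub>L\<^esub>" for i
      using two ord4[OF that(1,2)] that by blast
    interpret kneser_data L K U
      by (intro kneser_data.intro kneser_data_axioms.intro L.field_axioms)
        (fact assms(2) U assms(5) tors roots one_plus_i char_torsion)+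
    show ?one using kneser_class_independent rs.family_independent_of_class_independent rs.E_subfield[OF tors] by blast
  qed
  have "L.separable_algebraic_ext K E \<and> (L.ext_degree K E, group_index ?G ?H) \<in> ordIso" if one: ?one
  proof
    show "L.separable_algebraic_ext K E"
    proof (rule rs.E_separable_algebraic)
      show "\<exists>n>0. u [^]\<^bsub>L\<^esub> (n::nat) \<in> K" if "u \<in> U" for u using rs.torsion_of_subfield one that by blast
    qed (use one char_torsion in blast)+
    \<comment> \<open>The x i correspond to the cosets, so the cardinality of I links the degree
      with the index.\<close>
    have "bij_betw (\<lambda>i. ?H #>\<^bsub>?G\<^esub> x i) I (rcosets\<^bsub>?G\<^esub> ?H)" using assms(6) unfolding coset_representatives_def by simp
    hence "(card_of I, group_index ?G ?H) \<in> ordIso" unfolding group_index_def by (rule card_of_ordIsoI)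
    thus "(L.ext_degree K E, group_index ?G ?H) \<in> ordIso" using rs.ext_degree_eq one ordIso_transitive by blast
  qed
  thus ?thesis using sub 12 21 by blast
qed
end
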